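(* Let $K\subseteq\mathbb{R}^n$ be a convex body with nonempty interior, let $B_n$ be the Euclidean unit ball of $\mathbb{R}^n$, and let $K_\lambda$, $\lambda\ge -\mathrm{r}(K;B_n)$, denote the inner and outer parallel bodies of $K$ relative to $B_n$. Then the classical isoperimetric quotient $$\lambda\mapsto \mathrm{I}(K_\lambda)=\frac{\mathrm{S}(K_\lambda)^n}{\mathrm{vol}(K_\lambda)^{n-1}}$$ is monotonically decreasing for $\lambda\in(-\mathrm{r}(K;B_n),\infty)$.
   Context: A convex body in $\mathbb{R}^n$ is a nonempty compact convex subset of $\mathbb{R}^n$. $\mathrm{vol}$ denotes $n$-dimensional Lebesgue measure, and $\mathrm{S}(K)$ is the surface area, i.e. the $(n-1)$-dimensional Hausdorff measure of the boundary of $K$. The inradius of $K$ (relative to $B_n$) is $\mathrm{r}(K;B_n)=\sup\{r\ge 0: \text{there is } x\in\mathbb{R}^n \text{ with } x+rB_n\subseteq K\}$. The parallel bodies of $K$ relative to $B_n$ are $K_\lambda=\{x\in\mathbb{R}^n: x+|\lambda|B_n\subseteq K\}$ for $-\mathrm{r}(K;B_n)\le\lambda\le 0$ and $K_\lambda=K+\lambda B_n$ (Minkowski sum) for $\lambda\ge 0$. "Monotonically decreasing" is meant in the weak sense (non-increasing). *)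

theory Defs
  imports "HOL-Analysis.Analysis"
begin

definition convex_body :: "'a::euclidean_space set \<Rightarrow> bool" where
  "convex_body K \<longleftrightarrow> K \<noteq> {} \<and> compact K \<and> convex K"

text \<open>
  The \<open>k\<close>-dimensional Hausdorff (outer) measure, normalised so that it agrees with Lebesgue measure
  on \<open>k\<close>-dimensional Euclidean space. Covers are arbitrary countable covers by bounded sets (the
  library's \<^const>\<open>diameter\<close> is only meaningful on bounded sets). Empty members contribute \<open>0\<close> also
  for \<open>k = 0\<close>, while nonempty ones then contribute \<open>0 ^ 0 = 1\<close>, so that \<open>k = 0\<close> is counting measure.
\<close>

definition hausdorff_content :: "nat \<Rightarrow> real \<Rightarrow> 'a::metric_space set \<Rightarrow> ennreal" where
  "hausdorff_content k \<delta> A =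
     (INF U \<in> {U :: nat \<Rightarrow> 'a set. A \<subseteq> (\<Union>i. U i) \<and> (\<forall>i. bounded (U i) \<and> diameter (U i) \<le> \<delta>)}.
        (\<Sum>i. if U i = {} then 0
              else ennreal (unit_ball_vol (real k) * (diameter (U i) / 2) ^ k)))"

definition hausdorff_measure :: "nat \<Rightarrow> 'a::metric_space set \<Rightarrow> ennreal" where
  "hausdorff_measure k A = (SUP \<delta> \<in> {0<..}. hausdorff_content k \<delta> A)"

definition surface_area :: "'a::euclidean_space set \<Rightarrow> ennreal" where
  "surface_area K = hausdorff_measure (DIM('a) - 1) (frontier K)"

definition inradius :: "'a::euclidean_space set \<Rightarrow> 'a set \<Rightarrow> real" where
  "inradius K E = Sup {r. r \<ge> 0 \<and> (\<exists>x. (\<lambda>b. x + r *\<^sub>R b) ` E \<subseteq> K)}"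

text \<open>
  Parallel bodies of \<open>K\<close> relative to \<open>E\<close>; meant for \<open>t \<ge> - inradius K E\<close>. For convex bodies \<open>K\<close>, \<open>E\<close>
  both clauses give \<open>K\<close> at \<open>t = 0\<close>.
\<close>

definition parallel_body :: "'a::euclidean_space set \<Rightarrow> 'a set \<Rightarrow> real \<Rightarrow> 'a set" where
  "parallel_body K E t =
     (if t \<le> 0 then {x. (\<lambda>b. x + \<bar>t\<bar> *\<^sub>R b) ` E \<subseteq> K}
      else {x + t *\<^sub>R b | x b. x \<in> K \<and> b \<in> E})"

text \<open>
  The quotient is formed in \<^typ>\<open>ennreal\<close>, so no default value replaces an infinite area. For a
  convex body with nonempty interior both quantities are finite and the volume is positive, so this
  is the usual real quotient.
\<close>

definition isoperimetric_quotient :: "'a::euclidean_space set \<Rightarrow> ennreal" where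
  "isoperimetric_quotient K =
     surface_area K ^ DIM('a) / emeasure lebesgue K ^ (DIM('a) - 1)"

end

theory Submission
  imports Defs
begin

text \<open>
  Put \<open>V(t) = vol(K\<^sub>t)\<close> and \<open>f = V\<^bsup>1/n\<^esup>\<close>. Writing \<open>K\<^sub>t\<close> as the intersection of the half-spaces containing
  \<open>K\<close>, all shifted outwards by \<open>t\<close>, one sees that \<open>t \<mapsto> K\<^sub>t\<close> is a concave family, so \<open>f\<close> is concave by the
  Brunn-Minkowski inequality. Since \<open>V' = S\<close>, the isoperimetric quotient is \<open>(n f')\<^bsup>n\<^esup>\<close>, hence decreasing.

  Instead of differentiating, one proves the one-sided estimates \<open>V(t + h) \<ge> V(t) + h S(t)\<close> and
  \<open>V(s - h) \<ge> V(s) - h S(s)\<close>. For polytopes they come from prisms of height \<open>h\<close> over the facets,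
  erected outwards (where they are disjoint) and inwards (where they cover what is lost). They
  pass to convex bodies because the nearest point projection makes the surface area monotone.

  The normalisation of the Hausdorff measure is irrelevant, as the quotient only changes by a
  constant factor: on hyperplanes, uniqueness of translation invariant measures gives
  proportionality to the volume of prisms, with a factor that is the same for all hyperplanes. In
  particular the isodiametric inequality is not needed. Neither is linearity of the volume
  of a prism in its height \<open>h\<close>, since both estimates are used with the same \<open>h\<close>.
\<close>

subsection \<open>Hausdorff measure is a Borel measure\<close>

text \<open>For s <= t concavity gives f(t + h) - f(t) <= f(s) - f(s - h). The outer estimate bounds
  S(t) from above by the increment of V beyond t, and the inner one bounds S(s) from below by the
  increment before s. So the two areas are compared for each fixed h, and the limit h -> 0 needs
  nothing but continuity of f. The disc measure and the cylinder volume enter both bounds in the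
  same way, which is why their values can stay open.

  The two estimates ask different things of the Hausdorff measure. Outwards, subadditivity over the
  facets is enough. Inwards, the facet areas together must not exceed the area of the boundary. This
  requires additivity on Borel sets and ridges of measure zero, and it is one reason for first
  proving that the outer measure is a Borel measure. The other reason is Fubini's theorem, which
  yields the proportionality on hyperplanes.\<close>

theorem metric_outer_measure_closed:
  fixes f :: "'a::metric_space set \<Rightarrow> ennreal"
  assumes oms: "outer_measure_space UNIV f"
    and sep: "\<And>A B d. d > 0 \<Longrightarrow> (\<And>a b. a \<in> A \<Longrightarrow> b \<in> B \<Longrightarrow> d \<le> dist a b) \<Longrightarrow> f A + f B \<le> f (A \<union> B)"
    and F: "closed F"
  shows "F \<in> lambda_system UNIV UNIV f"
proof (cases "F = {}")
  case True
  have "f {} = 0"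
    using oms by (auto simp: outer_measure_space_def positive_def)
  then show ?thesis
    using True by (simp add: lambda_system_def)
next
  case False
  have mono: "f A \<le> f B" if "A \<subseteq> B" for A B
    using oms that by (auto simp: outer_measure_space_def increasing_def)
  have f0: "f {} = 0"
    using oms by (auto simp: outer_measure_space_def positive_def)
  interpret sigma_algebra UNIV "UNIV :: 'a set set"
    using sigma_algebra_Pow[of "UNIV :: 'a set"] by simp
  have pos: "positive UNIV f" and csa: "countably_subadditive UNIV f"
    using oms by (auto simp: outer_measure_space_def)
  have sub: "f (A \<union> B) \<le> f A + f B" for A B
    using countably_subadditive_subadditive[OF pos csa]
    by (auto simp: subadditive_def) (metis (no_types, lifting) Diff_disjoint Diff_subset Un_Diff_cancel add_left_mono mono order_trans)
  have csub: "f (\<Union>i. A i) \<le> (\<Sum>i. f (A i))" for A :: "nat \<Rightarrow> 'a set"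
  proof -
    have "f (\<Union>i. disjointed A i) \<le> (\<Sum>i. f (disjointed A i))"
      using csa disjoint_family_disjointed[of A] by (auto simp: countably_subadditive_def)
    also have "\<dots> \<le> (\<Sum>i. f (A i))"
      by (intro suminf_le mono disjointed_subset) auto
    finally show ?thesis by (simp add: UN_disjointed_eq)
  qed
  have "f (F \<inter> T) + f (T - F) \<le> f T" if fin: "f T < \<infinity>" for T
  proof -
    \<comment> \<open>Caratheodory's argument: \<open>E n\<close> keeps a positive distance from
      \<open>F\<close>, so \<open>sep\<close> gives
      \<open>f (F \<inter> T) + f (E n) \<le> f T\<close>. As \<open>F\<close> is closed, the
      \<open>E n\<close> exhaust \<open>T - F\<close>. What \<open>E n\<close> misses is covered by
      the layers \<open>R k\<close> with \<open>k \<ge> n\<close>, so a convergent sum over the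
      layers finishes the proof.\<close>
    define E where "E n = {x \<in> T. inverse (real (Suc n)) \<le> infdist x F}" for n
    define R where "R n = E (Suc n) - E n" for n
    \<comment> \<open>Layers whose indices differ by at least \<open>2\<close> are separated, so the even and the odd ones each add up.\<close>
    have ET: "E n \<subseteq> T" for n by (auto simp: E_def)
    have Emono: "E m \<subseteq> E n" if "m \<le> n" for m n
    proof -
      have "inverse (real (Suc n)) \<le> inverse (real (Suc m))"
        using that by (intro le_imp_inverse_le) auto
      then show ?thesis unfolding E_def using order_trans by blast
    qed
    have odd_even: "(\<Sum>k<N. f (R (2 * k + c))) \<le> f (\<Union>k<N. R (2 * k + c))" for N c
    proof (induction N)
      case (Suc N)
      let ?U = "\<Union>k<N. R (2 * k + c)"
      let ?m = "2 * N + c"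
      \<comment> \<open>Points of \<open>?U\<close> lie in \<open>E (?m - 1)\<close>, hence at
        distance at least 1 / ?m from \<open>F\<close>, while those of \<open>R ?m\<close> are
        nearer than 1 / (?m + 1). For \<open>N = 0\<close> the union is empty and \<open>d\<close>
        need not be positive.\<close>
      define d where "d = inverse (real ?m) - inverse (real (Suc ?m))"
      have sepd: "f ?U + f (R ?m) \<le> f (?U \<union> R ?m)"
      proof (cases "N = 0")
        case False
        have d: "d > 0" unfolding d_def using False by (auto intro!: less_imp_inverse_less)
        have U: "?U \<subseteq> E (?m - 1)"
        proof
          fix x assume "x \<in> ?U"
          then obtain k where k: "k < N" "x \<in> E (Suc (2 * k + c))"
            by (auto simp: R_def)
          then have "Suc (2 * k + c) \<le> ?m - 1" by linarith
          from subsetD[OF Emono[OF this] k(2)] show "x \<in> E (?m - 1)" .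
        qed
        show ?thesis
        proof (rule sep[OF d])
          fix a b assume "a \<in> ?U" "b \<in> R ?m"
          then have "inverse (real ?m) \<le> infdist a F" "infdist b F < inverse (real (Suc ?m))"
            using U False by (auto simp: E_def R_def)
          moreover have "infdist a F \<le> infdist b F + dist a b"
            by (rule infdist_triangle)
          ultimately show "d \<le> dist a b" by (auto simp: d_def)
        qed
      qed (simp add: f0)
      have eq: "(\<Union>k<Suc N. R (2 * k + c)) = ?U \<union> R ?m"
        by (auto simp: less_Suc_eq)
      have "(\<Sum>k<Suc N. f (R (2 * k + c))) \<le> f ?U + f (R ?m)"
        using Suc by (simp add: add_right_mono)
      also note sepd
      finally show ?case unfolding eq .
    qed (simp add: f0)
    have RT: "R n \<subseteq> T" for n using ET by (auto simp: R_def)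
    have le_T: "(\<Sum>k<N. f (R (2 * k + c))) \<le> f T" for N c
      by (rule order_trans[OF odd_even mono]) (use RT in blast)
    have "(\<Sum>k<2 * N. f (R k)) = (\<Sum>k<N. f (R (2 * k + 0))) + (\<Sum>k<N. f (R (2 * k + 1)))" for N
      by (induction N) (simp_all add: ac_simps)
    then have le_2T: "(\<Sum>k<2 * N. f (R k)) \<le> f T + f T" for N
      using add_mono[OF le_T[of 0 N] le_T[of 1 N]] by simp
    have "(\<Sum>k. f (R k)) \<le> f T + f T"
    proof (rule suminf_le_const)
      fix N
      have "(\<Sum>k<N. f (R k)) \<le> (\<Sum>k<2 * N. f (R k))"
        by (intro sum_mono2) auto
      then show "(\<Sum>k<N. f (R k)) \<le> f T + f T" using le_2T[of N] by (rule order_trans)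
    qed simp
    then have finsum: "(\<Sum>k. f (R k)) < \<infinity>"
      by (rule le_less_trans) (use fin in simp)
    have TF: "T - F \<subseteq> E n \<union> (\<Union>k. R (k + n))" for n
    proof
      fix x assume x: "x \<in> T - F"
      then have "infdist x F > 0"
        using F False in_closed_iff_infdist_zero[of F x] infdist_nonneg[of x F] by fastforce
      then obtain m where "inverse (real (Suc m)) < infdist x F"
        using reals_Archimedean by blast
      then have Em: "x \<in> E m" using x by (auto simp: E_def)
      show "x \<in> E n \<union> (\<Union>k. R (k + n))"
      proof (cases "x \<in> E n")
        case nE: False
        define j where "j = (LEAST j. x \<in> E j)"
        have j: "x \<in> E j" unfolding j_def using Em by (rule LeastI)
        have "n < j" using nE j Emono[of j n] by (meson linorder_not_le subsetD)
        then have "x \<notin> E (j - 1)" unfolding j_def using not_less_Least[of "j - 1" "\<lambda>j. x \<in> E j"]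
          by (auto simp: j_def)
        then have "x \<in> R ((j - 1 - n) + n)" using j \<open>n < j\<close> by (auto simp: R_def)
        then show ?thesis by blast
      qed simp
    qed
    \<comment> \<open>The full layer sum stands on both sides so that the tail beyond layer
      \<open>n\<close> can be absorbed: partial sum and tail together make it up. It is finite and
      cancels at the end.\<close>
    have "(\<Sum>k. f (R k)) + (f (F \<inter> T) + f (T - F)) \<le> f T + (\<Sum>k. f (R k))"
    proof (rule ennreal_suminf_bound_add)
      fix n
      have "f (T - F) \<le> f (E n) + f (\<Union>k. R (k + n))"
        using mono[OF TF[of n]] sub order_trans by blast
      also have "\<dots> \<le> f (E n) + (\<Sum>k. f (R (k + n)))"
        by (intro add_left_mono csub)
      finally have 1: "f (T - F) \<le> f (E n) + (\<Sum>k. f (R (k + n)))" .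
      have "f (F \<inter> T) + f (E n) \<le> f (F \<inter> T \<union> E n)"
      proof (rule sep)
        fix a b assume "a \<in> F \<inter> T" "b \<in> E n"
        then show "inverse (real (Suc n)) \<le> dist a b"
          using infdist_le[of a F b] by (auto simp: E_def dist_commute)
      qed simp
      also have "\<dots> \<le> f T" using ET by (intro mono) auto
      finally have 2: "f (F \<inter> T) + f (E n) \<le> f T" .
      have "(\<Sum>k<n. f (R k)) + (f (F \<inter> T) + f (T - F))
          \<le> (\<Sum>k<n. f (R k)) + (f (F \<inter> T) + (f (E n) + (\<Sum>k. f (R (k + n)))))"
        using 1 by (intro add_left_mono)
      also have "\<dots> = (f (F \<inter> T) + f (E n)) + (\<Sum>k. f (R k))"
        by (subst suminf_offset[of "\<lambda>k. f (R k)" n]) (auto simp: ac_simps)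
      also have "\<dots> \<le> f T + (\<Sum>k. f (R k))" using 2 by (rule add_right_mono)
      finally show "(\<Sum>k<n. f (R k)) + (f (F \<inter> T) + f (T - F)) \<le> f T + (\<Sum>k. f (R k))" .
    qed
    then show ?thesis using finsum by (auto simp: add.commute[of "f T"] ennreal_add_left_cancel_le)
  qed
  then have "f (F \<inter> T) + f (T - F) \<le> f T" for T
    by (cases "f T = \<infinity>") (auto simp: less_top)
  moreover have "f T \<le> f (F \<inter> T) + f (T - F)" for T
    using order_trans[OF mono sub, of T "F \<inter> T" "T - F"] by blast
  ultimately have "f (F \<inter> T) + f (T - F) = f T" for T
    by (metis antisym)
  then show ?thesis by (auto simp: lambda_system_def Compl_eq_Diff_UNIV[symmetric] Diff_eq Int_commute)
qed

corollary metric_outer_measure_borel: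
  fixes f :: "'a::metric_space set \<Rightarrow> ennreal"
  assumes oms: "outer_measure_space UNIV f"
    and sep: "\<And>A B d. d > 0 \<Longrightarrow> (\<And>a b. a \<in> A \<Longrightarrow> b \<in> B \<Longrightarrow> d \<le> dist a b) \<Longrightarrow> f A + f B \<le> f (A \<union> B)"
  shows "measure_space UNIV (sets borel) f"
proof -
  interpret sigma_algebra UNIV "UNIV :: 'a set set"
    using sigma_algebra_Pow[of "UNIV :: 'a set"] by simp
  have ms: "measure_space UNIV (lambda_system UNIV UNIV f) f"
    using caratheodory_lemma[OF oms] .
  have "Collect closed \<subseteq> lambda_system UNIV UNIV f"
  proof (clarify, rule metric_outer_measure_closed[OF oms])
    fix A B :: "'a set" and d :: real
    assume "d > 0" "\<And>a b. a \<in> A \<Longrightarrow> b \<in> B \<Longrightarrow> d \<le> dist a b"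
    then show "f A + f B \<le> f (A \<union> B)" by (rule sep)
  qed
  then have "sigma_sets UNIV (Collect closed) \<subseteq> lambda_system UNIV UNIV f"
    using ms by (intro sigma_algebra.sigma_sets_subset) (auto simp: measure_space_def)
  then have "sets (borel :: 'a measure) \<subseteq> lambda_system UNIV UNIV f"
    unfolding borel_eq_closed by (simp add: sets_measure_of_conv)
  moreover have "sigma_algebra UNIV (sets (borel :: 'a measure))"
    using sets.sigma_algebra_axioms[of "borel :: 'a measure"] by simp
  ultimately show ?thesis
    using ms measure_down by blast
qed

section \<open>Hausdorff content and Hausdorff measure\<close>

definition hausdorff_cost :: "nat \<Rightarrow> 'a::metric_space set \<Rightarrow> ennreal" where
  "hausdorff_cost k U = (if U = {} then 0 else ennreal (unit_ball_vol (real k) * (diameter U / 2) ^ k))"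

lemma hausdorff_content_le:
  assumes "A \<subseteq> (\<Union>i. U i)" "\<And>i. bounded (U i)" "\<And>i. diameter (U i) \<le> \<delta>"
  shows "hausdorff_content k \<delta> A \<le> (\<Sum>i. hausdorff_cost k (U i))"
  unfolding hausdorff_content_def hausdorff_cost_def using assms by (intro INF_lower) auto

lemma hausdorff_content_geI:
  assumes "\<And>U :: nat \<Rightarrow> _. A \<subseteq> (\<Union>i. U i) \<Longrightarrow> (\<And>i. bounded (U i)) \<Longrightarrow> (\<And>i. diameter (U i) \<le> \<delta>)
    \<Longrightarrow> x \<le> (\<Sum>i. hausdorff_cost k (U i))"
  shows "x \<le> hausdorff_content k \<delta> A"
  unfolding hausdorff_content_def using assms by (intro INF_greatest) (auto simp: hausdorff_cost_def)

lemma hausdorff_content_le_measure: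
  "\<delta> > 0 \<Longrightarrow> hausdorff_content k \<delta> A \<le> hausdorff_measure k A"
  unfolding hausdorff_measure_def by (intro SUP_upper) auto

lemma hausdorff_measure_leI:
  "(\<And>\<delta>. \<delta> > 0 \<Longrightarrow> hausdorff_content k \<delta> A \<le> x) \<Longrightarrow> hausdorff_measure k A \<le> x"
  unfolding hausdorff_measure_def by (intro SUP_least) auto

lemma hausdorff_content_mono:
  "A \<subseteq> B \<Longrightarrow> hausdorff_content k \<delta> A \<le> hausdorff_content k \<delta> B"
  unfolding hausdorff_content_def by (intro INF_superset_mono) auto

lemma hausdorff_content_antimono:
  "\<delta> \<le> \<delta>' \<Longrightarrow> hausdorff_content k \<delta>' A \<le> hausdorff_content k \<delta> A"
  unfolding hausdorff_content_def by (intro INF_superset_mono) (auto intro: order_trans)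

lemma hausdorff_measure_mono: "A \<subseteq> B \<Longrightarrow> hausdorff_measure k A \<le> hausdorff_measure k B"
  by (meson hausdorff_measure_leI hausdorff_content_le_measure hausdorff_content_mono order_trans)

lemma hausdorff_content_close:
  assumes "hausdorff_content k \<delta> A < e"
  shows "\<exists>U :: nat \<Rightarrow> _. A \<subseteq> (\<Union>i. U i) \<and> (\<forall>i. bounded (U i) \<and> diameter (U i) \<le> \<delta>)
    \<and> (\<Sum>i. hausdorff_cost k (U i)) < e"
  using assms unfolding hausdorff_content_def INF_less_iff by (auto simp: hausdorff_cost_def)

lemma hausdorff_content_UN:
  fixes A :: "nat \<Rightarrow> 'a::metric_space set"
  shows "hausdorff_content k \<delta> (\<Union>i. A i) \<le> (\<Sum>i. hausdorff_content k \<delta> (A i))"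
proof (rule ennreal_le_epsilon)
  let ?O = "hausdorff_content k \<delta>"
  fix e :: real assume "0 < e" "(\<Sum>n. ?O (A n)) < top"
  then have *: "\<And>n. ?O (A n) < ?O (A n) + e * (1/2)^Suc n"
    by (auto simp add: less_top dest!: ennreal_suminf_lessD)
  obtain B where B: "\<And>n. A n \<subseteq> (\<Union>i :: nat. B n i)"
      "\<And>n i. bounded (B n i) \<and> diameter (B n i) \<le> \<delta>"
      "\<And>n. (\<Sum>i. hausdorff_cost k (B n i)) \<le> ?O (A n) + e * (1/2)^(Suc n)"
    by (metis less_imp_le hausdorff_content_close[OF *])
  define C where "C = case_prod B o prod_decode"
  have A_C: "(\<Union>i. A i) \<subseteq> (\<Union>i. C i)"
    using B(1) by (auto simp add: C_def subset_eq) (metis prod.case prod_encode_inverse)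
  have "?O (\<Union>i. A i) \<le> (\<Sum>i. hausdorff_cost k (C i))"
    using A_C B(2) by (intro hausdorff_content_le) (auto simp: C_def split_def)
  also have "\<dots> = (\<Sum>n. \<Sum>i. hausdorff_cost k (B n i))"
    unfolding C_def comp_def
    using suminf_ennreal_2dimen[of "\<lambda>n. \<Sum>i. hausdorff_cost k (B n i)" "\<lambda>p. hausdorff_cost k (case_prod B p)"]
    by simp
  also have "\<dots> \<le> (\<Sum>n. ?O (A n) + e * (1/2) ^ Suc n)"
    by (intro suminf_le suminf_nonneg allI B(3)) auto
  also have "... = (\<Sum>n. ?O (A n)) + (\<Sum>n. ennreal e * ennreal ((1/2) ^ Suc n))"
    using \<open>0 < e\<close> by (subst suminf_add[symmetric])
      (auto simp del: ennreal_suminf_cmult simp add: ennreal_mult[symmetric])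
  also have "\<dots> = (\<Sum>n. ?O (A n)) + e"
    unfolding ennreal_suminf_cmult
    by (subst suminf_ennreal_eq[OF zero_le_power power_half_series]) auto
  finally show "?O (\<Union>i. A i) \<le> (\<Sum>n. ?O (A n)) + e" .
qed

lemma hausdorff_measure_empty [simp]: "hausdorff_measure k {} = 0"
proof -
  have "hausdorff_content k \<delta> ({} :: 'a set) \<le> 0" if "\<delta> > 0" for \<delta>
    using hausdorff_content_le[of "{}" "\<lambda>_. {} :: 'a set" \<delta> k] that
    by (simp add: hausdorff_cost_def)
  then show ?thesis
    using hausdorff_measure_leI[of k "{} :: 'a set" 0] by simp
qed

lemma hausdorff_measure_UN:
  fixes A :: "nat \<Rightarrow> 'a::metric_space set"
  shows "hausdorff_measure k (\<Union>i. A i) \<le> (\<Sum>i. hausdorff_measure k (A i))"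
proof (rule hausdorff_measure_leI)
  fix \<delta> :: real assume "\<delta> > 0"
  then have "(\<Sum>i. hausdorff_content k \<delta> (A i)) \<le> (\<Sum>i. hausdorff_measure k (A i))"
    by (intro suminf_le hausdorff_content_le_measure) auto
  then show "hausdorff_content k \<delta> (\<Union>i. A i) \<le> (\<Sum>i. hausdorff_measure k (A i))"
    using hausdorff_content_UN[of k \<delta> A] by (rule order_trans[rotated])
qed

lemma outer_measure_space_hausdorff: "outer_measure_space UNIV (hausdorff_measure k)"
  using hausdorff_measure_UN
  by (auto simp: outer_measure_space_def positive_def increasing_def countably_subadditive_def hausdorff_measure_mono)

text \<open>A set of diameter less than \<open>d\<close> cannot meet both \<open>A\<close> and
  \<open>B\<close>, so a fine cover of the union splits into a cover of \<open>A\<close> and a cover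
  of \<open>B\<close> that share no member.\<close>

lemma hausdorff_measure_separated:
  assumes d: "d > 0" and sep: "\<And>a b. a \<in> A \<Longrightarrow> b \<in> B \<Longrightarrow> d \<le> dist a b"
  shows "hausdorff_measure k A + hausdorff_measure k B \<le> hausdorff_measure k (A \<union> B)"
proof -
  have key: "hausdorff_content k \<delta> A + hausdorff_content k \<delta> B \<le> hausdorff_content k \<delta> (A \<union> B)"
    if \<delta>: "\<delta> > 0" "\<delta> < d" for \<delta>
  proof (rule hausdorff_content_geI)
    fix U :: "nat \<Rightarrow> 'a set"
    assume U: "A \<union> B \<subseteq> (\<Union>i. U i)" "\<And>i. bounded (U i)" "\<And>i. diameter (U i) \<le> \<delta>"
    define UA where "UA i = (if U i \<inter> A = {} then {} else U i)" for i
    define UB where "UB i = (if U i \<inter> B = {} then {} else U i)" for i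
    have disj: "U i \<inter> A = {} \<or> U i \<inter> B = {}" for i
    proof (rule ccontr)
      assume "\<not> ?thesis"
      then obtain a b where "a \<in> U i" "a \<in> A" "b \<in> U i" "b \<in> B" by auto
      then have "d \<le> dist a b" "dist a b \<le> diameter (U i)"
        using sep diameter_bounded_bound[OF U(2)] by auto
      then show False using U(3)[of i] \<delta> by auto
    qed
    have cA: "A \<subseteq> (\<Union>i. UA i)"
      using U(1) by (fastforce simp: UA_def split: if_splits)
    have cB: "B \<subseteq> (\<Union>i. UB i)"
      using U(1) by (fastforce simp: UB_def split: if_splits)
    have "hausdorff_content k \<delta> A + hausdorff_content k \<delta> B
       \<le> (\<Sum>i. hausdorff_cost k (UA i)) + (\<Sum>i. hausdorff_cost k (UB i))"
    proof (intro add_mono hausdorff_content_le cA cB)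
      show "bounded (UA i)" "bounded (UB i)" "diameter (UA i) \<le> \<delta>" "diameter (UB i) \<le> \<delta>" for i
        using U(2,3)[of i] \<delta> by (simp_all add: UA_def UB_def)
    qed
    also have "\<dots> = (\<Sum>i. hausdorff_cost k (UA i) + hausdorff_cost k (UB i))"
      by (intro suminf_add) auto
    also have "\<dots> \<le> (\<Sum>i. hausdorff_cost k (U i))"
      using disj by (intro suminf_le) (auto simp: UA_def UB_def hausdorff_cost_def)
    finally show "hausdorff_content k \<delta> A + hausdorff_content k \<delta> B \<le> (\<Sum>i. hausdorff_cost k (U i))" .
  qed
  \<comment> \<open>Independent scales allow the two suprema to be taken one after the other. The
    content grows as the mesh shrinks, so one smaller scale serves both.\<close>
  have "hausdorff_content k \<delta> A + hausdorff_content k \<delta>' B \<le> hausdorff_measure k (A \<union> B)"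
    if "\<delta> > 0" "\<delta>' > 0" for \<delta> \<delta>'
  proof -
    define e where "e = min (min \<delta> \<delta>') (d / 2)"
    have e: "e > 0" "e < d" using that d by (auto simp: e_def)
    have "hausdorff_content k \<delta> A + hausdorff_content k \<delta>' B \<le> hausdorff_content k e A + hausdorff_content k e B"
      by (intro add_mono hausdorff_content_antimono) (auto simp: e_def)
    also have "\<dots> \<le> hausdorff_content k e (A \<union> B)" by (rule key[OF e])
    also have "\<dots> \<le> hausdorff_measure k (A \<union> B)" by (rule hausdorff_content_le_measure[OF e(1)])
    finally show ?thesis .
  qed
  then have "(SUP \<delta>\<in>{0<..}. hausdorff_content k \<delta> A) + hausdorff_content k \<delta>' B \<le> hausdorff_measure k (A \<union> B)"
    if "\<delta>' > 0" for \<delta>'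
    using that by (subst ennreal_SUP_add_left[symmetric]) (auto intro!: SUP_least)
  then have "(SUP \<delta>'\<in>{0<..}. hausdorff_measure k A + hausdorff_content k \<delta>' B) \<le> hausdorff_measure k (A \<union> B)"
    by (intro SUP_least) (auto simp: hausdorff_measure_def[of k A])
  then show ?thesis by (simp add: hausdorff_measure_def[of k B] ennreal_SUP_add_right)
qed

definition hausdorff :: "nat \<Rightarrow> 'a::metric_space measure" where
  "hausdorff k = measure_of UNIV (sets borel) (hausdorff_measure k)"

lemma sets_hausdorff [simp, measurable_cong]: "sets (hausdorff k) = sets borel"
  unfolding hausdorff_def using sets.sigma_sets_eq[of borel] by (simp add: sets_measure_of_conv)

lemma space_hausdorff [simp]: "space (hausdorff k) = UNIV"
  unfolding hausdorff_def by (simp add: space_measure_of_conv)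

lemma emeasure_hausdorff:
  assumes "A \<in> sets borel"
  shows "emeasure (hausdorff k) A = hausdorff_measure k A"
proof -
  have "measure_space UNIV (sets borel) (hausdorff_measure k :: 'a set \<Rightarrow> _)"
    by (rule metric_outer_measure_borel[OF outer_measure_space_hausdorff hausdorff_measure_separated])
  then show ?thesis
    unfolding hausdorff_def using assms
    by (intro emeasure_measure_of_sigma) (auto simp: measure_space_def)
qed

lemma hausdorff_measure_lipschitz_image:
  fixes f :: "'a::metric_space \<Rightarrow> 'b::metric_space"
  assumes L: "L > 0" and lip: "\<And>x y. x \<in> A \<Longrightarrow> y \<in> A \<Longrightarrow> dist (f x) (f y) \<le> L * dist x y"
  shows "hausdorff_measure k (f ` A) \<le> ennreal (L ^ k) * hausdorff_measure k A"
proof (rule hausdorff_measure_leI)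
  fix \<delta> :: real assume \<delta>: "\<delta> > 0"
  \<comment> \<open>The cover sets are cut down to \<open>A\<close> before they are mapped, since
    the Lipschitz bound holds only there.\<close>
  have diam: "bounded (f ` (U \<inter> A)) \<and> diameter (f ` (U \<inter> A)) \<le> L * diameter U" if "bounded U" for U
  proof -
    have *: "dist (f x) (f y) \<le> L * diameter U" if "x \<in> U \<inter> A" "y \<in> U \<inter> A" for x y
    proof -
      have "dist (f x) (f y) \<le> L * dist x y" using that by (intro lip) auto
      also have "\<dots> \<le> L * diameter U"
        using L that diameter_bounded_bound[OF \<open>bounded U\<close>, of x y] by (intro mult_left_mono) auto
      finally show ?thesis .
    qed
    have "bounded (f ` (U \<inter> A))"
      unfolding bounded_two_points using * by blast
    moreover have "diameter (f ` (U \<inter> A)) \<le> L * diameter U"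
      using * L diameter_ge_0[OF that] unfolding diameter_def[of "f ` (U \<inter> A)"] by (auto intro!: cSUP_least)
    ultimately show ?thesis by blast
  qed
  have "hausdorff_content k \<delta> (f ` A) \<le> ennreal (L ^ k) * hausdorff_content k (\<delta> / L) A"
  proof -
    have Lk: "ennreal (L ^ k) \<noteq> 0" "ennreal (L ^ k) \<noteq> top" using L by auto
    \<comment> \<open>The factor is moved to the left so that the right-hand side is a bare infimum,
      which can be bounded below cover by cover.\<close>
    have "hausdorff_content k \<delta> (f ` A) / ennreal (L ^ k) \<le> hausdorff_content k (\<delta> / L) A"
    proof (rule hausdorff_content_geI)
      fix U :: "nat \<Rightarrow> 'a set"
      assume U: "A \<subseteq> (\<Union>i. U i)" "\<And>i. bounded (U i)" "\<And>i. diameter (U i) \<le> \<delta> / L"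
      have "hausdorff_content k \<delta> (f ` A) \<le> (\<Sum>i. hausdorff_cost k (f ` (U i \<inter> A)))"
      proof (rule hausdorff_content_le)
        show "f ` A \<subseteq> (\<Union>i. f ` (U i \<inter> A))" using U(1) by blast
        show "bounded (f ` (U i \<inter> A))" for i using diam U(2) by blast
        show "diameter (f ` (U i \<inter> A)) \<le> \<delta>" for i
          using diam[OF U(2), of i] U(3)[of i] L by (simp add: field_simps)
      qed
      also have "\<dots> \<le> (\<Sum>i. ennreal (L ^ k) * hausdorff_cost k (U i))"
      proof (intro suminf_le)
        fix i
        show "hausdorff_cost k (f ` (U i \<inter> A)) \<le> ennreal (L ^ k) * hausdorff_cost k (U i)"
        proof (cases "U i \<inter> A = {}")
          case False
          then have ne: "U i \<noteq> {}" by auto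
          have bd: "bounded (f ` (U i \<inter> A))" using diam U(2) by blast
          have "unit_ball_vol (real k) * (diameter (f ` (U i \<inter> A)) / 2) ^ k
              \<le> unit_ball_vol (real k) * ((L * diameter (U i)) / 2) ^ k"
            using diam[OF U(2), of i] diameter_ge_0[OF bd]
            by (intro mult_left_mono power_mono divide_right_mono) auto
          also have "\<dots> = L ^ k * (unit_ball_vol (real k) * (diameter (U i) / 2) ^ k)"
            by (simp add: power_mult_distrib power_divide)
          finally have "ennreal (unit_ball_vol (real k) * (diameter (f ` (U i \<inter> A)) / 2) ^ k)
              \<le> ennreal (L ^ k * (unit_ball_vol (real k) * (diameter (U i) / 2) ^ k))"
            by (rule ennreal_leI)
          also have "\<dots> = ennreal (L ^ k) * ennreal (unit_ball_vol (real k) * (diameter (U i) / 2) ^ k)"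
            using L by (intro ennreal_mult') auto
          finally show ?thesis using False ne by (simp add: hausdorff_cost_def)
        qed (simp add: hausdorff_cost_def)
      qed auto
      also have "\<dots> = ennreal (L ^ k) * (\<Sum>i. hausdorff_cost k (U i))"
        by (rule ennreal_suminf_cmult)
      finally show "hausdorff_content k \<delta> (f ` A) / ennreal (L ^ k) \<le> (\<Sum>i. hausdorff_cost k (U i))"
        using L by (intro divide_le_posI_ennreal) auto
    qed
    then have "ennreal (L ^ k) * (hausdorff_content k \<delta> (f ` A) / ennreal (L ^ k)) \<le> ennreal (L ^ k) * hausdorff_content k (\<delta> / L) A"
      by (rule mult_left_mono) simp
    moreover have "ennreal (L ^ k) * (hausdorff_content k \<delta> (f ` A) / ennreal (L ^ k)) = hausdorff_content k \<delta> (f ` A)"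
      unfolding ennreal_times_divide mult.commute[of "ennreal (L ^ k)"] by (rule ennreal_mult_divide_eq[OF Lk])
    ultimately show ?thesis by simp
  qed
  also have "\<dots> \<le> ennreal (L ^ k) * hausdorff_measure k A"
    using \<delta> L by (intro mult_left_mono hausdorff_content_le_measure) auto
  finally show "hausdorff_content k \<delta> (f ` A) \<le> ennreal (L ^ k) * hausdorff_measure k A" .
qed

lemma hausdorff_measure_isometry_image:
  fixes f :: "'a::metric_space \<Rightarrow> 'b::metric_space"
  assumes "\<And>x y. x \<in> A \<Longrightarrow> y \<in> A \<Longrightarrow> dist (f x) (f y) = dist x y"
  shows "hausdorff_measure k (f ` A) = hausdorff_measure k A"
proof (rule antisym)
  show "hausdorff_measure k (f ` A) \<le> hausdorff_measure k A"
    using hausdorff_measure_lipschitz_image[of 1 A f k] assms by simp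
  have inj: "inj_on f A"
    using assms by (metis (no_types, lifting) dist_eq_0_iff inj_onI)
  then have "the_inv_into A f ` (f ` A) = A"
    by (auto simp: the_inv_into_onto)
  moreover have "hausdorff_measure k (the_inv_into A f ` (f ` A)) \<le> ennreal (1 ^ k) * hausdorff_measure k (f ` A)"
    using inj assms by (intro hausdorff_measure_lipschitz_image) (auto simp: the_inv_into_f_f)
  ultimately show "hausdorff_measure k A \<le> hausdorff_measure k (f ` A)" by simp
qed

subsection \<open>Flat pieces\<close>

text \<open>Evaluate \<open>\<integral>\<integral> 1\<^sub>A(x) 1\<^sub>Q(x - y)\<close> in both orders.\<close>

lemma translation_invariant_proportional:
  fixes M1 M2 :: "'a::euclidean_space measure"
  assumes "sigma_finite_measure M1" "sigma_finite_measure M2"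
    and [measurable_cong]: "sets M1 = sets borel" "sets M2 = sets borel"
    and inv1: "\<And>w B. w \<in> W \<Longrightarrow> B \<in> sets borel \<Longrightarrow> emeasure M1 {x. x + w \<in> B} = emeasure M1 B"
    and inv2: "\<And>w B. w \<in> W \<Longrightarrow> B \<in> sets borel \<Longrightarrow> emeasure M2 {x. x + w \<in> B} = emeasure M2 B"
    and AE1: "AE x in M1. x \<in> W" and AE2: "AE x in M2. x \<in> W"
    and W: "\<And>w. w \<in> W \<Longrightarrow> - w \<in> W"
    and A [measurable]: "A \<in> sets borel" and Q [measurable]: "Q \<in> sets borel"
    and sym: "\<And>x. - x \<in> Q \<longleftrightarrow> x \<in> Q"
  shows "emeasure M1 A * emeasure M2 Q = emeasure M1 Q * emeasure M2 A"
proof -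
  interpret M1: sigma_finite_measure M1 by fact
  interpret M2: sigma_finite_measure M2 by fact
  interpret P: pair_sigma_finite M2 M1 ..
  have space [simp]: "space M1 = UNIV" "space M2 = UNIV"
    using assms(3,4) by (metis sets_eq_imp_space_eq space_borel)+
  \<comment> \<open>Symmetry of \<open>Q\<close> lets \<open>x - y \<in> Q\<close> be read as a
    translate of \<open>Q\<close> in the variable \<open>y\<close>. Invariance is available only for
    shifts in \<open>W\<close>; this suffices because both measures are concentrated there.\<close>
  have 1: "emeasure M2 {y. x - y \<in> Q} = emeasure M2 Q" if "x \<in> W" for x
  proof -
    have "{y. x - y \<in> Q} = {y. y + (- x) \<in> Q}"
      using sym by (metis (no_types, opaque_lifting) minus_diff_eq uminus_add_conv_diff add.commute)
    then show ?thesis using inv2[OF W[OF that] Q] by simp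
  qed
  have 2: "emeasure M1 {x. x \<in> A \<and> x - y \<in> Q} = emeasure M1 {x. x + y \<in> A \<and> x \<in> Q}" if "y \<in> W" for y
    using inv1[OF that, of "{x. x \<in> A \<and> x - y \<in> Q}"] by simp
  have 3: "emeasure M2 {y. x + y \<in> A} = emeasure M2 A" if "x \<in> W" for x
    using inv2[OF that A] by (simp add: add.commute)
  have "emeasure M1 A * emeasure M2 Q = (\<integral>\<^sup>+x. indicator A x * emeasure M2 Q \<partial>M1)"
    by (simp add: nn_integral_multc)
  also have "\<dots> = (\<integral>\<^sup>+x. indicator A x * emeasure M2 {y. x - y \<in> Q} \<partial>M1)"
    using AE1 by (intro nn_integral_cong_AE) (auto simp: 1)
  also have "\<dots> = (\<integral>\<^sup>+x. (\<integral>\<^sup>+y. indicator A x * indicator Q (x - y) \<partial>M2) \<partial>M1)"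
  proof (intro nn_integral_cong)
    fix x
    have "(\<integral>\<^sup>+y. indicator A x * indicator Q (x - y) \<partial>M2) = (\<integral>\<^sup>+y. indicator A x * indicator {y. x - y \<in> Q} y \<partial>M2)"
      by (intro nn_integral_cong) (simp split: split_indicator)
    also have "\<dots> = indicator A x * (\<integral>\<^sup>+y. indicator {y. x - y \<in> Q} y \<partial>M2)"
      by (rule nn_integral_cmult) simp
    also have "(\<integral>\<^sup>+y. indicator {y. x - y \<in> Q} y \<partial>M2) = emeasure M2 {y. x - y \<in> Q}"
      by (rule nn_integral_indicator) simp
    finally show "indicator A x * emeasure M2 {y. x - y \<in> Q} = (\<integral>\<^sup>+y. indicator A x * indicator Q (x - y) \<partial>M2)" by simp
  qed
  also have "\<dots> = (\<integral>\<^sup>+y. (\<integral>\<^sup>+x. indicator A x * indicator Q (x - y) \<partial>M1) \<partial>M2)"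
    by (rule P.Fubini') simp
  also have "\<dots> = (\<integral>\<^sup>+y. emeasure M1 {x. x \<in> A \<and> x - y \<in> Q} \<partial>M2)"
  proof (intro nn_integral_cong)
    fix y
    have "(\<integral>\<^sup>+x. indicator A x * indicator Q (x - y) \<partial>M1) = (\<integral>\<^sup>+x. indicator {x. x \<in> A \<and> x - y \<in> Q} x \<partial>M1)"
      by (intro nn_integral_cong) (simp split: split_indicator)
    also have "\<dots> = emeasure M1 {x. x \<in> A \<and> x - y \<in> Q}" by (rule nn_integral_indicator) simp
    finally show "(\<integral>\<^sup>+x. indicator A x * indicator Q (x - y) \<partial>M1) = emeasure M1 {x. x \<in> A \<and> x - y \<in> Q}" .
  qed
  also have "\<dots> = (\<integral>\<^sup>+y. emeasure M1 {x. x + y \<in> A \<and> x \<in> Q} \<partial>M2)"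
    using AE2 by (intro nn_integral_cong_AE) (auto simp: 2)
  also have "\<dots> = (\<integral>\<^sup>+y. (\<integral>\<^sup>+x. indicator Q x * indicator A (x + y) \<partial>M1) \<partial>M2)"
  proof (intro nn_integral_cong)
    fix y
    have "(\<integral>\<^sup>+x. indicator Q x * indicator A (x + y) \<partial>M1) = (\<integral>\<^sup>+x. indicator {x. x + y \<in> A \<and> x \<in> Q} x \<partial>M1)"
      by (intro nn_integral_cong) (simp split: split_indicator)
    also have "\<dots> = emeasure M1 {x. x + y \<in> A \<and> x \<in> Q}" by (rule nn_integral_indicator) simp
    finally show "emeasure M1 {x. x + y \<in> A \<and> x \<in> Q} = (\<integral>\<^sup>+x. indicator Q x * indicator A (x + y) \<partial>M1)" by simp
  qed
  also have "\<dots> = (\<integral>\<^sup>+x. (\<integral>\<^sup>+y. indicator Q x * indicator A (x + y) \<partial>M2) \<partial>M1)"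
    by (rule P.Fubini'[symmetric]) simp
  also have "\<dots> = (\<integral>\<^sup>+x. indicator Q x * emeasure M2 {y. x + y \<in> A} \<partial>M1)"
  proof (intro nn_integral_cong)
    fix x
    have "(\<integral>\<^sup>+y. indicator Q x * indicator A (x + y) \<partial>M2) = (\<integral>\<^sup>+y. indicator Q x * indicator {y. x + y \<in> A} y \<partial>M2)"
      by (intro nn_integral_cong) (simp split: split_indicator)
    also have "\<dots> = indicator Q x * (\<integral>\<^sup>+y. indicator {y. x + y \<in> A} y \<partial>M2)"
      by (rule nn_integral_cmult) simp
    also have "(\<integral>\<^sup>+y. indicator {y. x + y \<in> A} y \<partial>M2) = emeasure M2 {y. x + y \<in> A}"
      by (rule nn_integral_indicator) simp
    finally show "(\<integral>\<^sup>+y. indicator Q x * indicator A (x + y) \<partial>M2) = indicator Q x * emeasure M2 {y. x + y \<in> A}" .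
  qed
  also have "\<dots> = (\<integral>\<^sup>+x. indicator Q x * emeasure M2 A \<partial>M1)"
    using AE1 by (intro nn_integral_cong_AE) (auto simp: 3)
  also have "\<dots> = emeasure M1 Q * emeasure M2 A"
    by (simp add: nn_integral_multc)
  finally show ?thesis .
qed

lemma sigma_finite_measure_cballI:
  fixes M :: "'a::euclidean_space measure"
  assumes "sets M = sets borel" "\<And>n::nat. emeasure M (cball 0 (real n)) < \<infinity>"
  shows "sigma_finite_measure M"
proof
  have "space M = UNIV" using assms(1) by (metis sets_eq_imp_space_eq space_borel)
  moreover have "(\<Union>n. cball (0::'a) (real n)) = UNIV"
    using real_arch_simple by (auto simp: mem_cball) blast
  ultimately show "\<exists>A. countable A \<and> A \<subseteq> sets M \<and> \<Union> A = space M \<and> (\<forall>a\<in>A. emeasure M a \<noteq> \<infinity>)"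
    using assms by (intro exI[of _ "range (\<lambda>n::nat. cball 0 (real n))"]) (auto simp: less_top)
qed

lemma emeasure_lborel_translate:
  fixes B :: "'a::euclidean_space set"
  assumes [measurable]: "B \<in> sets borel"
  shows "emeasure lborel {x. x + w \<in> B} = emeasure lborel B"
proof -
  have "emeasure lborel B = emeasure (distr lborel borel ((+) w)) B"
    by (simp add: lborel_distr_plus)
  also have "\<dots> = emeasure lborel {x. x + w \<in> B}"
    by (subst emeasure_distr) (auto simp: vimage_def add.commute)
  finally show ?thesis by simp
qed

text \<open>The image of Lebesgue measure under \<open>f\<close> is again translation invariant,
  hence proportional to it. Balls around the origin are preserved, so the factor is 1.\<close>

lemma emeasure_lborel_orthogonal_vimage:
  fixes f :: "'a::euclidean_space \<Rightarrow> 'a"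
  assumes f: "orthogonal_transformation f" and A: "A \<in> sets borel"
  shows "emeasure lborel (f -` A) = emeasure lborel A"
proof -
  have lin: "linear f" using f by (simp add: orthogonal_transformation_linear)
  have [measurable]: "f \<in> borel_measurable borel"
    using lin by (intro borel_measurable_continuous_onI linear_continuous_on linear_conv_bounded_linear[THEN iffD1])
  have vim: "f -` cball 0 r = cball 0 r" for r
    using f by (auto simp: orthogonal_transformation_norm)
  let ?M = "distr lborel borel f"
  have ball: "emeasure ?M (cball 0 r) = emeasure lborel (cball (0::'a) r)" for r
    by (subst emeasure_distr) (auto simp: vim)
  have "emeasure ?M A * emeasure lborel (cball (0::'a) 1) = emeasure ?M (cball 0 1) * emeasure lborel A"
  proof (rule translation_invariant_proportional[where W = UNIV])
    show "sigma_finite_measure ?M"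
      by (rule sigma_finite_measure_cballI) (use ball emeasure_lborel_cball_finite in \<open>auto simp: less_top\<close>)
    show "emeasure ?M {x. x + w \<in> B} = emeasure ?M B" if [measurable]: "B \<in> sets borel" for w B
    proof -
      obtain v where v: "f v = w"
        using orthogonal_transformation_surj[OF f] by (metis surjD)
      have "f -` {x. x + w \<in> B} = {x. x + v \<in> f -` B}"
        by (auto simp: v linear_add[OF lin])
      moreover have "f -` B \<in> sets borel" using measurable_sets[of f borel borel B] by simp
      ultimately show ?thesis
        using emeasure_lborel_translate[of "f -` B" v] by (simp add: emeasure_distr)
    qed
  qed (auto simp: A emeasure_lborel_translate lborel.sigma_finite_measure_axioms)
  moreover have "emeasure lborel (cball (0::'a) 1) \<noteq> 0" "emeasure lborel (cball (0::'a) 1) \<noteq> top"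
    using emeasure_lborel_cball_finite[of "0::'a" 1] content_cball_pos[of 1 "0::'a"]
    by (auto simp: measure_def)
  ultimately have "emeasure ?M A = emeasure lborel A"
    unfolding ball by (simp add: ennreal_mult_cancel_left mult.commute[of _ "emeasure lborel (cball 0 1)"])
  then show ?thesis using A by (simp add: emeasure_distr)
qed

text \<open>For a unit vector \<open>u\<close>, the point tested for membership in \<open>A\<close>
  is the orthogonal projection of \<open>y\<close> to the hyperplane
  \<open>u \<bullet> x = b\<close>, so only the part of \<open>A\<close> in that hyperplane matters.
  The base is left out, which keeps the prism disjoint from the half-space below it.\<close>

definition prism :: "'a::euclidean_space \<Rightarrow> real \<Rightarrow> real \<Rightarrow> 'a set \<Rightarrow> 'a set" where
  "prism u b h A = {y. b < u \<bullet> y \<and> u \<bullet> y \<le> b + h \<and> y - (u \<bullet> y - b) *\<^sub>R u \<in> A}"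

lemma prism_borel [measurable (raw)]:
  assumes [measurable]: "A \<in> sets borel"
  shows "prism u b h A \<in> sets borel"
  unfolding prism_def by measurable

lemma prism_cball:
  fixes u :: "'a::euclidean_space"
  assumes u: "norm u = 1" and h: "h > 0"
  shows "emeasure lborel (prism u 0 h (cball 0 r)) < \<infinity>"
    and "r > 0 \<Longrightarrow> emeasure lborel (prism u 0 h (cball 0 r)) > 0"
proof -
  have uu: "u \<bullet> u = 1" using u by (simp add: dot_square_norm)
  have "prism u 0 h (cball 0 r) \<subseteq> cball 0 (r + h)"
  proof
    fix y assume "y \<in> prism u 0 h (cball 0 r)"
    then have "0 < u \<bullet> y" "u \<bullet> y \<le> h" "norm (y - (u \<bullet> y) *\<^sub>R u) \<le> r"
      by (auto simp: prism_def)
    then have "norm ((y - (u \<bullet> y) *\<^sub>R u) + (u \<bullet> y) *\<^sub>R u) \<le> r + h"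
      using u by (intro norm_triangle_le) auto
    then show "y \<in> cball 0 (r + h)" by simp
  qed
  then have "emeasure lborel (prism u 0 h (cball 0 r)) \<le> emeasure lborel (cball (0::'a) (r + h))"
    by (intro emeasure_mono) auto
  also have "\<dots> < \<infinity>" by (rule emeasure_lborel_cball_finite)
  finally show "emeasure lborel (prism u 0 h (cball 0 r)) < \<infinity>" .
  assume r: "r > 0"
  \<comment> \<open>Half of \<open>h\<close> keeps the ball inside the slab. Half of
    \<open>r\<close> is needed because projecting can cost the norm of \<open>z\<close> a second
    time.\<close>
  define d where "d = min (h / 2) (r / 2)"
  have d: "d > 0" using h r by (auto simp: d_def)
  have "ball ((h / 2) *\<^sub>R u) d \<subseteq> prism u 0 h (cball 0 r)"
  proof
    fix y assume "y \<in> ball ((h / 2) *\<^sub>R u) d"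
    define z where "z = y - (h / 2) *\<^sub>R u"
    have z: "norm z < d" using \<open>y \<in> _\<close> by (simp add: z_def dist_norm norm_minus_commute)
    have y: "y = (h / 2) *\<^sub>R u + z" by (simp add: z_def)
    have uz: "\<bar>u \<bullet> z\<bar> < d" using Cauchy_Schwarz_ineq2[of u z] u z by simp
    have uy: "u \<bullet> y = h / 2 + u \<bullet> z" by (simp add: y inner_add_right uu)
    have "norm (z - (u \<bullet> z) *\<^sub>R u) \<le> norm z + \<bar>u \<bullet> z\<bar>"
      using norm_triangle_ineq4[of z "(u \<bullet> z) *\<^sub>R u"] u by simp
    also have "\<dots> \<le> r" using z uz by (simp add: d_def)
    finally have "norm (y - (u \<bullet> y) *\<^sub>R u) \<le> r"
      unfolding uy by (simp add: y algebra_simps)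
    then show "y \<in> prism u 0 h (cball 0 r)"
      using uz by (simp add: prism_def uy d_def min_def abs_less_iff split: if_splits)
  qed
  then have "emeasure lborel (ball ((h / 2) *\<^sub>R u) d) \<le> emeasure lborel (prism u 0 h (cball 0 r))"
    by (intro emeasure_mono) auto
  moreover have "emeasure lborel (ball ((h / 2) *\<^sub>R u) d) > 0"
    using content_ball_pos[OF d, of "(h / 2) *\<^sub>R u"]
    by (auto simp: measure_def zero_less_iff_neq_zero)
  ultimately show "emeasure lborel (prism u 0 h (cball 0 r)) > 0" by order
qed

text \<open>Hausdorff measure on the hyperplane through 0 and the volume of the prism over a set are
  both measures on that hyperplane, invariant under its translations. Hence they are proportional,
  and the unit disc serves as the common reference set. Finiteness on the disc supplies
  sigma-finiteness.\<close>

lemma hausdorff_flat_centered: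
  fixes u :: "'a::euclidean_space"
  assumes u: "norm u = 1" and h: "h > 0" and A [measurable]: "A \<in> sets borel"
    and fin: "hausdorff_measure k (cball 0 1 \<inter> {x. u \<bullet> x = 0}) < \<infinity>"
  shows "hausdorff_measure k (A \<inter> {x. u \<bullet> x = 0}) * emeasure lborel (prism u 0 h (cball 0 1))
       = hausdorff_measure k (cball 0 1 \<inter> {x. u \<bullet> x = 0}) * emeasure lborel (prism u 0 h A)"
proof -
  define W where "W = {x. u \<bullet> x = 0}"
  have W [measurable]: "W \<in> sets borel" unfolding W_def by measurable
  have uu: "u \<bullet> u = 1" using u by (simp add: dot_square_norm)
  define M1 where "M1 = density (hausdorff k) (indicator W)"
  define S where "S = {y. 0 < u \<bullet> y \<and> u \<bullet> y \<le> h}"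
  have S [measurable]: "S \<in> sets borel" unfolding S_def by measurable
  define p where "p y = y - (u \<bullet> y) *\<^sub>R u" for y
  have p [measurable]: "p \<in> borel_measurable borel" unfolding p_def by measurable
  \<comment> \<open>Lebesgue measure on a slab, pushed down to the hyperplane: \<open>M2\<close>
    assigns to a set the volume of the prism over it.\<close>
  define M2 where "M2 = distr (density lborel (indicator S)) borel p"
  have M1: "emeasure M1 B = hausdorff_measure k (B \<inter> W)" if [measurable]: "B \<in> sets borel" for B
  proof -
    have "emeasure M1 B = (\<integral>\<^sup>+x. indicator W x * indicator B x \<partial>hausdorff k)"
      by (simp add: M1_def emeasure_density)
    also have "\<dots> = (\<integral>\<^sup>+x. indicator (B \<inter> W) x \<partial>hausdorff k)"
      by (intro nn_integral_cong) (simp split: split_indicator)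
    also have "\<dots> = emeasure (hausdorff k) (B \<inter> W)" by (rule nn_integral_indicator) simp
    also have "\<dots> = hausdorff_measure k (B \<inter> W)" by (rule emeasure_hausdorff) simp
    finally show ?thesis .
  qed
  have M2: "emeasure M2 B = emeasure lborel (prism u 0 h B)" if [measurable]: "B \<in> sets borel" for B
  proof -
    have "emeasure M2 B = emeasure (density lborel (indicator S)) (p -` B)"
      unfolding M2_def by (subst emeasure_distr) auto
    also have "\<dots> = (\<integral>\<^sup>+x. indicator S x * indicator (p -` B) x \<partial>lborel)"
      using measurable_sets[OF p that] by (simp add: emeasure_density)
    also have "\<dots> = (\<integral>\<^sup>+x. indicator (prism u 0 h B) x \<partial>lborel)"
      by (intro nn_integral_cong) (simp split: split_indicator add: prism_def S_def p_def)
    also have "\<dots> = emeasure lborel (prism u 0 h B)" by (rule nn_integral_indicator) simp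
    finally show ?thesis .
  qed
  have "emeasure M1 A * emeasure M2 (cball 0 1) = emeasure M1 (cball 0 1) * emeasure M2 A"
  proof (rule translation_invariant_proportional[where W = W])
    show sets: "sets M1 = sets borel" "sets M2 = sets borel" by (auto simp: M1_def M2_def)
    show "sigma_finite_measure M1"
    proof (rule sigma_finite_measure_cballI[OF sets(1)])
      fix n :: nat
      \<comment> \<open>Scaling by \<open>n + 1\<close> instead of \<open>n\<close> keeps the factor
        positive for \<open>n = 0\<close>.\<close>
      have "cball 0 (real n) \<inter> W \<subseteq> (\<lambda>x. (real n + 1) *\<^sub>R x) ` (cball 0 1 \<inter> W)"
      proof
        fix x assume x: "x \<in> cball 0 (real n) \<inter> W"
        then have "x /\<^sub>R (real n + 1) \<in> cball 0 1 \<inter> W" by (auto simp: W_def field_simps)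
        moreover have "x = (real n + 1) *\<^sub>R (x /\<^sub>R (real n + 1))" by simp
        ultimately show "x \<in> (\<lambda>x. (real n + 1) *\<^sub>R x) ` (cball 0 1 \<inter> W)" by blast
      qed
      then have "hausdorff_measure k (cball 0 (real n) \<inter> W)
          \<le> hausdorff_measure k ((\<lambda>x. (real n + 1) *\<^sub>R x) ` (cball 0 1 \<inter> W))"
        by (rule hausdorff_measure_mono)
      also have "\<dots> \<le> ennreal ((real n + 1) ^ k) * hausdorff_measure k (cball 0 1 \<inter> W)"
        by (rule hausdorff_measure_lipschitz_image) (auto simp: dist_norm simp flip: scaleR_diff_right)
      also have "\<dots> < \<infinity>"
        using fin by (simp add: W_def ennreal_mult_less_top)
      finally show "emeasure M1 (cball 0 (real n)) < \<infinity>" by (simp add: M1)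
    qed
    show "sigma_finite_measure M2"
      by (rule sigma_finite_measure_cballI[OF sets(2)]) (use prism_cball(1)[OF u h] in \<open>simp add: M2\<close>)
    show "emeasure M1 {x. x + w \<in> B} = emeasure M1 B" if w: "w \<in> W" and [measurable]: "B \<in> sets borel" for w B
    proof -
      have eq: "(\<lambda>x. x + w) ` ({x. x + w \<in> B} \<inter> W) = B \<inter> W"
      proof (intro set_eqI iffI)
        fix x assume "x \<in> B \<inter> W"
        then show "x \<in> (\<lambda>x. x + w) ` ({x. x + w \<in> B} \<inter> W)"
          using w by (intro image_eqI[of _ _ "x - w"]) (auto simp: W_def inner_diff_right)
      qed (use w in \<open>auto simp: W_def inner_add_right\<close>)
      have "hausdorff_measure k ((\<lambda>x. x + w) ` ({x. x + w \<in> B} \<inter> W)) = hausdorff_measure k ({x. x + w \<in> B} \<inter> W)"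
        by (rule hausdorff_measure_isometry_image) simp
      then show ?thesis unfolding eq by (simp add: M1)
    qed
    show "emeasure M2 {x. x + w \<in> B} = emeasure M2 B" if w: "w \<in> W" and [measurable]: "B \<in> sets borel" for w B
    proof -
      have "prism u 0 h {x. x + w \<in> B} = {x. x + w \<in> prism u 0 h B}"
        using w by (auto simp: prism_def W_def inner_add_right algebra_simps)
      then show ?thesis by (simp add: M2 emeasure_lborel_translate)
    qed
    show "AE x in M1. x \<in> W"
      unfolding M1_def by (subst AE_density) (auto simp: indicator_def)
    have "p y \<in> W" for y by (simp add: p_def W_def inner_diff_right uu)
    then show "AE x in M2. x \<in> W"
      unfolding M2_def by (subst AE_distr_iff) auto
  qed (auto simp: W_def)
  then show ?thesis by (simp add: M1 M2 W_def mult.commute)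
qed

lemma hausdorff_flat:
  fixes u :: "'a::euclidean_space"
  assumes u: "norm u = 1" and h: "h > 0" and A [measurable]: "A \<in> sets borel"
    and fin: "hausdorff_measure k (cball 0 1 \<inter> {x. u \<bullet> x = 0}) < \<infinity>"
  shows "hausdorff_measure k (A \<inter> {x. u \<bullet> x = b}) * emeasure lborel (prism u 0 h (cball 0 1))
       = hausdorff_measure k (cball 0 1 \<inter> {x. u \<bullet> x = 0}) * emeasure lborel (prism u b h A)"
proof -
  have uu: "u \<bullet> u = 1" using u by (simp add: dot_square_norm)
  define A' where "A' = {x. x + b *\<^sub>R u \<in> A}"
  have [measurable]: "A' \<in> sets borel" unfolding A'_def by measurable
  have eq: "(\<lambda>x. x + b *\<^sub>R u) ` (A' \<inter> {x. u \<bullet> x = 0}) = A \<inter> {x. u \<bullet> x = b}"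
  proof (intro set_eqI iffI)
    fix x assume "x \<in> A \<inter> {x. u \<bullet> x = b}"
    then show "x \<in> (\<lambda>x. x + b *\<^sub>R u) ` (A' \<inter> {x. u \<bullet> x = 0})"
      by (intro image_eqI[of _ _ "x - b *\<^sub>R u"]) (auto simp: A'_def inner_diff_right uu)
  qed (auto simp: A'_def inner_add_right uu)
  have "hausdorff_measure k ((\<lambda>x. x + b *\<^sub>R u) ` (A' \<inter> {x. u \<bullet> x = 0})) = hausdorff_measure k (A' \<inter> {x. u \<bullet> x = 0})"
    by (rule hausdorff_measure_isometry_image) simp
  moreover have "prism u 0 h A' = {x. x + b *\<^sub>R u \<in> prism u b h A}"
    by (auto simp: prism_def A'_def inner_add_right uu algebra_simps)
  ultimately show ?thesis
    using hausdorff_flat_centered[OF u h, of A' k] fin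
    by (simp add: eq emeasure_lborel_translate)
qed

text \<open>An orthogonal map taking \<open>u\<close> to \<open>v\<close> carries disc to disc and
  prism to prism. This makes the factor of proportionality the same for every facet
  direction.\<close>

lemma disc_rotate:
  fixes u v :: "real ^ 'n"
  assumes u: "norm u = 1" and v: "norm v = 1"
  shows "hausdorff_measure k (cball 0 1 \<inter> {x. u \<bullet> x = 0}) = hausdorff_measure k (cball 0 1 \<inter> {x. v \<bullet> x = 0})"
    and "emeasure lborel (prism u 0 h (cball 0 r)) = emeasure lborel (prism v 0 h (cball 0 r))"
proof -
  obtain f where f: "orthogonal_transformation f" "f u = v"
    using orthogonal_transformation_exists_1[OF u v] .
  have lin: "linear f" using f by (simp add: orthogonal_transformation_linear)
  have inn: "v \<bullet> f x = u \<bullet> x" for x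
    using f unfolding orthogonal_transformation_def by metis
  have nrm: "norm (f x) = norm x" for x using f by (simp add: orthogonal_transformation_norm)
  have eq: "f ` (cball 0 1 \<inter> {x. u \<bullet> x = 0}) = cball 0 1 \<inter> {x. v \<bullet> x = 0}"
  proof (intro set_eqI iffI)
    fix y assume y: "y \<in> cball 0 1 \<inter> {x. v \<bullet> x = 0}"
    obtain x where "f x = y" using orthogonal_transformation_surj[OF f(1)] by (metis surjD)
    then show "y \<in> f ` (cball 0 1 \<inter> {x. u \<bullet> x = 0})"
      using y by (intro image_eqI[of _ _ x]) (auto simp: inn nrm simp flip: inn)
  qed (auto simp: inn nrm)
  show "hausdorff_measure k (cball 0 1 \<inter> {x. u \<bullet> x = 0}) = hausdorff_measure k (cball 0 1 \<inter> {x. v \<bullet> x = 0})"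
    unfolding eq[symmetric] using f
    by (intro hausdorff_measure_isometry_image[symmetric]) (simp add: dist_norm orthogonal_transformation_norm flip: linear_diff[OF lin])
  have "f y - (v \<bullet> f y - 0) *\<^sub>R v = f (y - (u \<bullet> y) *\<^sub>R u)" for y
    by (simp add: inn linear_diff[OF lin] linear_scale[OF lin] f)
  then have "f -` prism v 0 h (cball 0 r) = prism u 0 h (cball 0 r)"
    by (auto simp: prism_def inn nrm)
  then show "emeasure lborel (prism u 0 h (cball 0 r)) = emeasure lborel (prism v 0 h (cball 0 r))"
    using emeasure_lborel_orthogonal_vimage[OF f(1), of "prism v 0 h (cball 0 r)"] by simp
qed

subsection \<open>Polytopes\<close>

text \<open>The choice of the coordinate axis is immaterial: see \<open>disc_rotate\<close>.\<close>

definition disc_area :: "'n::finite itself \<Rightarrow> nat \<Rightarrow> ennreal" where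
  "disc_area _ k = hausdorff_measure k (cball 0 1 \<inter> {x. axis undefined 1 \<bullet> (x :: real ^ 'n) = 0})"

definition cylinder_volume :: "'n::finite itself \<Rightarrow> real \<Rightarrow> ennreal" where
  "cylinder_volume _ h = emeasure lebesgue (prism (axis undefined 1 :: real ^ 'n) 0 h (cball 0 1))"

lemma cylinder_volume_pos: "h > 0 \<Longrightarrow> 0 < cylinder_volume TYPE('n::finite) h"
  and cylinder_volume_finite: "h > 0 \<Longrightarrow> cylinder_volume TYPE('n::finite) h < \<infinity>"
  unfolding cylinder_volume_def by (simp_all add: prism_cball[simplified])

lemma disc_area_eq:
  fixes u :: "real ^ 'n"
  shows "norm u = 1 \<Longrightarrow> hausdorff_measure k (cball 0 1 \<inter> {x. u \<bullet> x = 0}) = disc_area TYPE('n) k"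
  unfolding disc_area_def by (intro disc_rotate) auto

text \<open>The cross-multiplied form leaves open whether the disc area vanishes; later only the
  cylinder volume, which is positive and finite, is cancelled.\<close>

lemma hausdorff_facet:
  fixes u :: "real ^ 'n"
  assumes "norm u = 1" "h > 0" "A \<in> sets borel" "disc_area TYPE('n) k < \<infinity>"
  shows "hausdorff_measure k (A \<inter> {x. u \<bullet> x = b}) * cylinder_volume TYPE('n) h
       = disc_area TYPE('n) k * emeasure lebesgue (prism u b h A)"
  using hausdorff_flat[of u h A k b] disc_rotate(2)[of u "axis undefined 1" h 1] assms
  by (simp add: disc_area_eq cylinder_volume_def)

text \<open>Meant for facets, which overlap only in ridges. Taking the earlier sets away from a new
  one removes a null set and makes the union disjoint.\<close>

lemma sum_emeasure_le_AE:
  assumes I: "finite I" and F: "\<And>i. i \<in> I \<Longrightarrow> F i \<in> sets M"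
    and null: "\<And>i j. i \<in> I \<Longrightarrow> j \<in> I \<Longrightarrow> i \<noteq> j \<Longrightarrow> emeasure M (F i \<inter> F j) = 0"
  shows "(\<Sum>i\<in>I. emeasure M (F i)) \<le> emeasure M (\<Union>i\<in>I. F i)"
  using assms
proof (induction I rule: finite_induct)
  case (insert j I)
  let ?U = "\<Union>i\<in>I. F i"
  have U: "?U \<in> sets M" "F j \<in> sets M" using insert by auto
  have "emeasure M (F j \<inter> ?U) \<le> (\<Sum>i\<in>I. emeasure M (F j \<inter> F i))"
    unfolding Int_UN_distrib using insert by (intro emeasure_subadditive_finite) auto
  also have "\<dots> = 0" using insert by (intro sum.neutral) auto
  finally have 0: "emeasure M (F j \<inter> ?U) = 0" by simp
  have "emeasure M (F j) \<le> emeasure M (F j - ?U) + emeasure M (F j \<inter> ?U)"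
    using emeasure_subadditive[of "F j - ?U" M "F j \<inter> ?U"] U by (simp add: Un_Diff_Int)
  then have 1: "emeasure M (F j) \<le> emeasure M (F j - ?U)" using 0 by simp
  have "(\<Sum>i\<in>insert j I. emeasure M (F i)) \<le> emeasure M (F j - ?U) + emeasure M ?U"
    using insert 1 by (simp add: add_mono)
  also have "\<dots> = emeasure M ((F j - ?U) \<union> ?U)"
    using U by (intro plus_emeasure) auto
  finally show ?case by simp
qed simp

definition halfspaces :: "('a::euclidean_space \<times> real) set \<Rightarrow> 'a set" where
  "halfspaces I = {x. \<forall>(u, b)\<in>I. u \<bullet> x \<le> b}"

lemma halfspacesD: "x \<in> halfspaces I \<Longrightarrow> (u, b) \<in> I \<Longrightarrow> u \<bullet> x \<le> b"
  by (auto simp: halfspaces_def)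

lemma halfspaces_eq_Inter: "halfspaces I = (\<Inter>(u, b)\<in>I. {x. u \<bullet> x \<le> b})"
  by (auto simp: halfspaces_def)

lemma closed_halfspaces: "closed (halfspaces I)"
  unfolding halfspaces_eq_Inter by (intro closed_INT ballI) (auto simp: closed_halfspace_le)

lemma convex_halfspaces: "convex (halfspaces I)"
  unfolding halfspaces_eq_Inter by (intro convex_INT) (auto simp: convex_halfspace_le)

lemma frontier_halfspaces:
  assumes I: "finite I" and unit: "\<And>u b. (u, b) \<in> I \<Longrightarrow> norm u = 1"
  shows "frontier (halfspaces I) = (\<Union>(u, b)\<in>I. halfspaces I \<inter> {x. u \<bullet> x = b})"
proof (intro set_eqI iffI)
  fix x assume x: "x \<in> frontier (halfspaces I)"
  have xP: "x \<in> halfspaces I"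
    using x frontier_subset_closed[OF closed_halfspaces] by blast
  have xi: "x \<notin> interior (halfspaces I)"
    using x by (simp add: frontier_def)
  have "\<exists>(u, b)\<in>I. u \<bullet> x = b"
  proof (rule ccontr)
    assume "\<not> ?thesis"
    then have "u \<bullet> x < b" if "(u, b) \<in> I" for u b
      using halfspacesD[OF xP that] that by fastforce
    then have 1: "x \<in> (\<Inter>(u, b)\<in>I. {x. u \<bullet> x < b})" by auto
    have 2: "open (\<Inter>(u, b)\<in>I. {x. u \<bullet> x < b})"
      using I by (intro open_INT ballI) (auto simp: open_halfspace_lt)
    have 3: "(\<Inter>(u, b)\<in>I. {x. u \<bullet> x < b}) \<subseteq> halfspaces I"
      unfolding halfspaces_eq_Inter by (auto intro: less_imp_le)
    show False using interiorI[OF 2 1 3] xi by contradiction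
  qed
  then show "x \<in> (\<Union>(u, b)\<in>I. halfspaces I \<inter> {x. u \<bullet> x = b})" using xP by auto
next
  fix x assume "x \<in> (\<Union>(u, b)\<in>I. halfspaces I \<inter> {x. u \<bullet> x = b})"
  then obtain u b where ub: "(u, b) \<in> I" "x \<in> halfspaces I" "u \<bullet> x = b" by auto
  have "x \<notin> interior (halfspaces I)"
  proof
    assume "x \<in> interior (halfspaces I)"
    then obtain e where e: "e > 0" "cball x e \<subseteq> halfspaces I"
      by (meson mem_interior_cball)
    have "x + e *\<^sub>R u \<in> cball x e" using unit[OF ub(1)] e(1) by (simp add: dist_norm)
    then have "u \<bullet> (x + e *\<^sub>R u) \<le> b" using halfspacesD[OF subsetD[OF e(2)] ub(1)] by blast
    then show False using ub(3) e(1) unit[OF ub(1)] by (simp add: inner_add_right dot_square_norm)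
  qed
  then show "x \<in> frontier (halfspaces I)"
    using ub(2) closure_subset by (auto simp: frontier_def)
qed

text \<open>Let \<open>y\<close> be a common point, at height \<open>s\<close> above one face and
  \<open>t\<close> above the other. Its foot in one face satisfies the inequality of the other, so
  \<open>t \<le> s * (u \<bullet> v)\<close> and \<open>s \<le> t * (u \<bullet> v)\<close>. As the
  inner product is at most 1, the heights agree and the two normals coincide.\<close>

lemma prism_disjoint:
  assumes "norm u = 1" "norm v = 1" and ne: "(u, b) \<noteq> (v, c)"
    and Pu: "\<And>x. x \<in> P \<Longrightarrow> u \<bullet> x \<le> b" and Pv: "\<And>x. x \<in> P \<Longrightarrow> v \<bullet> x \<le> c"
  shows "prism u b h P \<inter> prism v c h P = {}"
proof (rule ccontr)
  assume "\<not> ?thesis"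
  then obtain y where y: "y \<in> prism u b h P" "y \<in> prism v c h P" by auto
  define s t where "s = u \<bullet> y - b" and "t = v \<bullet> y - c"
  have pos: "s > 0" "t > 0" using y by (auto simp: prism_def s_def t_def)
  have "v \<bullet> (y - s *\<^sub>R u) \<le> c" "u \<bullet> (y - t *\<^sub>R v) \<le> b"
    using y Pu Pv by (auto simp: prism_def s_def t_def)
  then have st: "t \<le> s * (u \<bullet> v)" "s \<le> t * (u \<bullet> v)"
    by (auto simp: s_def t_def inner_diff_right inner_commute)
  have uv: "u \<bullet> v \<le> 1" using norm_cauchy_schwarz[of u v] assms(1,2) by simp
  have "s * (u \<bullet> v) \<le> s" "t * (u \<bullet> v) \<le> t" using pos uv by (simp_all add: mult_left_le)
  then have "t \<le> s" "s \<le> t" using st by linarith+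
  then have "s = t" by simp
  have "s * 1 \<le> s * (u \<bullet> v)" using st(2) \<open>s = t\<close> by simp
  then have "1 \<le> u \<bullet> v" using pos(1) by (simp only: mult_le_cancel_left_pos)
  then have "u \<bullet> v = 1" using uv by simp
  then have "norm (u - v) ^ 2 = 0"
    using assms(1,2) dot_norm_neg[of u v] by simp
  then have "u = v" by simp
  moreover have "b = c" using \<open>s = t\<close> \<open>u = v\<close> by (simp add: s_def t_def)
  ultimately show False using ne by simp
qed

text \<open>The prism over a ridge lies in a hyperplane whose normal \<open>w\<close> is the part of
  \<open>v\<close> orthogonal to \<open>u\<close>. If \<open>w\<close> vanishes, the two faces are
  parallel. Equal normals belong to different levels, and opposite normals cannot share a face
  because \<open>z\<close> satisfies both inequalities strictly; so the ridge is empty.\<close>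

lemma prism_ridge_null:
  fixes u v :: "'a::euclidean_space"
  assumes u: "norm u = 1" and v: "norm v = 1" and ne: "(u, b) \<noteq> (v, c)"
    and z: "u \<bullet> z < b" "v \<bullet> z < c"
  shows "negligible (prism u b h {x. v \<bullet> x = c})"
proof -
  have uu: "u \<bullet> u = 1" and vv: "v \<bullet> v = 1" using u v by (simp_all add: dot_square_norm)
  define w where "w = v - (u \<bullet> v) *\<^sub>R u"
  have wu: "w \<bullet> u = 0" by (simp add: w_def inner_diff_left uu inner_commute[of v u])
  show ?thesis
  proof (cases "w = 0")
    case False
    have "prism u b h {x. v \<bullet> x = c} \<subseteq> {y. w \<bullet> y = c - (u \<bullet> v) * b}"
    proof
      fix y assume "y \<in> prism u b h {x. v \<bullet> x = c}"
      then have "v \<bullet> (y - (u \<bullet> y - b) *\<^sub>R u) = c" by (simp add: prism_def)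
      then show "y \<in> {y. w \<bullet> y = c - (u \<bullet> v) * b}"
        by (simp add: w_def inner_diff_left inner_diff_right inner_commute algebra_simps)
    qed
    moreover have "negligible {y. w \<bullet> y = c - (u \<bullet> v) * b}"
      using False by (intro negligible_hyperplane) auto
    ultimately show ?thesis by (rule negligible_subset[rotated])
  next
    case True
    then have v_eq: "v = (u \<bullet> v) *\<^sub>R u" by (simp add: w_def)
    then have "\<bar>u \<bullet> v\<bar> = 1" using u v by (metis mult.right_neutral norm_scaleR)
    then consider "v = u" | "v = - u" using v_eq by (metis abs_1 abs_eq_iff' scaleR_minus1_left scaleR_one)
    then have "prism u b h {x. v \<bullet> x = c} = {}"
    proof cases
      case 1
      then show ?thesis using ne by (auto simp: prism_def inner_diff_right uu)
    next
      case 2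
      then show ?thesis using z by (auto simp: prism_def inner_diff_right uu)
    qed
    then show ?thesis by simp
  qed
qed

section \<open>Volume estimates for polytopes\<close>

context
  fixes I :: "((real ^ 'n) \<times> real) set" and h :: real and k :: nat
  assumes I: "finite I" and unit: "\<And>u b. (u, b) \<in> I \<Longrightarrow> norm u = 1"
    and h: "h > 0" and fin: "disc_area TYPE('n) k < \<infinity>"
begin

lemma polytope_borel [measurable]: "halfspaces I \<in> sets borel"
  using closed_halfspaces by (rule borel_closed)

lemma polytope_frontier:
  "frontier (halfspaces I) = (\<Union>(u, b)\<in>I. halfspaces I \<inter> {x. u \<bullet> x = b})"
  using I unit by (rule frontier_halfspaces)

lemma polytope_facet:
  "(u, b) \<in> I \<Longrightarrow> hausdorff_measure k (halfspaces I \<inter> {x. u \<bullet> x = b}) * cylinder_volume TYPE('n) h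
     = disc_area TYPE('n) k * emeasure lebesgue (prism u b h (halfspaces I))"
  using unit h fin by (intro hausdorff_facet) auto

text \<open>\<open>Z\<close> stands for an outer parallel body. Only an inclusion is asked of it, so
  it can stay fixed while a convex body is approximated by polytopes from inside.\<close>

lemma polytope_outer:
  assumes Z: "Z \<in> sets lebesgue" "\<And>x. x \<in> halfspaces I \<Longrightarrow> cball x h \<subseteq> Z"
  shows "disc_area TYPE('n) k * emeasure lebesgue (halfspaces I)
      + hausdorff_measure k (frontier (halfspaces I)) * cylinder_volume TYPE('n) h
     \<le> disc_area TYPE('n) k * emeasure lebesgue Z"
proof -
  let ?P = "halfspaces I" and ?\<kappa> = "disc_area TYPE('n) k" and ?m = "cylinder_volume TYPE('n) h"
  let ?F = "\<lambda>(u, b). ?P \<inter> {x. u \<bullet> x = b}" and ?R = "\<lambda>(u, b). prism u b h ?P"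
  have FB [measurable]: "?F i \<in> sets borel" for i by (cases i) simp
  have RB: "?R i \<in> sets borel" for i by (cases i) simp
  have "hausdorff_measure k (frontier ?P) = emeasure (hausdorff k) (\<Union>i\<in>I. ?F i)"
    unfolding polytope_frontier using I by (subst emeasure_hausdorff) auto
  also have "\<dots> \<le> (\<Sum>i\<in>I. emeasure (hausdorff k) (?F i))"
    using I FB by (intro emeasure_subadditive_finite) auto
  also have "\<dots> = (\<Sum>i\<in>I. hausdorff_measure k (?F i))"
    using FB by (intro sum.cong emeasure_hausdorff) auto
  finally have "hausdorff_measure k (frontier ?P) * ?m \<le> (\<Sum>i\<in>I. hausdorff_measure k (?F i)) * ?m"
    by (rule mult_right_mono) simp
  also have "\<dots> = (\<Sum>i\<in>I. ?\<kappa> * emeasure lebesgue (?R i))"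
    unfolding sum_distrib_right by (intro sum.cong) (auto simp: polytope_facet)
  also have "\<dots> = ?\<kappa> * (\<Sum>i\<in>I. emeasure lebesgue (?R i))"
    by (rule sum_distrib_left[symmetric])
  also have "(\<Sum>i\<in>I. emeasure lebesgue (?R i)) = emeasure lebesgue (\<Union>i\<in>I. ?R i)"
  proof (rule sum_emeasure)
    show "disjoint_family_on ?R I"
      unfolding disjoint_family_on_def
    proof (intro ballI impI)
      fix i j assume ij: "i \<in> I" "j \<in> I" "i \<noteq> j"
      obtain u b v c where [simp]: "i = (u, b)" "j = (v, c)" by (cases i, cases j)
      have "prism u b h ?P \<inter> prism v c h ?P = {}"
        using ij by (intro prism_disjoint unit) (auto dest: halfspacesD)
      then show "?R i \<inter> ?R j = {}" by simp
    qed
  qed (use I RB in auto)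
  finally have 1: "hausdorff_measure k (frontier ?P) * ?m \<le> ?\<kappa> * emeasure lebesgue (\<Union>i\<in>I. ?R i)" .
  have "emeasure lebesgue ?P + emeasure lebesgue (\<Union>i\<in>I. ?R i) = emeasure lebesgue (?P \<union> (\<Union>i\<in>I. ?R i))"
  proof (rule plus_emeasure)
    show "?P \<inter> (\<Union>i\<in>I. ?R i) = {}"
    proof (rule ccontr)
      assume "\<not> ?thesis"
      then obtain y u b where y: "y \<in> ?P" "(u, b) \<in> I" "y \<in> prism u b h ?P" by auto
      then show False using halfspacesD[OF y(1,2)] by (simp add: prism_def)
    qed
    show "(\<Union>i\<in>I. ?R i) \<in> sets lebesgue"
      using I RB by (intro sets.finite_UN) auto
  qed simp
  also have "\<dots> \<le> emeasure lebesgue Z"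
  proof (rule emeasure_mono)
    show "?P \<union> (\<Union>i\<in>I. ?R i) \<subseteq> Z"
    proof (intro Un_least UN_least)
      show "?P \<subseteq> Z" using Z(2) h by (metis centre_in_cball less_imp_le subset_eq)
      fix i assume "i \<in> I"
      obtain u b where i: "i = (u, b)" by (cases i)
      show "?R i \<subseteq> Z"
      proof
        fix y assume "y \<in> ?R i"
        then have y: "b < u \<bullet> y" "u \<bullet> y \<le> b + h" "y - (u \<bullet> y - b) *\<^sub>R u \<in> ?P"
          by (auto simp: i prism_def)
        moreover have "y \<in> cball (y - (u \<bullet> y - b) *\<^sub>R u) h"
          using y unit[of u b] \<open>i \<in> I\<close> by (simp add: i dist_norm)
        ultimately show "y \<in> Z" using Z(2) by blast
      qed
    qed
  qed (rule Z)
  finally have 2: "emeasure lebesgue ?P + emeasure lebesgue (\<Union>i\<in>I. ?R i) \<le> emeasure lebesgue Z" .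
  show ?thesis
    by (rule order_trans[OF add_left_mono[OF 1] mult_left_mono[OF 2, of ?\<kappa>, unfolded distrib_left]]) simp
qed

text \<open>Points of the polytope outside \<open>Z\<close> are less than \<open>h\<close> below
  some facet, so inward prisms cover them. The sum of the facet areas then has to be bounded by the
  area of the boundary; the interior point \<open>z\<close> enters here, through the null
  ridges.\<close>

lemma polytope_inner:
  assumes Z: "Z \<in> sets lebesgue" "\<And>x. cball x h \<subseteq> halfspaces I \<Longrightarrow> x \<in> Z"
    and z: "\<And>u b. (u, b) \<in> I \<Longrightarrow> u \<bullet> z < b"
  shows "disc_area TYPE('n) k * emeasure lebesgue (halfspaces I)
    \<le> disc_area TYPE('n) k * emeasure lebesgue Z
      + hausdorff_measure k (frontier (halfspaces I)) * cylinder_volume TYPE('n) h"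
proof -
  let ?P = "halfspaces I" and ?\<kappa> = "disc_area TYPE('n) k" and ?m = "cylinder_volume TYPE('n) h"
  let ?F = "\<lambda>(u, b). ?P \<inter> {x. u \<bullet> x = b}" and ?R = "\<lambda>(u, b). prism u b h ?P"
  \<comment> \<open>Shifting an outward prism by \<open>h\<close> against its normal gives the
    inward prism over the same face, with the same volume.\<close>
  let ?R' = "\<lambda>i. (+) (- (h *\<^sub>R fst i)) ` ?R i"
  have FB [measurable]: "?F i \<in> sets borel" for i by (cases i) simp
  have RB: "?R i \<in> sets borel" for i by (cases i) simp
  have vol_R': "emeasure lebesgue (?R' i) = emeasure lebesgue (?R i)" for i
    using emeasure_lebesgue_affine[of 1 "- (h *\<^sub>R fst i)" "?R i"] by (simp add: add.commute cong: image_cong_simp)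
  have R'_sets: "?R' i \<in> sets lebesgue" for i
    using RB[of i] by (intro lebesgue_sets_translation) auto
  have ridge: "emeasure (hausdorff k) (?F i \<inter> ?F j) = 0" if ij: "i \<in> I" "j \<in> I" "i \<noteq> j" for i j
  proof -
    obtain u b v c where [simp]: "i = (u, b)" "j = (v, c)" by (cases i, cases j)
    have [measurable]: "?F (v, c) \<in> sets borel" by (rule FB)
    have "hausdorff_measure k (?F (v, c) \<inter> {x. u \<bullet> x = b}) * ?m = ?\<kappa> * emeasure lebesgue (prism u b h (?F (v, c)))"
      using unit ij h fin by (intro hausdorff_facet) auto
    also have "negligible (prism u b h (?F (v, c)))"
    proof (rule negligible_subset)
      show "negligible (prism u b h {x. v \<bullet> x = c})"
        using ij unit z by (intro prism_ridge_null[where z = z]) auto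
      show "prism u b h (?F (v, c)) \<subseteq> prism u b h {x. v \<bullet> x = c}"
        by (auto simp: prism_def)
    qed
    then have "emeasure lebesgue (prism u b h (?F (v, c))) = 0"
      by (simp add: negligible_iff_null_sets null_sets_def)
    finally have "hausdorff_measure k (?F (v, c) \<inter> {x. u \<bullet> x = b}) = 0"
      using cylinder_volume_pos[OF h, where ?'n = 'n] by auto
    moreover have "?F i \<inter> ?F j = ?F (v, c) \<inter> {x. u \<bullet> x = b}" by auto
    ultimately show ?thesis by (subst emeasure_hausdorff) auto
  qed
  have "?P \<subseteq> Z \<union> (\<Union>i\<in>I. ?R' i)"
  proof
    fix y assume yP: "y \<in> ?P"
    show "y \<in> Z \<union> (\<Union>i\<in>I. ?R' i)"
    proof (cases "y \<in> Z")
      case False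
      then have "\<not> cball y h \<subseteq> ?P" using Z(2) by blast
      then obtain x where x: "dist y x \<le> h" "x \<notin> ?P" unfolding subset_iff mem_cball by blast
      then obtain v c where vc: "(v, c) \<in> I" "v \<bullet> x > c" by (auto simp: halfspaces_def not_le)
      have "v \<bullet> (x - y) \<le> h"
        using norm_cauchy_schwarz[of v "x - y"] unit[OF vc(1)] x(1) by (simp add: dist_norm norm_minus_commute)
      then have vlt: "c - v \<bullet> y < h" using vc(2) by (simp add: inner_diff_right)
      \<comment> \<open>\<open>g\<close> measures the slack of \<open>y\<close> in each inequality.
        Moving from \<open>y\<close> along the normal \<open>u\<close> of a face with least slack
        \<open>s\<close> raises any other left-hand side by at most \<open>s\<close>, so
        \<open>y + s *\<^sub>R u\<close> is still in the polytope and lies on that face.\<close>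
      define g where "g i = snd i - fst i \<bullet> y" for i :: "(real ^ 'n) \<times> real"
      define s where "s = Min (g ` I)"
      have "s \<in> g ` I" unfolding s_def using I vc by (intro Min_in) auto
      then obtain u b where ub: "(u, b) \<in> I" "s = b - u \<bullet> y" by (auto simp: g_def)
      have smin: "s \<le> c - v \<bullet> y" if "(v, c) \<in> I" for v c
        unfolding s_def using I that by (intro Min_le) (auto simp: g_def intro!: image_eqI[of _ _ "(v, c)"])
      \<comment> \<open>Strictness of \<open>s < h\<close> comes from the strictly violated
        inequality at \<open>x\<close>. It is needed because prisms omit their base:
        \<open>y + h *\<^sub>R u\<close> has height \<open>h - s\<close> above the face.\<close>
      have s: "0 \<le> s" "s < h" using smin[OF vc(1)] vlt ub halfspacesD[OF yP ub(1)] by auto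
      have uu: "u \<bullet> u = 1" using unit[OF ub(1)] by (simp add: dot_square_norm)
      have xP: "y + s *\<^sub>R u \<in> ?P"
      proof -
        have "v \<bullet> (y + s *\<^sub>R u) \<le> c" if "(v, c) \<in> I" for v c
        proof -
          have "v \<bullet> u \<le> 1" using norm_cauchy_schwarz[of v u] unit[OF that] unit[OF ub(1)] by simp
          then have "s * (v \<bullet> u) \<le> s" using s(1) by (simp add: mult_left_le)
          then show ?thesis using smin[OF that] by (simp add: inner_add_right)
        qed
        then show ?thesis by (auto simp: halfspaces_def)
      qed
      have inn: "u \<bullet> (y + h *\<^sub>R u) = b + (h - s)" using ub(2) by (simp add: inner_add_right uu)
      have "y + h *\<^sub>R u \<in> prism u b h ?P"
        unfolding prism_def mem_Collect_eq inn using s xP by (simp add: algebra_simps)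
      then have "y \<in> ?R' (u, b)" by (intro image_eqI[of _ _ "y + h *\<^sub>R u"]) auto
      then show ?thesis using ub(1) by blast
    qed simp
  qed
  then have "emeasure lebesgue ?P \<le> emeasure lebesgue (Z \<union> (\<Union>i\<in>I. ?R' i))"
    using Z(1) I R'_sets by (intro emeasure_mono sets.Un sets.finite_UN) auto
  also have "\<dots> \<le> emeasure lebesgue Z + emeasure lebesgue (\<Union>i\<in>I. ?R' i)"
    using Z(1) I R'_sets by (intro emeasure_subadditive sets.finite_UN) auto
  also have "\<dots> \<le> emeasure lebesgue Z + (\<Sum>i\<in>I. emeasure lebesgue (?R' i))"
    using I R'_sets by (intro add_left_mono emeasure_subadditive_finite) auto
  also have "(\<Sum>i\<in>I. emeasure lebesgue (?R' i)) = (\<Sum>i\<in>I. emeasure lebesgue (?R i))"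
    by (intro sum.cong refl vol_R')
  finally have "emeasure lebesgue ?P \<le> emeasure lebesgue Z + (\<Sum>i\<in>I. emeasure lebesgue (?R i))" .
  then have "?\<kappa> * emeasure lebesgue ?P \<le> ?\<kappa> * (emeasure lebesgue Z + (\<Sum>i\<in>I. emeasure lebesgue (?R i)))"
    by (rule mult_left_mono) simp
  also have "\<dots> = ?\<kappa> * emeasure lebesgue Z + (\<Sum>i\<in>I. ?\<kappa> * emeasure lebesgue (?R i))"
    unfolding distrib_left sum_distrib_left ..
  also have "(\<Sum>i\<in>I. ?\<kappa> * emeasure lebesgue (?R i)) = (\<Sum>i\<in>I. hausdorff_measure k (?F i) * ?m)"
    by (intro sum.cong) (auto simp: polytope_facet)
  also have "\<dots> = (\<Sum>i\<in>I. emeasure (hausdorff k) (?F i)) * ?m"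
    unfolding sum_distrib_right using FB by (intro sum.cong) (simp_all add: emeasure_hausdorff)
  finally have 1: "?\<kappa> * emeasure lebesgue ?P \<le> ?\<kappa> * emeasure lebesgue Z + (\<Sum>i\<in>I. emeasure (hausdorff k) (?F i)) * ?m" .
  have "(\<Sum>i\<in>I. emeasure (hausdorff k) (?F i)) \<le> emeasure (hausdorff k) (\<Union>i\<in>I. ?F i)"
    using I FB ridge by (intro sum_emeasure_le_AE) auto
  also have "\<dots> = hausdorff_measure k (frontier ?P)"
    unfolding polytope_frontier using I by (subst emeasure_hausdorff) auto
  finally have 2: "(\<Sum>i\<in>I. emeasure (hausdorff k) (?F i)) * ?m \<le> hausdorff_measure k (frontier ?P) * ?m"
    by (rule mult_right_mono) simp
  show ?thesis using 1 add_left_mono[OF 2] by (rule order_trans)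
qed

end

subsection \<open>Convex bodies\<close>

text \<open>The nearest point map of \<open>Q\<close> does not increase distances, and it maps the
  boundary of \<open>P\<close> onto a superset of the boundary of \<open>Q\<close>: an outer normal
  ray at a boundary point \<open>y\<close> of \<open>Q\<close> must leave \<open>P\<close>, and all
  its points have \<open>y\<close> as their nearest point.\<close>

lemma hausdorff_frontier_mono:
  fixes Q :: "'a::euclidean_space set"
  assumes Q: "convex Q" "closed Q" "interior Q \<noteq> {}" and P: "bounded P" and sub: "Q \<subseteq> P"
  shows "hausdorff_measure k (frontier Q) \<le> hausdorff_measure k (frontier P)"
proof -
  have Qne: "Q \<noteq> {}" using Q(3) interior_subset by blast
  have "frontier Q \<subseteq> closest_point Q ` frontier P"
  proof
    fix y assume y: "y \<in> frontier Q"
    then have yQ: "y \<in> Q" and "y \<notin> rel_interior Q"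
      using Q frontier_subset_closed[OF Q(2)] by (auto simp: rel_interior_nonempty_interior frontier_def)
    then obtain a where a: "a \<noteq> 0" "\<And>x. x \<in> Q \<Longrightarrow> a \<bullet> y \<le> a \<bullet> x"
      using supporting_hyperplane_relative_frontier[OF Q(1), of y] closure_subset by (metis subsetD)
    \<comment> \<open>The functional \<open>a\<close> is minimal over \<open>Q\<close> at
      \<open>y\<close>, so the outer normal ray runs in direction \<open>- a\<close>.\<close>
    define f where "f s = y - s *\<^sub>R a" for s :: real
    define R where "R = f ` {0..}"
    have "connected R"
      unfolding R_def f_def by (intro connected_continuous_image continuous_intros) auto
    moreover have "R \<inter> P \<noteq> {}"
    proof -
      have "f 0 \<in> R \<inter> P" using yQ sub by (auto simp: R_def f_def)
      then show ?thesis by blast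
    qed
    moreover have "R - P \<noteq> {}"
    proof
      assume "R - P = {}"
      obtain B where B: "B > 0" "\<And>x. x \<in> P \<Longrightarrow> norm x \<le> B"
        using P bounded_pos by blast
      define s where "s = (B + norm y + 1) / norm a"
      have s: "s \<ge> 0" using B(1) by (simp add: s_def)
      have "f s \<in> P" using \<open>R - P = {}\<close> s by (auto simp: R_def)
      then have "norm (f s) \<le> B" by (rule B(2))
      moreover have "norm (s *\<^sub>R a) = B + norm y + 1" using a(1) s B(1) by (simp add: s_def)
      moreover have "norm (s *\<^sub>R a) \<le> norm y + norm (f s)"
        using norm_triangle_ineq4[of y "f s"] by (simp add: f_def)
      ultimately show False by simp
    qed
    ultimately have "R \<inter> frontier P \<noteq> {}" by (rule connected_Int_frontier)
    then obtain s where s: "s \<ge> 0" "f s \<in> frontier P" by (auto simp: R_def)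
    have "y = closest_point Q (f s)"
    proof (rule closest_point_unique[OF Q(1,2) yQ], intro ballI)
      fix z assume z: "z \<in> Q"
      have "norm (s *\<^sub>R a) ^ 2 \<le> norm (z - y) ^ 2 + 2 * (s * (a \<bullet> (z - y))) + norm (s *\<^sub>R a) ^ 2"
        using a(2)[OF z] s(1) by (simp add: inner_diff_right)
      also have "\<dots> = norm ((z - y) + s *\<^sub>R a) ^ 2"
        unfolding power2_norm_eq_inner
        by (simp add: inner_add_left inner_add_right inner_diff_left inner_diff_right inner_commute)
      finally have "norm (s *\<^sub>R a) \<le> norm ((z - y) + s *\<^sub>R a)"
        by (rule power2_le_imp_le) simp
      then show "dist (f s) y \<le> dist (f s) z"
        by (simp add: f_def dist_norm norm_minus_commute algebra_simps)
    qed
    then show "y \<in> closest_point Q ` frontier P" using s(2) by blast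
  qed
  then have "hausdorff_measure k (frontier Q) \<le> hausdorff_measure k (closest_point Q ` frontier P)"
    by (rule hausdorff_measure_mono)
  also have "\<dots> \<le> ennreal (1 ^ k) * hausdorff_measure k (frontier P)"
    using closest_point_lipschitz[OF Q(1,2) Qne] by (intro hausdorff_measure_lipschitz_image) auto
  finally show ?thesis by simp
qed

lemma frontier_scaleR:
  fixes S :: "'a::euclidean_space set"
  assumes "c \<noteq> 0"
  shows "frontier ((*\<^sub>R) c ` S) = (*\<^sub>R) c ` frontier S"
proof -
  have inj: "inj ((*\<^sub>R) c :: 'a \<Rightarrow> 'a)" using assms by (simp add: inj_on_def)
  have "interior ((*\<^sub>R) c ` S) = (*\<^sub>R) c ` interior S"
    using inj by (intro interior_injective_linear_image) auto
  then show ?thesis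
    by (simp add: frontier_def closure_scaleR image_set_diff[OF inj])
qed

text \<open>The boundary of the dilate \<open>l Q\<close> is compact and misses \<open>Q\<close>, so
  finitely many half-spaces around \<open>Q\<close> cut off all its points. Their intersection
  \<open>P\<close> contains \<open>Q\<close>, is connected and avoids that boundary, hence lies in
  \<open>l Q\<close>. Shrinking \<open>P\<close> by the factor \<open>l\<close> gives the
  polytope.\<close>

lemma convex_approx_halfspaces:
  fixes Q :: "'a::euclidean_space set"
  assumes Q: "convex Q" "compact Q" and 0: "0 \<in> interior Q" and l: "l > 1"
  obtains I where "finite I" "\<And>u b. (u, b) \<in> I \<Longrightarrow> norm u = 1 \<and> 0 < b"
    "halfspaces I \<subseteq> Q" "Q \<subseteq> (*\<^sub>R) l ` halfspaces I"
proof -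
  have zQ: "0 \<in> Q" using 0 interior_subset by blast
  define S where "S = frontier ((*\<^sub>R) l ` Q)"
  have S: "compact S" unfolding S_def by (intro compact_frontier compact_scaling Q)
  have inj: "inj ((*\<^sub>R) l :: 'a \<Rightarrow> 'a)" using l by (simp add: inj_on_def)
  have int: "interior ((*\<^sub>R) l ` Q) = (*\<^sub>R) l ` interior Q"
    using inj by (intro interior_injective_linear_image) auto
  have QS: "x \<notin> Q" if "x \<in> S" for x
  proof
    assume "x \<in> Q"
    then have "x - (1 - 1 / l) *\<^sub>R (x - 0) \<in> interior Q"
      using l by (intro mem_interior_convex_shrink[OF Q(1) 0]) auto
    then have "(1 / l) *\<^sub>R x \<in> interior Q" by (simp add: algebra_simps)
    then have "l *\<^sub>R ((1 / l) *\<^sub>R x) \<in> interior ((*\<^sub>R) l ` Q)" unfolding int by blast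
    then show False using that l by (simp add: S_def frontier_def)
  qed
  have "\<exists>u b. norm u = 1 \<and> 0 < b \<and> u \<bullet> x > b \<and> (\<forall>y\<in>Q. u \<bullet> y < b)" if xS: "x \<in> S" for x
  proof -
    obtain a c where ac: "a \<bullet> x < c" "\<forall>y\<in>Q. a \<bullet> y > c"
      using separating_hyperplane_closed_point[OF Q(1) compact_imp_closed[OF Q(2)] QS[OF xS]] by blast
    have "c < 0" using ac(2) zQ by fastforce
    then have a: "norm a > 0" using ac by auto
    show ?thesis
      using ac \<open>c < 0\<close> a
      by (intro exI[of _ "- (a /\<^sub>R norm a)"] exI[of _ "- (c / norm a)"]) (auto simp: field_simps)
  qed
  then obtain u b where ub: "\<And>x. x \<in> S \<Longrightarrow> norm (u x) = 1 \<and> 0 < b x \<and> u x \<bullet> x > b x \<and> (\<forall>y\<in>Q. u x \<bullet> y < b x)"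
    by metis
  obtain C where C: "C \<subseteq> S" "finite C" "S \<subseteq> (\<Union>c\<in>C. {y. u c \<bullet> y > b c})"
  proof (rule compactE_image[OF S, of S "\<lambda>c. {y. u c \<bullet> y > b c}"])
    show "S \<subseteq> (\<Union>c\<in>S. {y. b c < u c \<bullet> y})" using ub by blast
  qed (auto simp: open_halfspace_gt)
  define P where "P = halfspaces ((\<lambda>c. (u c, b c)) ` C)"
  have QP: "Q \<subseteq> P" using ub C(1) by (fastforce simp: P_def halfspaces_def)
  have "P \<inter> S = {}"
  proof (rule ccontr)
    assume "P \<inter> S \<noteq> {}"
    then obtain x where "x \<in> P" "x \<in> S" by auto
    then obtain c where "c \<in> C" "u c \<bullet> x > b c" using C(3) by blast
    then show False using \<open>x \<in> P\<close> by (auto simp: P_def halfspaces_def)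
  qed
  moreover have "connected P" unfolding P_def by (intro convex_connected convex_halfspaces)
  moreover have "0 \<in> P" using QP zQ by blast
  moreover have "0 \<in> (*\<^sub>R) l ` Q" using zQ by (auto intro!: image_eqI[of _ _ 0])
  ultimately have PQ: "P \<subseteq> (*\<^sub>R) l ` Q"
    using connected_Int_frontier[of P "(*\<^sub>R) l ` Q"] unfolding S_def by blast
  show ?thesis
  proof (rule that[of "(\<lambda>c. (u c, b c / l)) ` C"])
    \<comment> \<open>Dividing the offsets by \<open>l\<close> describes \<open>P\<close> shrunk by
      that factor.\<close>
    have eq: "x \<in> halfspaces ((\<lambda>c. (u c, b c / l)) ` C) \<longleftrightarrow> l *\<^sub>R x \<in> P" for x
      using l by (auto simp: P_def halfspaces_def field_simps)
    show "halfspaces ((\<lambda>c. (u c, b c / l)) ` C) \<subseteq> Q"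
      using PQ inj by (auto simp: eq dest: injD)
    show "Q \<subseteq> (*\<^sub>R) l ` halfspaces ((\<lambda>c. (u c, b c / l)) ` C)"
    proof
      fix x assume "x \<in> Q"
      then have "(1 / l) *\<^sub>R x \<in> halfspaces ((\<lambda>c. (u c, b c / l)) ` C)" using QP l by (auto simp: eq)
      moreover have "x = l *\<^sub>R ((1 / l) *\<^sub>R x)" using l by simp
      ultimately show "x \<in> (*\<^sub>R) l ` halfspaces ((\<lambda>c. (u c, b c / l)) ` C)" by blast
    qed
  qed (use C(1,2) ub l in auto)
qed

text \<open>Lets the dilation factor of the approximating polytopes tend to 1. The instance
  \<open>l = 2\<close> shows that \<open>x\<close> is finite, after which the limit is taken in the
  reals.\<close>

lemma ennreal_le_if_le_power_mult:
  fixes x y :: ennreal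
  assumes "\<And>l. l > 1 \<Longrightarrow> x \<le> ennreal (l ^ N) * y"
  shows "x \<le> y"
proof (cases "y = \<infinity>")
  case False
  then obtain b where b: "y = ennreal b" "b \<ge> 0" by (cases y) auto
  have "x < \<infinity>" using assms[of 2] by (simp add: b ennreal_mult_less_top order_le_less_trans)
  then obtain a where a: "x = ennreal a" "a \<ge> 0" by (cases x) auto
  have le: "a \<le> l ^ N * b" if "l > 1" for l
    using assms[OF that] that b a by (simp add: ennreal_mult'[symmetric] ennreal_le_iff)
  have "((\<lambda>l. l ^ N * b) \<longlongrightarrow> 1 ^ N * b) (at_right 1)"
    by (intro tendsto_intros)
  moreover have "\<forall>\<^sub>F l in at_right (1::real). a \<le> l ^ N * b"
    using le by (simp add: eventually_at_right_less eventually_at_filter)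
  ultimately have "a \<le> 1 ^ N * b"
    by (rule tendsto_lowerbound) simp
  then show ?thesis using a b by (simp add: ennreal_le_iff)
qed simp

lemma emeasure_scaleR_image:
  fixes S :: "'a::euclidean_space set"
  shows "l \<ge> 0 \<Longrightarrow> emeasure lebesgue ((*\<^sub>R) l ` S) = ennreal (l ^ DIM('a)) * emeasure lebesgue S"
  using emeasure_lebesgue_affine[of l 0 S] by (simp cong: image_cong_simp)

section \<open>From polytopes to convex bodies\<close>

context
  fixes h :: real and k :: nat and Q Z :: "(real ^ 'n) set"
  assumes h: "h > 0" and fin: "disc_area TYPE('n) k < \<infinity>"
    and Q: "convex Q" "compact Q" and Z: "Z \<in> sets lebesgue"
begin

text \<open>Volume contributes the exponent \<open>CARD('n)\<close> and area the exponent
  \<open>k\<close>. Their sum bounds both, so a single factor can be pulled out of expressions that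
  contain volume and area together.\<close>

lemma body_approx:
  assumes 0: "0 \<in> interior Q" and l: "l > 1"
  obtains I :: "((real ^ 'n) \<times> real) set" where "finite I" "\<And>u b. (u, b) \<in> I \<Longrightarrow> norm u = 1"
    "\<And>u b. (u, b) \<in> I \<Longrightarrow> u \<bullet> 0 < b" "halfspaces I \<subseteq> Q"
    "emeasure lebesgue Q \<le> ennreal (l ^ (CARD('n) + k)) * emeasure lebesgue (halfspaces I)"
    "hausdorff_measure k (frontier Q) \<le> ennreal (l ^ (CARD('n) + k)) * hausdorff_measure k (frontier (halfspaces I))"
    "hausdorff_measure k (frontier (halfspaces I)) \<le> hausdorff_measure k (frontier Q)"
proof -
  obtain I where I: "finite I" "\<And>u b. (u, b) \<in> I \<Longrightarrow> norm u = 1 \<and> 0 < b"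
      "halfspaces I \<subseteq> Q" "Q \<subseteq> (*\<^sub>R) l ` halfspaces I"
    using convex_approx_halfspaces[OF Q 0 l] by metis
  let ?P = "halfspaces I"
  have bP: "bounded ?P" using I(3) Q(2) by (metis bounded_subset compact_imp_bounded)
  have "emeasure lebesgue Q \<le> emeasure lebesgue ((*\<^sub>R) l ` ?P)"
    using I(4) by (intro emeasure_mono) (auto intro!: lmeasurable_compact compact_scaling fmeasurableD simp: compact_eq_bounded_closed bP closed_halfspaces)
  also have "\<dots> = ennreal (l ^ CARD('n)) * emeasure lebesgue ?P"
    using l emeasure_scaleR_image[of l ?P] by simp
  also have "\<dots> \<le> ennreal (l ^ (CARD('n) + k)) * emeasure lebesgue ?P"
    using l by (intro mult_right_mono ennreal_leI power_increasing) auto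
  finally have 1: "emeasure lebesgue Q \<le> ennreal (l ^ (CARD('n) + k)) * emeasure lebesgue ?P" .
  have "hausdorff_measure k (frontier Q) \<le> hausdorff_measure k (frontier ((*\<^sub>R) l ` ?P))"
    using Q 0 I(4) bP by (intro hausdorff_frontier_mono compact_imp_closed bounded_scaling) auto
  also have "\<dots> \<le> ennreal (l ^ k) * hausdorff_measure k (frontier ?P)"
    unfolding frontier_scaleR[OF less_imp_neq[OF order.strict_trans[OF zero_less_one l], symmetric]]
    using l by (intro hausdorff_measure_lipschitz_image) (auto simp: dist_norm simp flip: scaleR_diff_right)
  also have "\<dots> \<le> ennreal (l ^ (CARD('n) + k)) * hausdorff_measure k (frontier ?P)"
    using l by (intro mult_right_mono ennreal_leI power_increasing) auto
  finally have 2: "hausdorff_measure k (frontier Q) \<le> ennreal (l ^ (CARD('n) + k)) * hausdorff_measure k (frontier ?P)" .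
  have "interior ?P \<noteq> {}"
  proof -
    have "(*\<^sub>R) l ` interior ?P = interior ((*\<^sub>R) l ` ?P)"
      using l by (intro interior_injective_linear_image[symmetric]) (auto simp: inj_on_def)
    also have "\<dots> \<noteq> {}" using 0 interior_mono[OF I(4)] by blast
    finally show ?thesis by blast
  qed
  then have 3: "hausdorff_measure k (frontier ?P) \<le> hausdorff_measure k (frontier Q)"
    using I(3) Q(2) by (intro hausdorff_frontier_mono convex_halfspaces closed_halfspaces compact_imp_bounded)
  show ?thesis using I 1 2 3 by (intro that[of I]) auto
qed

lemma body_outer_centered:
  assumes 0: "0 \<in> interior Q" and QZ: "\<And>x. x \<in> Q \<Longrightarrow> cball x h \<subseteq> Z"
  shows "disc_area TYPE('n) k * emeasure lebesgue Q
      + hausdorff_measure k (frontier Q) * cylinder_volume TYPE('n) h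
     \<le> disc_area TYPE('n) k * emeasure lebesgue Z"
proof (rule ennreal_le_if_le_power_mult)
  fix l :: real assume l: "l > 1"
  let ?N = "CARD('n) + k"
  obtain I :: "((real ^ 'n) \<times> real) set" where I: "finite I" "\<And>u b. (u, b) \<in> I \<Longrightarrow> norm u = 1"
    "halfspaces I \<subseteq> Q"
    "emeasure lebesgue Q \<le> ennreal (l ^ ?N) * emeasure lebesgue (halfspaces I)"
    "hausdorff_measure k (frontier Q) \<le> ennreal (l ^ ?N) * hausdorff_measure k (frontier (halfspaces I))"
    using body_approx[OF 0 l] by metis
  have "disc_area TYPE('n) k * emeasure lebesgue Q
      + hausdorff_measure k (frontier Q) * cylinder_volume TYPE('n) h
    \<le> disc_area TYPE('n) k * (ennreal (l ^ ?N) * emeasure lebesgue (halfspaces I))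
      + (ennreal (l ^ ?N) * hausdorff_measure k (frontier (halfspaces I))) * cylinder_volume TYPE('n) h"
    using I(4,5) by (intro add_mono mult_left_mono mult_right_mono) auto
  also have "\<dots> = ennreal (l ^ ?N) * (disc_area TYPE('n) k * emeasure lebesgue (halfspaces I)
      + hausdorff_measure k (frontier (halfspaces I)) * cylinder_volume TYPE('n) h)"
    by (simp only: distrib_left ac_simps)
  also have "\<dots> \<le> ennreal (l ^ ?N) * (disc_area TYPE('n) k * emeasure lebesgue Z)"
    using I(3) QZ by (intro mult_left_mono polytope_outer I h fin Z) auto
  finally show "disc_area TYPE('n) k * emeasure lebesgue Q
      + hausdorff_measure k (frontier Q) * cylinder_volume TYPE('n) h
    \<le> ennreal (l ^ ?N) * (disc_area TYPE('n) k * emeasure lebesgue Z)" .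
qed

lemma body_inner_centered:
  assumes 0: "0 \<in> interior Q" and QZ: "\<And>x. cball x h \<subseteq> Q \<Longrightarrow> x \<in> Z"
  shows "disc_area TYPE('n) k * emeasure lebesgue Q \<le> disc_area TYPE('n) k * emeasure lebesgue Z
      + hausdorff_measure k (frontier Q) * cylinder_volume TYPE('n) h"
proof (rule ennreal_le_if_le_power_mult)
  fix l :: real assume l: "l > 1"
  let ?N = "CARD('n) + k"
  obtain I :: "((real ^ 'n) \<times> real) set" where I: "finite I" "\<And>u b. (u, b) \<in> I \<Longrightarrow> norm u = 1"
    "\<And>u b. (u, b) \<in> I \<Longrightarrow> u \<bullet> 0 < b" "halfspaces I \<subseteq> Q"
    "emeasure lebesgue Q \<le> ennreal (l ^ ?N) * emeasure lebesgue (halfspaces I)"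
    "hausdorff_measure k (frontier (halfspaces I)) \<le> hausdorff_measure k (frontier Q)"
    using body_approx[OF 0 l] by metis
  have "disc_area TYPE('n) k * emeasure lebesgue Q
      \<le> disc_area TYPE('n) k * (ennreal (l ^ ?N) * emeasure lebesgue (halfspaces I))"
    using I(5) by (rule mult_left_mono) simp
  also have "\<dots> = ennreal (l ^ ?N) * (disc_area TYPE('n) k * emeasure lebesgue (halfspaces I))"
    by (simp only: ac_simps)
  also have "\<dots> \<le> ennreal (l ^ ?N) * (disc_area TYPE('n) k * emeasure lebesgue Z
      + hausdorff_measure k (frontier (halfspaces I)) * cylinder_volume TYPE('n) h)"
    using I(4) QZ by (intro mult_left_mono polytope_inner[where z = 0] I h fin Z) auto
  also have "\<dots> \<le> ennreal (l ^ ?N) * (disc_area TYPE('n) k * emeasure lebesgue Z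
      + hausdorff_measure k (frontier Q) * cylinder_volume TYPE('n) h)"
    using I(6) by (intro mult_left_mono add_left_mono mult_right_mono) auto
  finally show "disc_area TYPE('n) k * emeasure lebesgue Q
      \<le> ennreal (l ^ ?N) * (disc_area TYPE('n) k * emeasure lebesgue Z
      + hausdorff_measure k (frontier Q) * cylinder_volume TYPE('n) h)" .
qed

end

lemma emeasure_translation: "emeasure lebesgue ((+) a ` S) = emeasure lebesgue (S :: 'a::euclidean_space set)"
  using emeasure_lebesgue_affine[of 1 a S] by (simp add: add.commute cong: image_cong_simp)

lemma hausdorff_frontier_translation:
  "hausdorff_measure k (frontier ((+) a ` S)) = hausdorff_measure k (frontier (S :: 'a::euclidean_space set))"
  unfolding frontier_translation by (rule hausdorff_measure_isometry_image) simp

lemma interior_translate_to_0: "a \<in> interior S \<Longrightarrow> 0 \<in> interior ((+) (- a) ` S)"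
  for a :: "'a::euclidean_space"
  unfolding interior_translation by (auto intro!: image_eqI[of _ _ a])

lemma cball_translate: "(+) a ` cball x r = cball (a + x) r" for a :: "'a::real_normed_vector"
  by (rule cball_translation[symmetric])

theorem body_outer:
  fixes Q Z :: "(real ^ 'n) set"
  assumes h: "h > 0" and fin: "disc_area TYPE('n) k < \<infinity>"
    and Q: "convex Q" "compact Q" "interior Q \<noteq> {}" and Z: "Z \<in> sets lebesgue"
    and QZ: "\<And>x. x \<in> Q \<Longrightarrow> cball x h \<subseteq> Z"
  shows "disc_area TYPE('n) k * emeasure lebesgue Q
      + hausdorff_measure k (frontier Q) * cylinder_volume TYPE('n) h
     \<le> disc_area TYPE('n) k * emeasure lebesgue Z"
proof -
  obtain a where a: "a \<in> interior Q" using Q(3) by blast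
  have "disc_area TYPE('n) k * emeasure lebesgue ((+) (- a) ` Q)
      + hausdorff_measure k (frontier ((+) (- a) ` Q)) * cylinder_volume TYPE('n) h
     \<le> disc_area TYPE('n) k * emeasure lebesgue ((+) (- a) ` Z)"
  proof (rule body_outer_centered[OF h fin])
    fix x assume "x \<in> (+) (- a) ` Q"
    then obtain y where "y \<in> Q" "a + x = y" by auto
    then have "cball (a + x) h \<subseteq> Z" using QZ by blast
    then have "(+) (- a) ` cball (a + x) h \<subseteq> (+) (- a) ` Z" by blast
    then show "cball x h \<subseteq> (+) (- a) ` Z" unfolding cball_translate by simp
  qed (rule convex_translation[OF Q(1)] compact_translation[OF Q(2)] lebesgue_sets_translation[OF Z]
      interior_translate_to_0[OF a])+
  then show ?thesis unfolding emeasure_translation hausdorff_frontier_translation .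
qed

theorem body_inner:
  fixes Q Z :: "(real ^ 'n) set"
  assumes h: "h > 0" and fin: "disc_area TYPE('n) k < \<infinity>"
    and Q: "convex Q" "compact Q" "interior Q \<noteq> {}" and Z: "Z \<in> sets lebesgue"
    and QZ: "\<And>x. cball x h \<subseteq> Q \<Longrightarrow> x \<in> Z"
  shows "disc_area TYPE('n) k * emeasure lebesgue Q \<le> disc_area TYPE('n) k * emeasure lebesgue Z
      + hausdorff_measure k (frontier Q) * cylinder_volume TYPE('n) h"
proof -
  obtain a where a: "a \<in> interior Q" using Q(3) by blast
  have "disc_area TYPE('n) k * emeasure lebesgue ((+) (- a) ` Q) \<le> disc_area TYPE('n) k * emeasure lebesgue ((+) (- a) ` Z)
      + hausdorff_measure k (frontier ((+) (- a) ` Q)) * cylinder_volume TYPE('n) h"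
  proof (rule body_inner_centered[OF h fin])
    fix x assume "cball x h \<subseteq> (+) (- a) ` Q"
    then have "(+) a ` cball x h \<subseteq> (+) a ` (+) (- a) ` Q" by blast
    then have "cball (a + x) h \<subseteq> Q" unfolding cball_translate by (simp add: image_image)
    then have "a + x \<in> Z" by (rule QZ)
    then show "x \<in> (+) (- a) ` Z" by (intro image_eqI[of _ _ "a + x"]) auto
  qed (rule convex_translation[OF Q(1)] compact_translation[OF Q(2)] lebesgue_sets_translation[OF Z]
      interior_translate_to_0[OF a])+
  then show ?thesis unfolding emeasure_translation hausdorff_frontier_translation .
qed

text \<open>Lines orthogonal to a central disc of a ball inside \<open>Q\<close> must meet the
  boundary. Hence projecting along them and rescaling is a Lipschitz map whose image of the boundary
  contains the unit disc.\<close>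

lemma hausdorff_frontier_infinite:
  fixes Q :: "(real ^ 'n) set"
  assumes inf: "disc_area TYPE('n) k = \<infinity>" and Q: "bounded Q" "interior Q \<noteq> {}"
  shows "hausdorff_measure k (frontier Q) = \<infinity>"
proof -
  define e where "e = (axis undefined 1 :: real ^ 'n)"
  have ee: "e \<bullet> e = 1" and ne: "norm e = 1" by (simp_all add: e_def inner_axis_axis)
  obtain a r where r: "r > 0" "cball a r \<subseteq> Q"
    using Q(2) mem_interior_cball by blast
  define p where "p y = y - (e \<bullet> y) *\<^sub>R e" for y
  define f where "f y = (1 / r) *\<^sub>R p (y - a)" for y
  have lip: "dist (f x) (f y) \<le> (1 / r) * dist x y" for x y
  proof -
    have "norm (p z) \<le> norm z" for z
    proof -
      have "norm (p z) ^ 2 = norm z ^ 2 - (e \<bullet> z) * (e \<bullet> z)"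
        unfolding p_def power2_norm_eq_inner by (simp add: inner_diff_left inner_diff_right ee inner_commute)
      moreover have "0 \<le> (e \<bullet> z) * (e \<bullet> z)" by simp
      ultimately have "norm (p z) ^ 2 \<le> norm z ^ 2" by linarith
      then show ?thesis by (rule power2_le_imp_le) simp
    qed
    moreover have "f x - f y = (1 / r) *\<^sub>R p (x - y)"
      unfolding f_def p_def inner_diff_right by (simp add: algebra_simps)
    ultimately show ?thesis using r(1) by (simp add: dist_norm divide_right_mono)
  qed
  have "cball 0 1 \<inter> {x. e \<bullet> x = 0} \<subseteq> f ` frontier Q"
  proof
    fix x assume x: "x \<in> cball 0 1 \<inter> {x. e \<bullet> x = 0}"
    define g where "g s = a + r *\<^sub>R x + s *\<^sub>R e" for s :: real
    have "connected (range g)"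
      unfolding g_def by (intro connected_continuous_image continuous_intros) auto
    moreover have "range g \<inter> Q \<noteq> {}"
    proof -
      have "g 0 \<in> cball a r" using x r(1) by (simp add: g_def dist_norm mult_left_le)
      then show ?thesis using r(2) by blast
    qed
    moreover have "range g - Q \<noteq> {}"
    proof
      assume "range g - Q = {}"
      obtain B where B: "B > 0" "\<And>x. x \<in> Q \<Longrightarrow> norm x \<le> B"
        using Q(1) bounded_pos by blast
      define s where "s = B + norm (a + r *\<^sub>R x) + 1"
      have "norm (g s) \<le> B" using \<open>range g - Q = {}\<close> B(2) by blast
      moreover have "norm (s *\<^sub>R e) \<le> norm (g s) + norm (a + r *\<^sub>R x)"
        using norm_triangle_ineq4[of "g s" "a + r *\<^sub>R x"] by (simp add: g_def)
      moreover have "norm (s *\<^sub>R e) = s" using B(1) ne by (simp add: s_def)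
      ultimately show False by (simp add: s_def)
    qed
    ultimately have "range g \<inter> frontier Q \<noteq> {}" by (rule connected_Int_frontier)
    then obtain s where s: "g s \<in> frontier Q" by auto
    have "f (g s) = x"
      using x r(1) by (simp add: f_def g_def p_def inner_add_right inner_diff_right ee algebra_simps)
    then show "x \<in> f ` frontier Q" using s by blast
  qed
  then have "disc_area TYPE('n) k \<le> hausdorff_measure k (f ` frontier Q)"
    unfolding disc_area_def e_def by (rule hausdorff_measure_mono)
  also have "\<dots> \<le> ennreal ((1 / r) ^ k) * hausdorff_measure k (frontier Q)"
    using r(1) lip by (intro hausdorff_measure_lipschitz_image) auto
  finally show ?thesis using inf by (auto simp: top_unique ennreal_mult_eq_top_iff)
qed

subsection \<open>The Brunn-Minkowski inequality\<close>

text \<open>Excluding degenerate boxes and the empty family makes the total volume positive, so that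
  it can be divided in a given proportion.\<close>

definition box_family :: "'a::euclidean_space set set \<Rightarrow> bool" where
  "box_family D \<longleftrightarrow> finite D \<and> D \<noteq> {} \<and> (\<forall>K\<in>D. interior K \<noteq> {} \<and> (\<exists>a b. K = cbox a b))
     \<and> pairwise (\<lambda>K L. interior K \<inter> interior L = {}) D"

text \<open>Boxes left without interior are dropped. This keeps the result a
  \<open>box_family\<close> and lets the number of boxes fall.\<close>

definition cut_family :: "'a::euclidean_space set set \<Rightarrow> 'a set \<Rightarrow> 'a set set" where
  "cut_family D H = (\<lambda>K. K \<inter> H) ` {K \<in> D. interior (K \<inter> H) \<noteq> {}}"

lemma box_familyE:
  assumes "box_family D" "K \<in> D"
  obtains a b where "K = cbox a b" "box a b \<noteq> {}"
  using assms unfolding box_family_def by (metis interior_cbox)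

lemma box_family_content_pos:
  assumes "box_family D" "K \<in> D"
  shows "measure lborel K > 0"
proof -
  obtain a b where "K = cbox a b" "box a b \<noteq> {}" using assms by (rule box_familyE)
  then show ?thesis using content_eq_0_interior[of a b] by (simp add: zero_less_measure_iff)
qed

lemma box_family_sum_pos: "box_family D \<Longrightarrow> (\<Sum>K\<in>D. measure lborel K) > 0"
  using box_family_content_pos by (intro sum_pos) (auto simp: box_family_def)

text \<open>\<open>H\<close> will be one of the two closed sides of a coordinate hyperplane. The
  strict decrease in the number of boxes drives the induction for the Brunn-Minkowski
  inequality.\<close>

lemma cut_family:
  assumes D: "box_family D" and H: "\<And>a b :: 'a::euclidean_space. \<exists>c d. cbox a b \<inter> H = cbox c d"
    and ne: "(\<Sum>K\<in>D. measure lborel (K \<inter> H)) > 0"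
  shows "box_family (cut_family D H)"
    and "(\<Sum>K\<in>cut_family D H. measure lborel K) = (\<Sum>K\<in>D. measure lborel (K \<inter> H))"
    and "card (cut_family D H) \<le> card D"
    and "L \<in> D \<Longrightarrow> interior (L \<inter> H) = {} \<Longrightarrow> card (cut_family D H) < card D"
    and "\<Union>(cut_family D H) \<subseteq> \<Union>D \<inter> H"
proof -
  let ?D = "{K \<in> D. interior (K \<inter> H) \<noteq> {}}"
  have fin: "finite D" using D by (simp add: box_family_def)
  have 0: "measure lborel (K \<inter> H) = 0" if KD: "K \<in> D" and e: "interior (K \<inter> H) = {}" for K
  proof -
    obtain a b where K: "K = cbox a b" using D KD by (rule box_familyE)
    obtain c d where "cbox a b \<inter> H = cbox c d" using H by blast
    then show ?thesis using e content_eq_0_interior[of c d] by (simp add: K)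
  qed
  have disj: "interior (K \<inter> H) \<inter> interior (L \<inter> H) = {}" if "K \<in> D" "L \<in> D" "K \<noteq> L" for K L
  proof -
    have "interior K \<inter> interior L = {}" using D that by (auto simp: box_family_def pairwise_def)
    then show ?thesis using interior_mono[of "K \<inter> H" K] interior_mono[of "L \<inter> H" L] by blast
  qed
  \<comment> \<open>Two boxes with the same cut would share its nonempty interior.\<close>
  then have inj: "inj_on (\<lambda>K. K \<inter> H) ?D"
    by (intro inj_onI) (metis (mono_tags, lifting) Int_absorb mem_Collect_eq)
  show sum: "(\<Sum>K\<in>cut_family D H. measure lborel K) = (\<Sum>K\<in>D. measure lborel (K \<inter> H))"
    unfolding cut_family_def sum.reindex[OF inj] o_def
    using fin 0 by (intro sum.mono_neutral_left) auto
  show "box_family (cut_family D H)"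
    unfolding box_family_def
  proof (intro conjI ballI)
    show "finite (cut_family D H)" using fin by (simp add: cut_family_def)
    show "cut_family D H \<noteq> {}" using sum ne by force
    fix M assume "M \<in> cut_family D H"
    then obtain K where K: "K \<in> D" "interior (K \<inter> H) \<noteq> {}" "M = K \<inter> H" by (auto simp: cut_family_def)
    then show "interior M \<noteq> {}" by simp
    obtain a b where "K = cbox a b" using D K(1) by (rule box_familyE)
    then show "\<exists>a b. M = cbox a b" using H K by simp
  next
    show "pairwise (\<lambda>K L. interior K \<inter> interior L = {}) (cut_family D H)"
      using disj unfolding pairwise_def cut_family_def by fastforce
  qed
  have card: "card (cut_family D H) = card ?D"
    unfolding cut_family_def by (rule card_image[OF inj])
  show "card (cut_family D H) \<le> card D"
    unfolding card using fin by (intro card_mono) auto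
  show "card (cut_family D H) < card D" if "L \<in> D" "interior (L \<inter> H) = {}"
    unfolding card using fin that by (intro psubset_card_mono) auto
  show "\<Union>(cut_family D H) \<subseteq> \<Union>D \<inter> H" by (auto simp: cut_family_def)
qed

lemma halfspace_cuts_box:
  fixes i :: "'a::euclidean_space"
  assumes "i \<in> Basis"
  shows "\<exists>c d. cbox a b \<inter> {x. x \<bullet> i \<le> t} = cbox c d" "\<exists>c d. cbox a b \<inter> {x. t \<le> x \<bullet> i} = cbox c d"
  using interval_split[OF assms, of a b t] by blast+

text \<open>The closed form shows that the volume depends continuously on \<open>t\<close>, as the
  intermediate value theorem in \<open>box_family_proportion\<close> requires.\<close>

lemma content_box_halfspace:
  fixes i :: "'a::euclidean_space"
  assumes i: "i \<in> Basis" and ab: "\<And>j. j \<in> Basis \<Longrightarrow> a \<bullet> j \<le> b \<bullet> j"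
  shows "measure lborel (cbox a b \<inter> {x. x \<bullet> i \<le> t})
    = (\<Prod>j\<in>Basis - {i}. b \<bullet> j - a \<bullet> j) * max 0 (min (b \<bullet> i) t - a \<bullet> i)"
proof -
  define c where "c = (\<Sum>j\<in>Basis. (if j = i then min (b \<bullet> i) t else b \<bullet> j) *\<^sub>R j)"
  have c: "c \<bullet> j = (if j = i then min (b \<bullet> i) t else b \<bullet> j)" if "j \<in> Basis" for j
    unfolding c_def using that by (subst inner_sum_left_Basis) auto
  have eq: "cbox a b \<inter> {x. x \<bullet> i \<le> t} = cbox a c"
    unfolding c_def by (rule interval_split(1)[OF i])
  show ?thesis
  proof (cases "a \<bullet> i \<le> t")
    case True
    have "measure lborel (cbox a c) = (\<Prod>j\<in>Basis. c \<bullet> j - a \<bullet> j)"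
      using True ab by (intro content_cbox) (auto simp: c)
    also have "\<dots> = (c \<bullet> i - a \<bullet> i) * (\<Prod>j\<in>Basis - {i}. c \<bullet> j - a \<bullet> j)"
      using i by (simp add: prod.remove)
    also have "(\<Prod>j\<in>Basis - {i}. c \<bullet> j - a \<bullet> j) = (\<Prod>j\<in>Basis - {i}. b \<bullet> j - a \<bullet> j)"
      by (intro prod.cong) (auto simp: c)
    finally show ?thesis using True ab[OF i] by (simp add: eq c[OF i] mult.commute)
  next
    case False
    then have "measure lborel (cbox a c) = 0"
      using i ab[OF i] by (auto simp: content_eq_0 c min_def intro!: bexI[of _ i])
    then show ?thesis using False by (simp add: eq)
  qed
qed

lemma box_family_proportion:
  assumes D: "box_family D" and i: "i \<in> Basis" and p: "0 < p" "p < 1"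
  obtains t where "(\<Sum>K\<in>D. measure lborel (K \<inter> {x. x \<bullet> i \<le> t})) = p * (\<Sum>K\<in>D. measure lborel K)"
    "(\<Sum>K\<in>D. measure lborel (K \<inter> {x. t \<le> x \<bullet> i})) = (1 - p) * (\<Sum>K\<in>D. measure lborel K)"
proof -
  let ?S = "\<Sum>K\<in>D. measure lborel K"
  have S: "?S > 0" by (rule box_family_sum_pos[OF D])
  define g where "g t = (\<Sum>K\<in>D. measure lborel (K \<inter> {x. x \<bullet> i \<le> t}))" for t
  have cont: "continuous_on A g" for A
    unfolding g_def
  proof (intro continuous_on_sum)
    fix K assume "K \<in> D"
    with D obtain a b where K: "K = cbox a b" and ne: "box a b \<noteq> {}" by (rule box_familyE)
    have "a \<bullet> j \<le> b \<bullet> j" if "j \<in> Basis" for j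
      using ne that by (auto simp: box_ne_empty less_imp_le)
    then show "continuous_on A (\<lambda>t. measure lborel (K \<inter> {x. x \<bullet> i \<le> t}))"
      unfolding K by (subst content_box_halfspace[OF i]) (auto intro!: continuous_intros)
  qed
  have "bounded (\<Union>D)"
    using D by (intro bounded_Union) (auto simp: box_family_def)
  then obtain B where B: "B > 0" "\<And>x. x \<in> \<Union>D \<Longrightarrow> norm x \<le> B"
    by (auto simp: bounded_pos)
  have Bi: "\<bar>x \<bullet> i\<bar> \<le> B" if "x \<in> \<Union>D" for x
    using B(2)[OF that] Basis_le_norm[OF i, of x] by linarith
  have "K \<inter> {x. x \<bullet> i \<le> - B - 1} = {}" if "K \<in> D" for K
  proof (rule ccontr)
    assume "K \<inter> {x. x \<bullet> i \<le> - B - 1} \<noteq> {}"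
    then obtain x where "x \<in> K" "x \<bullet> i \<le> - B - 1" by auto
    moreover have "x \<in> \<Union>D" using \<open>x \<in> K\<close> that by blast
    ultimately show False using Bi[of x] by linarith
  qed
  then have g0: "g (- B - 1) = 0" by (simp add: g_def)
  have "K \<inter> {x. x \<bullet> i \<le> B} = K" if "K \<in> D" for K
  proof -
    have "x \<bullet> i \<le> B" if "x \<in> K" for x
    proof -
      have "x \<in> \<Union>D" using that \<open>K \<in> D\<close> by blast
      then show ?thesis using Bi[of x] by linarith
    qed
    then show ?thesis by auto
  qed
  then have g1: "g B = ?S" by (simp add: g_def)
  obtain t where t: "g t = p * ?S"
    using IVT'[of g "- B - 1" "p * ?S" B] g0 g1 S p B(1) cont by (auto simp: mult_left_le_one_le)
  have "?S = (\<Sum>K\<in>D. measure lborel (K \<inter> {x. x \<bullet> i \<le> t}) + measure lborel (K \<inter> {x. t \<le> x \<bullet> i}))"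
  proof (intro sum.cong refl)
    fix K assume "K \<in> D"
    with D obtain a b where "K = cbox a b" by (rule box_familyE)
    then show "measure lborel K = measure lborel (K \<inter> {x. x \<bullet> i \<le> t}) + measure lborel (K \<inter> {x. t \<le> x \<bullet> i})"
      using content_split[OF i, of a b t] by simp
  qed
  also have "\<dots> = g t + (\<Sum>K\<in>D. measure lborel (K \<inter> {x. t \<le> x \<bullet> i}))"
    by (simp add: g_def sum.distrib)
  finally have "(\<Sum>K\<in>D. measure lborel (K \<inter> {x. t \<le> x \<bullet> i})) = (1 - p) * ?S"
    using t by (simp add: algebra_simps)
  then show ?thesis using that t by (simp add: g_def)
qed

text \<open>Brunn-Minkowski for two boxes, in terms of their edge lengths. The inequality of
  arithmetic and geometric means is applied to the fractions \<open>a i / (a i + b i)\<close> and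
  \<open>b i / (a i + b i)\<close>, whose averages add up to 1.\<close>

lemma root_prod_add_le:
  fixes a b :: "'i \<Rightarrow> real"
  assumes I: "finite I" "I \<noteq> {}" and pos: "\<And>i. i \<in> I \<Longrightarrow> a i > 0" "\<And>i. i \<in> I \<Longrightarrow> b i > 0"
  shows "root (card I) (\<Prod>i\<in>I. a i) + root (card I) (\<Prod>i\<in>I. b i) \<le> root (card I) (\<Prod>i\<in>I. a i + b i)"
proof -
  let ?n = "card I"
  have n: "?n > 0" using I by (simp add: card_gt_0_iff)
  let ?P = "\<Prod>i\<in>I. a i + b i"
  have P: "?P > 0" using pos by (intro prod_pos) (simp add: add_pos_pos)
  have amgm: "root ?n (\<Prod>i\<in>I. f i) \<le> (\<Sum>i\<in>I. f i / ?n)" if "\<And>i. i \<in> I \<Longrightarrow> f i > 0" for f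
    using arith_geom_mean[OF I, of f] that n
    by (simp add: root_powr_inverse prod_pos less_imp_le inverse_eq_divide)
  have "root ?n (\<Prod>i\<in>I. a i / (a i + b i)) + root ?n (\<Prod>i\<in>I. b i / (a i + b i))
      \<le> (\<Sum>i\<in>I. a i / (a i + b i) / ?n) + (\<Sum>i\<in>I. b i / (a i + b i) / ?n)"
    using pos by (intro add_mono amgm) (auto intro!: divide_pos_pos add_pos_pos)
  also have "\<dots> = (\<Sum>i\<in>I. 1 / ?n)"
    unfolding sum.distrib[symmetric]
  proof (intro sum.cong refl)
    fix i assume "i \<in> I"
    then have "a i + b i \<noteq> 0" using pos[of i] by simp
    then show "a i / (a i + b i) / ?n + b i / (a i + b i) / ?n = 1 / ?n"
      by (simp flip: add_divide_distrib)
  qed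
  also have "\<dots> = 1" using n by simp
  finally have "(root ?n (\<Prod>i\<in>I. a i) + root ?n (\<Prod>i\<in>I. b i)) / root ?n ?P \<le> 1"
    using n by (simp add: prod_dividef real_root_divide add_divide_distrib)
  then show ?thesis using P n by (simp add: divide_le_eq_1_pos)
qed

lemma box_sum_decompose:
  fixes a b c d :: "'a::euclidean_space"
  assumes ab: "\<And>i. i \<in> Basis \<Longrightarrow> a \<bullet> i < b \<bullet> i" and cd: "\<And>i. i \<in> Basis \<Longrightarrow> c \<bullet> i < d \<bullet> i"
    and z: "z \<in> cbox (a + c) (b + d)"
  obtains x y where "x \<in> cbox a b" "y \<in> cbox c d" "z = x + y"
proof -
  \<comment> \<open>Each coordinate of \<open>x\<close> is the least one that keeps \<open>x\<close>
    in its box without pushing \<open>z - x\<close> above \<open>d\<close>.\<close>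
  define x where "x = (\<Sum>i\<in>Basis. max (a \<bullet> i) (z \<bullet> i - d \<bullet> i) *\<^sub>R i)"
  have x: "x \<bullet> i = max (a \<bullet> i) (z \<bullet> i - d \<bullet> i)" if "i \<in> Basis" for i
    unfolding x_def using that by (subst inner_sum_left_Basis) auto
  have zi: "a \<bullet> i + c \<bullet> i \<le> z \<bullet> i \<and> z \<bullet> i \<le> b \<bullet> i + d \<bullet> i" if "i \<in> Basis" for i
    using z that by (auto simp: mem_box inner_add_left)
  have "x \<in> cbox a b"
    using zi ab by (fastforce simp: mem_box x max_def)
  moreover have "z - x \<in> cbox c d"
    using zi cd by (fastforce simp: mem_box x max_def inner_diff_left)
  ultimately show ?thesis using that[of x "z - x"] by simp
qed

text \<open>
  Hadwiger-Ohmann: a coordinate hyperplane separates two boxes of one family; a parallel one cuts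
  the other family in the same proportion, and both halves consist of fewer boxes in total.
\<close>

lemma brunn_minkowski_boxes:
  fixes D E :: "'a::euclidean_space set set"
  assumes "box_family D" "box_family E" and C: "C \<in> lmeasurable"
    and "\<And>x y. x \<in> \<Union>D \<Longrightarrow> y \<in> \<Union>E \<Longrightarrow> x + y \<in> C"
  shows "(root DIM('a) (\<Sum>K\<in>D. measure lborel K) + root DIM('a) (\<Sum>K\<in>E. measure lborel K)) ^ DIM('a) \<le> measure lebesgue C"
  using assms
proof (induction "card D + card E" arbitrary: D E C rule: less_induct)
  case less
  let ?n = "DIM('a)"
  have n: "?n > 0" by simp
  \<comment> \<open>Stated for arbitrary families with two boxes in the first one, so that it also
    serves with the roles of the families exchanged.\<close>
  have step: "(root ?n (\<Sum>K\<in>D. measure lborel K) + root ?n (\<Sum>K\<in>E. measure lborel K)) ^ ?n \<le> measure lebesgue C"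
    if D: "box_family D" and E: "box_family E" and C: "C \<in> lmeasurable"
      and sub: "\<And>x y. x \<in> \<Union>D \<Longrightarrow> y \<in> \<Union>E \<Longrightarrow> x + y \<in> C"
      and KL: "K \<in> D" "L \<in> D" "K \<noteq> L"
      and IH: "\<And>(D' :: 'a set set) E' C'. card D' + card E' < card D + card E \<Longrightarrow> box_family D' \<Longrightarrow> box_family E' \<Longrightarrow>
         C' \<in> lmeasurable \<Longrightarrow> (\<And>x y. x \<in> \<Union>D' \<Longrightarrow> y \<in> \<Union>E' \<Longrightarrow> x + y \<in> C') \<Longrightarrow>
         (root ?n (\<Sum>K\<in>D'. measure lborel K) + root ?n (\<Sum>K\<in>E'. measure lborel K)) ^ ?n \<le> measure lebesgue C'"
    for D E :: "'a set set" and C K L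
  proof -
    let ?SD = "\<Sum>K\<in>D. measure lborel K" and ?SE = "\<Sum>K\<in>E. measure lborel K"
    have SD: "?SD > 0" and SE: "?SE > 0" using D E by (simp_all add: box_family_sum_pos)
    have finD: "finite D" using D by (simp add: box_family_def)
    obtain i s K1 K2 where i: "i \<in> Basis" and K12: "K1 \<in> D" "K2 \<in> D"
        "K1 \<subseteq> {x. x \<bullet> i \<le> s}" "K2 \<subseteq> {x. s \<le> x \<bullet> i}"
    proof -
      obtain a b where 1: "K = cbox a b" "box a b \<noteq> {}" using D KL(1) by (rule box_familyE)
      obtain c d where 2: "L = cbox c d" "box c d \<noteq> {}" using D KL(2) by (rule box_familyE)
      note ab = 1 2
      have "interior K \<inter> interior L = {}" using D KL unfolding box_family_def pairwise_def by blast
      then have "box a b \<inter> box c d = {}" by (simp add: ab)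
      then obtain i where i: "i \<in> Basis" "min (b \<bullet> i) (d \<bullet> i) \<le> max (a \<bullet> i) (c \<bullet> i)"
        unfolding box_Int_box box_eq_empty by auto
      have "a \<bullet> i < b \<bullet> i" "c \<bullet> i < d \<bullet> i" using ab i by (auto simp: box_ne_empty)
      then consider "b \<bullet> i \<le> c \<bullet> i" | "d \<bullet> i \<le> a \<bullet> i" using i by (auto simp: min_def max_def split: if_splits)
      then show ?thesis
      proof cases
        case 1
        then show ?thesis using that[of i K L "b \<bullet> i"] i KL ab by (fastforce simp: mem_box)
      next
        case 2
        then show ?thesis using that[of i L K "d \<bullet> i"] i KL ab by (fastforce simp: mem_box)
      qed
    qed
    let ?L = "\<lambda>s. {x :: 'a. x \<bullet> i \<le> s}" and ?R = "\<lambda>s. {x :: 'a. s \<le> x \<bullet> i}"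
    have eqK: "K1 \<inter> ?L s = K1" "K2 \<inter> ?R s = K2" using K12 by auto
    have thin: "interior (?L s \<inter> ?R s) = {}"
    proof -
      have "?L s \<inter> ?R s = {x. i \<bullet> x = s}" by (auto simp: inner_commute)
      then show ?thesis using i interior_hyperplane[of i s] by (auto simp: nonzero_Basis)
    qed
    \<comment> \<open>\<open>K1\<close> is lost on the right side and \<open>K2\<close> on the left,
      so each side has strictly fewer boxes of \<open>D\<close>, and no more boxes of
      \<open>E\<close> than before.\<close>
    have K1R: "interior (K1 \<inter> ?R s) = {}" and K2L: "interior (K2 \<inter> ?L s) = {}"
      using interior_mono[of "K1 \<inter> ?R s" "?L s \<inter> ?R s"] interior_mono[of "K2 \<inter> ?L s" "?L s \<inter> ?R s"] thin K12 by blast+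
    define p where "p = (\<Sum>K\<in>D. measure lborel (K \<inter> ?L s)) / ?SD"
    have split: "?SD = (\<Sum>K\<in>D. measure lborel (K \<inter> ?L s)) + (\<Sum>K\<in>D. measure lborel (K \<inter> ?R s))"
      unfolding sum.distrib[symmetric]
    proof (intro sum.cong refl)
      fix K assume "K \<in> D"
      with D obtain a b where "K = cbox a b" by (rule box_familyE)
      then show "measure lborel K = measure lborel (K \<inter> ?L s) + measure lborel (K \<inter> ?R s)"
        using content_split[OF i, of a b s] by simp
    qed
    have posL: "(\<Sum>K\<in>D. measure lborel (K \<inter> ?L s)) > 0"
      using box_family_content_pos[OF D K12(1)] eqK K12 finD by (intro sum_pos2[of _ K1]) auto
    have posR: "(\<Sum>K\<in>D. measure lborel (K \<inter> ?R s)) > 0"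
      using box_family_content_pos[OF D K12(2)] eqK K12 finD by (intro sum_pos2[of _ K2]) auto
    have p: "0 < p" "p < 1" using posL posR split SD by (auto simp: p_def)
    have DL: "(\<Sum>K\<in>D. measure lborel (K \<inter> ?L s)) = p * ?SD" using SD by (simp add: p_def)
    have DR: "(\<Sum>K\<in>D. measure lborel (K \<inter> ?R s)) = (1 - p) * ?SD" using split DL by (simp add: algebra_simps)
    obtain t where EL: "(\<Sum>K\<in>E. measure lborel (K \<inter> ?L t)) = p * ?SE" and ER: "(\<Sum>K\<in>E. measure lborel (K \<inter> ?R t)) = (1 - p) * ?SE"
      using box_family_proportion[OF E i p] .
    have posE: "(\<Sum>K\<in>E. measure lborel (K \<inter> ?L t)) > 0" "(\<Sum>K\<in>E. measure lborel (K \<inter> ?R t)) > 0"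
      using EL ER p SE by simp_all
    note cDL = cut_family[OF D halfspace_cuts_box(1)[OF i] posL]
    note cDR = cut_family[OF D halfspace_cuts_box(2)[OF i] posR]
    note cEL = cut_family[OF E halfspace_cuts_box(1)[OF i] posE(1)]
    note cER = cut_family[OF E halfspace_cuts_box(2)[OF i] posE(2)]
    have meas: "C \<inter> ?L (s + t) \<in> lmeasurable" "C \<inter> ?R (s + t) \<in> lmeasurable"
      using C by (auto intro!: fmeasurable_Int_fmeasurable closed_halfspace_component_le closed_halfspace_component_ge)
    \<comment> \<open>Cutting both families in the same proportion multiplies both volumes by the
      same \<open>q\<close>, hence also the bound. The factors \<open>p\<close> and
      \<open>1 - p\<close> of the two sides then add up to 1.\<close>
    have root_scale: "(root ?n (q * ?SD) + root ?n (q * ?SE)) ^ ?n = q * (root ?n ?SD + root ?n ?SE) ^ ?n" if "q \<ge> 0" for q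
      using that n by (simp add: real_root_mult power_mult_distrib flip: distrib_left)
    have 1: "p * (root ?n ?SD + root ?n ?SE) ^ ?n \<le> measure lebesgue (C \<inter> ?L (s + t))"
    proof -
      have "(root ?n (\<Sum>K\<in>cut_family D (?L s). measure lborel K) + root ?n (\<Sum>K\<in>cut_family E (?L t). measure lborel K)) ^ ?n
          \<le> measure lebesgue (C \<inter> ?L (s + t))"
      proof (rule IH[OF _ cDL(1) cEL(1) meas(1)])
        show "card (cut_family D (?L s)) + card (cut_family E (?L t)) < card D + card E"
          using cDL(4)[OF K12(2) K2L] cEL(3) by (rule add_less_le_mono)
        show "x + y \<in> C \<inter> ?L (s + t)" if "x \<in> \<Union>(cut_family D (?L s))" "y \<in> \<Union>(cut_family E (?L t))" for x y
          using subsetD[OF cDL(5) that(1)] subsetD[OF cEL(5) that(2)] sub by (auto simp: inner_add_left)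
      qed
      then show ?thesis unfolding cDL(2) cEL(2) DL EL using root_scale[of p] p by simp
    qed
    have 2: "(1 - p) * (root ?n ?SD + root ?n ?SE) ^ ?n \<le> measure lebesgue (C \<inter> ?R (s + t))"
    proof -
      have "(root ?n (\<Sum>K\<in>cut_family D (?R s). measure lborel K) + root ?n (\<Sum>K\<in>cut_family E (?R t). measure lborel K)) ^ ?n
          \<le> measure lebesgue (C \<inter> ?R (s + t))"
      proof (rule IH[OF _ cDR(1) cER(1) meas(2)])
        show "card (cut_family D (?R s)) + card (cut_family E (?R t)) < card D + card E"
          using cDR(4)[OF K12(1) K1R] cER(3) by (rule add_less_le_mono)
        show "x + y \<in> C \<inter> ?R (s + t)" if "x \<in> \<Union>(cut_family D (?R s))" "y \<in> \<Union>(cut_family E (?R t))" for x y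
          using subsetD[OF cDR(5) that(1)] subsetD[OF cER(5) that(2)] sub by (auto simp: inner_add_left)
      qed
      then show ?thesis unfolding cDR(2) cER(2) DR ER using root_scale[of "1 - p"] p by simp
    qed
    have "measure lebesgue ((C \<inter> ?L (s + t)) \<union> (C \<inter> ?R (s + t)))
        = measure lebesgue (C \<inter> ?L (s + t)) + measure lebesgue (C \<inter> ?R (s + t))"
    proof -
      have "(C \<inter> ?L (s + t)) \<inter> (C \<inter> ?R (s + t)) \<subseteq> {x. i \<bullet> x = s + t}" by (auto simp: inner_commute)
      moreover have "negligible {x. i \<bullet> x = s + t}" using i by (intro negligible_hyperplane) (auto simp: nonzero_Basis)
      ultimately have "negligible ((C \<inter> ?L (s + t)) \<inter> (C \<inter> ?R (s + t)))" by (rule negligible_subset[rotated])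
      then show ?thesis using measure_Un3[OF meas] by (simp add: negligible_imp_measure0)
    qed
    moreover have "(C \<inter> ?L (s + t)) \<union> (C \<inter> ?R (s + t)) = C" by auto
    ultimately show ?thesis using 1 2 by (simp add: algebra_simps)
  qed
  have fin: "finite D" "finite E" "D \<noteq> {}" "E \<noteq> {}" using less.prems by (auto simp: box_family_def)
  consider (D) K L where "K \<in> D" "L \<in> D" "K \<noteq> L" | (E) K L where "K \<in> E" "L \<in> E" "K \<noteq> L"
    | (single) K L where "D = {K}" "E = {L}"
    using fin by (metis is_singletonI' is_singletonE)
  then show ?case
  proof cases
    case D
    show ?thesis
      by (rule step[OF less.prems D]) (use less.hyps in auto)
  next
    case E
    have "(root ?n (\<Sum>K\<in>E. measure lborel K) + root ?n (\<Sum>K\<in>D. measure lborel K)) ^ ?n \<le> measure lebesgue C"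
    proof (rule step[OF less.prems(2,1,3) _ E])
      show "x + y \<in> C" if "x \<in> \<Union>E" "y \<in> \<Union>D" for x y
        using less.prems(4)[OF that(2,1)] by (simp add: add.commute)
    qed (use less.hyps in \<open>auto simp: add.commute\<close>)
    then show ?thesis by (simp add: add.commute)
  next
    case single
    have "K \<in> D" "L \<in> E" using single by auto
    obtain a b where 1: "K = cbox a b" "box a b \<noteq> {}" using less.prems(1) \<open>K \<in> D\<close> by (rule box_familyE)
    obtain c d where 2: "L = cbox c d" "box c d \<noteq> {}" using less.prems(2) \<open>L \<in> E\<close> by (rule box_familyE)
    note KL = 1(1) 2(1) and ne = 1(2) 2(2)
    have ab: "a \<bullet> i < b \<bullet> i" and cd: "c \<bullet> i < d \<bullet> i" if "i \<in> Basis" for i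
      using ne that by (auto simp: box_ne_empty)
    have "cbox (a + c) (b + d) \<subseteq> C"
      using box_sum_decompose[OF ab cd] less.prems(4) single KL by (metis Union_iff insertI1 subsetI)
    then have "measure lborel (cbox (a + c) (b + d)) \<le> measure lebesgue C"
      using measure_mono_fmeasurable[of "cbox (a + c) (b + d)" C lebesgue] less.prems(3) by simp
    moreover have "measure lborel (cbox (a + c) (b + d)) = (\<Prod>i\<in>Basis. (b \<bullet> i - a \<bullet> i) + (d \<bullet> i - c \<bullet> i))"
    proof -
      have "\<forall>i\<in>Basis. (a + c) \<bullet> i \<le> (b + d) \<bullet> i"
        using add_mono[OF less_imp_le[OF ab] less_imp_le[OF cd]] by (simp add: inner_add_left)
      then show ?thesis by (subst content_cbox) (auto simp: inner_add_left intro!: prod.cong)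
    qed
    moreover have "measure lborel (cbox a b) = (\<Prod>i\<in>Basis. b \<bullet> i - a \<bullet> i)" "measure lborel (cbox c d) = (\<Prod>i\<in>Basis. d \<bullet> i - c \<bullet> i)"
      using ab cd by (intro content_cbox; simp add: less_imp_le)+
    moreover have "root ?n (\<Prod>i\<in>Basis. b \<bullet> i - a \<bullet> i) + root ?n (\<Prod>i\<in>Basis. d \<bullet> i - c \<bullet> i)
        \<le> root ?n (\<Prod>i\<in>Basis. (b \<bullet> i - a \<bullet> i) + (d \<bullet> i - c \<bullet> i))"
      using ab cd by (intro root_prod_add_le) auto
    ultimately have le: "root ?n (measure lborel (cbox a b)) + root ?n (measure lborel (cbox c d)) \<le> root ?n (measure lebesgue C)"
      using n by (metis (no_types, lifting) order_trans real_root_le_iff)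
    have "(root ?n (measure lborel (cbox a b)) + root ?n (measure lborel (cbox c d))) ^ ?n \<le> root ?n (measure lebesgue C) ^ ?n"
      using le by (intro power_mono) auto
    then show ?thesis using single KL by simp
  qed
qed

text \<open>A bounded open set is a countable union of nonoverlapping boxes, and finitely many of
  them carry more than \<open>m\<close> by continuity from below. The gauge keeps every box inside
  \<open>A\<close>.\<close>

lemma open_box_family_approx:
  fixes A :: "'a::euclidean_space set"
  assumes A: "open A" "bounded A" and m: "0 \<le> m" "m < measure lebesgue A"
  obtains D where "box_family D" "\<Union>D \<subseteq> A" "m < (\<Sum>K\<in>D. measure lborel K)"
proof -
  obtain a where a: "A \<subseteq> cbox (- a) a"
    using bounded_subset_cbox_symmetric[OF A(2)] by blast
  have box: "box (- a) a \<noteq> {}"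
  proof
    assume "box (- a) a = {}"
    then have "measure lborel (cbox (- a) a) = 0" using content_eq_0_interior[of "- a" a] by simp
    moreover have "measure lebesgue A \<le> measure lebesgue (cbox (- a) a)"
      using a A by (intro measure_mono_fmeasurable) auto
    ultimately show False using m by simp
  qed
  have "\<forall>x. \<exists>e>0. x \<in> A \<longrightarrow> ball x e \<subseteq> A"
    using A(1) by (metis open_contains_ball zero_less_one)
  then obtain e where e: "\<And>x. e x > 0" "\<And>x. x \<in> A \<Longrightarrow> ball x (e x) \<subseteq> A" by metis
  have gauge: "gauge (\<lambda>x. ball x (e x))" using e by (intro gauge_ball_dependent) auto
  obtain \<D> where \<D>: "countable \<D>" "\<And>K. K \<in> \<D> \<Longrightarrow> interior K \<noteq> {} \<and> (\<exists>c d. K = cbox c d)"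
      "pairwise (\<lambda>K L. interior K \<inter> interior L = {}) \<D>"
      "\<And>K. K \<in> \<D> \<Longrightarrow> \<exists>x\<in>A \<inter> K. K \<subseteq> ball x (e x)" "A \<subseteq> \<Union>\<D>"
    using covering_lemma[OF a box gauge] by metis
  have sub: "K \<subseteq> A" if "K \<in> \<D>" for K using \<D>(4)[OF that] e(2) by blast
  have ne: "\<D> \<noteq> {}" using \<D>(5) m by auto
  define f where "f = from_nat_into \<D>"
  have range: "range f = \<D>" unfolding f_def using ne \<D>(1) by (rule range_from_nat_into)
  have fm: "f i \<in> sets lebesgue" for i
  proof -
    have "f i \<in> \<D>" using range by blast
    then obtain c d where "f i = cbox c d" using \<D>(2) by blast
    then show ?thesis by simp
  qed
  have UA: "(\<Union>i. \<Union>k\<le>i. f k) = A"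
  proof -
    have "(\<Union>i. \<Union>k\<le>i. f k) = \<Union>(range f)" by auto
    then show ?thesis using sub \<D>(5) range by auto
  qed
  have "(\<lambda>i. measure lebesgue (\<Union>k\<le>i. f k)) \<longlonglongrightarrow> measure lebesgue (\<Union>i. \<Union>k\<le>i. f k)"
  proof (rule Lim_measure_incseq)
    show "range (\<lambda>i. \<Union>k\<le>i. f k) \<subseteq> sets lebesgue" using fm by auto
    show "incseq (\<lambda>i. \<Union>k\<le>i. f k)" by (fastforce simp: incseq_def)
    show "emeasure lebesgue (\<Union>i. \<Union>k\<le>i. f k) \<noteq> \<infinity>"
      unfolding UA using lmeasurable_open[OF A(2,1)] by (auto simp: fmeasurable_def)
  qed
  then have "\<forall>\<^sub>F i in sequentially. m < measure lebesgue (\<Union>k\<le>i. f k)"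
    unfolding UA using m(2) by (rule order_tendstoD)
  then obtain i where i: "m < measure lebesgue (\<Union>k\<le>i. f k)"
    using eventually_happens'[OF sequentially_bot] by blast
  define D where "D = f ` {..i}"
  have D: "D \<subseteq> \<D>" unfolding D_def using range by auto
  show ?thesis
  proof (rule that[of D])
    show "box_family D"
      unfolding box_family_def
    proof (intro conjI)
      show "\<forall>K\<in>D. interior K \<noteq> {} \<and> (\<exists>a b. K = cbox a b)" using D \<D>(2) by blast
      show "pairwise (\<lambda>K L. interior K \<inter> interior L = {}) D" by (rule pairwise_subset[OF \<D>(3) D])
    qed (auto simp: D_def)
    show "\<Union>D \<subseteq> A" using D sub by blast
    have "measure lebesgue (\<Union>k\<le>i. f k) \<le> (\<Sum>K\<in>D. measure lebesgue K)"
      using fm measure_Union_le[of D lebesgue] by (auto simp: D_def)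
    also have "\<dots> = (\<Sum>K\<in>D. measure lborel K)"
    proof (intro sum.cong refl)
      fix K assume "K \<in> D"
      then obtain c d where "K = cbox c d" using D \<D>(2) by blast
      then show "measure lebesgue K = measure lborel K" by simp
    qed
    finally show "m < (\<Sum>K\<in>D. measure lborel K)" using i by simp
  qed
qed

text \<open>Anything positive below the root of a volume is reached by a box family inside the set.
  Open nonempty sets have positive volume, so it suffices to test positive \<open>x\<close> and
  \<open>y\<close>.\<close>

theorem brunn_minkowski_open:
  fixes A B :: "'a::euclidean_space set"
  assumes A: "open A" "bounded A" "A \<noteq> {}" and B: "open B" "bounded B" "B \<noteq> {}" and C: "C \<in> lmeasurable"
    and sub: "\<And>x y. x \<in> A \<Longrightarrow> y \<in> B \<Longrightarrow> x + y \<in> C"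
  shows "root DIM('a) (measure lebesgue A) + root DIM('a) (measure lebesgue B) \<le> root DIM('a) (measure lebesgue C)"
proof -
  let ?n = "DIM('a)"
  have pos: "root ?n (measure lebesgue S) > 0" if "open S" "bounded S" "S \<noteq> {}" for S :: "'a set"
  proof -
    have "\<not> negligible S" using that open_not_negligible by blast
    then show ?thesis using lmeasurable_open[OF that(2,1)]
      by (simp add: negligible_iff_measure0 zero_less_measure_iff)
  qed
  have approx: "\<exists>D. box_family D \<and> \<Union>D \<subseteq> S \<and> x \<le> root ?n (\<Sum>K\<in>D. measure lborel K)"
    if S: "open S" "bounded S" and x: "0 < x" "x < root ?n (measure lebesgue S)" for S :: "'a set" and x
  proof -
    have "x ^ ?n < root ?n (measure lebesgue S) ^ ?n" using x by (intro power_strict_mono) auto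
    then obtain D where D: "box_family D" "\<Union>D \<subseteq> S" "x ^ ?n < (\<Sum>K\<in>D. measure lborel K)"
      using open_box_family_approx[OF S, of "x ^ ?n"] x by auto
    then have "root ?n (x ^ ?n) \<le> root ?n (\<Sum>K\<in>D. measure lborel K)" by simp
    then show ?thesis using D x by (auto simp: real_root_power_cancel)
  qed
  have le: "x + y \<le> root ?n (measure lebesgue C)"
    if x: "0 < x" "x < root ?n (measure lebesgue A)" and y: "0 < y" "y < root ?n (measure lebesgue B)" for x y
  proof -
    obtain D where D: "box_family D" "\<Union>D \<subseteq> A" "x \<le> root ?n (\<Sum>K\<in>D. measure lborel K)" using approx[OF A(1,2) x] by blast
    obtain E where E: "box_family E" "\<Union>E \<subseteq> B" "y \<le> root ?n (\<Sum>K\<in>E. measure lborel K)" using approx[OF B(1,2) y] by blast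
    have "(x + y) ^ ?n \<le> (root ?n (\<Sum>K\<in>D. measure lborel K) + root ?n (\<Sum>K\<in>E. measure lborel K)) ^ ?n"
      using x y D(3) E(3) by (intro power_mono add_mono) auto
    also have "\<dots> \<le> measure lebesgue C"
      using D E sub by (intro brunn_minkowski_boxes C) blast+
    finally have "root ?n ((x + y) ^ ?n) \<le> root ?n (measure lebesgue C)" by simp
    then show ?thesis using x y by (simp add: real_root_power_cancel)
  qed
  have "root ?n (measure lebesgue A) \<le> root ?n (measure lebesgue C) - root ?n (measure lebesgue B)"
  proof (rule dense_le_bounded[OF pos[OF A]])
    fix x assume x: "0 < x" "x < root ?n (measure lebesgue A)"
    have "root ?n (measure lebesgue B) \<le> root ?n (measure lebesgue C) - x"
    proof (rule dense_le_bounded[OF pos[OF B]])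
      fix y assume "0 < y" "y < root ?n (measure lebesgue B)"
      then show "y \<le> root ?n (measure lebesgue C) - x" using le[OF x, of y] by linarith
    qed
    then show "x \<le> root ?n (measure lebesgue C) - root ?n (measure lebesgue B)" by linarith
  qed
  then show ?thesis by linarith
qed

subsection \<open>Parallel bodies\<close>

lemma separating_unit_normal:
  fixes K :: "'a::euclidean_space set"
  assumes K: "convex K" "closed K" "K \<noteq> {}" and z: "z \<notin> K"
  obtains u b where "norm u = 1" "\<And>y. y \<in> K \<Longrightarrow> u \<bullet> y \<le> b" "b < u \<bullet> z"
proof -
  obtain a c where ac: "a \<bullet> z < c" "\<forall>y\<in>K. a \<bullet> y > c"
    using separating_hyperplane_closed_point[OF K(1,2) z] by blast
  have "a \<noteq> 0" using ac K(3) by auto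
  then have a: "norm a > 0" by simp
  show thesis
  proof (rule that[of "- (a /\<^sub>R norm a)" "- (c / norm a)"])
    fix y assume "y \<in> K"
    then show "- (a /\<^sub>R norm a) \<bullet> y \<le> - (c / norm a)"
      using ac(2) a by (simp add: field_simps less_imp_le)
  qed (use ac(1) a in \<open>auto simp: field_simps\<close>)
qed

text \<open>One formula for both signs of \<open>t\<close>. Quantifying over all upper bounds
  \<open>b\<close> avoids the support function, and the smallest bound in each direction is the
  decisive one.\<close>

definition offset_body :: "'a::euclidean_space set \<Rightarrow> real \<Rightarrow> 'a set" where
  "offset_body K t = {x. \<forall>u b. norm u = 1 \<longrightarrow> (\<forall>y\<in>K. u \<bullet> y \<le> b) \<longrightarrow> u \<bullet> x \<le> b + t}"

text \<open>Both cases separate a missing point from a closed convex set: from \<open>K\<close> for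
  inner bodies and from the Minkowski sum for outer ones. In the second case a bound
  \<open>b\<close> for the sum yields \<open>b - t\<close> for \<open>K\<close>, because the sum
  contains \<open>y + t *\<^sub>R u\<close> for every \<open>y\<close> in \<open>K\<close>.\<close>

lemma parallel_body_eq_offset_body:
  fixes K :: "'a::euclidean_space set"
  assumes K: "convex_body K"
  shows "parallel_body K (cball 0 1) t = offset_body K t"
proof (cases "t \<le> 0")
  case True
  have K': "convex K" "closed K" "K \<noteq> {}" using K by (auto simp: convex_body_def compact_imp_closed)
  have "(\<lambda>b. x + \<bar>t\<bar> *\<^sub>R b) ` cball 0 1 \<subseteq> K \<longleftrightarrow> x \<in> offset_body K t" for x
  proof
    assume sub: "(\<lambda>b. x + \<bar>t\<bar> *\<^sub>R b) ` cball 0 1 \<subseteq> K"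
    show "x \<in> offset_body K t"
      unfolding offset_body_def
    proof (clarify)
      fix u b assume u: "norm u = 1" and b: "\<forall>y\<in>K. u \<bullet> y \<le> b"
      have "x + \<bar>t\<bar> *\<^sub>R u \<in> K" using sub u by (auto simp: image_subset_iff)
      then have "u \<bullet> (x + \<bar>t\<bar> *\<^sub>R u) \<le> b" using b by blast
      then show "u \<bullet> x \<le> b + t" using u True by (simp add: inner_add_right inner_diff_right dot_square_norm)
    qed
  next
    assume x: "x \<in> offset_body K t"
    show "(\<lambda>b. x + \<bar>t\<bar> *\<^sub>R b) ` cball 0 1 \<subseteq> K"
    proof (rule image_subsetI, rule ccontr)
      fix v :: 'a assume v: "v \<in> cball 0 1" and "x + \<bar>t\<bar> *\<^sub>R v \<notin> K"
      then obtain u b where u: "norm u = 1" and b: "\<And>y. y \<in> K \<Longrightarrow> u \<bullet> y \<le> b" and "b < u \<bullet> (x + \<bar>t\<bar> *\<^sub>R v)"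
        using separating_unit_normal[OF K'] by metis
      moreover have "u \<bullet> x \<le> b + t" using x u b by (auto simp: offset_body_def)
      moreover have "u \<bullet> v \<le> 1" using norm_cauchy_schwarz[of u v] u v by simp
      then have "\<bar>t\<bar> * (u \<bullet> v) \<le> \<bar>t\<bar>" by (simp add: mult_left_le)
      ultimately show False using True by (simp add: inner_add_right inner_diff_right)
    qed
  qed
  then show ?thesis using True by (simp add: parallel_body_def)
next
  case False
  define S where "S = {x + t *\<^sub>R b | x b. x \<in> K \<and> b \<in> cball (0::'a) 1}"
  have S: "S = (\<Union>x\<in>K. \<Union>y\<in>(*\<^sub>R) t ` cball 0 1. {x + y})"
    unfolding S_def by blast
  have convS: "convex S"
    unfolding S using K by (intro convex_sums convex_scaling convex_cball) (auto simp: convex_body_def)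
  have "compact S"
    unfolding S using K by (intro compact_sums' compact_scaling compact_cball) (auto simp: convex_body_def)
  then have closedS: "closed S" by (rule compact_imp_closed)
  have SI: "y + t *\<^sub>R v \<in> S" if "y \<in> K" "norm v \<le> 1" for y v
    unfolding S_def using that by (intro CollectI exI[of _ y] exI[of _ v]) auto
  obtain k where "k \<in> K" using K by (auto simp: convex_body_def)
  from SI[OF this, of 0] have "S \<noteq> {}" by auto
  have "S = offset_body K t"
  proof (intro set_eqI iffI)
    fix z assume "z \<in> S"
    then obtain x v where x: "z = x + t *\<^sub>R v" "x \<in> K" "norm v \<le> 1" by (auto simp: S_def)
    show "z \<in> offset_body K t"
      unfolding offset_body_def
    proof (clarify)
      fix u b assume u: "norm u = 1" and b: "\<forall>y\<in>K. u \<bullet> y \<le> b"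
      have "u \<bullet> v \<le> 1" using norm_cauchy_schwarz[of u v] u x(3) by simp
      then have "t * (u \<bullet> v) \<le> t" using False by (simp add: mult_left_le)
      moreover have "u \<bullet> x \<le> b" using b x(2) by blast
      ultimately show "u \<bullet> z \<le> b + t" by (simp add: x(1) inner_add_right)
    qed
  next
    fix z assume z: "z \<in> offset_body K t"
    show "z \<in> S"
    proof (rule ccontr)
      assume "z \<notin> S"
      then obtain u b where u: "norm u = 1" and b: "\<And>y. y \<in> S \<Longrightarrow> u \<bullet> y \<le> b" and "b < u \<bullet> z"
        using separating_unit_normal[OF convS closedS \<open>S \<noteq> {}\<close>] by metis
      have "u \<bullet> y \<le> b - t" if "y \<in> K" for y
      proof -
        have "y + t *\<^sub>R u \<in> S" using that u by (intro SI) auto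
        from b[OF this] show ?thesis using u by (simp add: inner_add_right dot_square_norm)
      qed
      then have "u \<bullet> z \<le> (b - t) + t" using z u unfolding offset_body_def by blast
      then show False using \<open>b < u \<bullet> z\<close> by simp
    qed
  qed
  then show ?thesis using False by (simp add: parallel_body_def S_def)
qed

lemma offset_bodyD: "x \<in> offset_body K t \<Longrightarrow> norm u = 1 \<Longrightarrow> (\<And>y. y \<in> K \<Longrightarrow> u \<bullet> y \<le> b) \<Longrightarrow> u \<bullet> x \<le> b + t"
  by (auto simp: offset_body_def)

lemma offset_bodyI: "(\<And>u b. norm u = 1 \<Longrightarrow> (\<And>y. y \<in> K \<Longrightarrow> u \<bullet> y \<le> b) \<Longrightarrow> u \<bullet> x \<le> b + t) \<Longrightarrow> x \<in> offset_body K t"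
  by (auto simp: offset_body_def)

lemma offset_body_eq_Inter:
  "offset_body K t = (\<Inter>(u, b)\<in>{(u, b). norm u = 1 \<and> (\<forall>y\<in>K. u \<bullet> y \<le> b)}. {x. u \<bullet> x \<le> b + t})"
  by (auto simp: offset_body_def)

lemma convex_offset_body: "convex (offset_body K t)"
  unfolding offset_body_eq_Inter by (intro convex_INT) (auto simp: convex_halfspace_le)

lemma closed_offset_body: "closed (offset_body K t)"
  unfolding offset_body_eq_Inter by (intro closed_INT ballI) (auto simp: closed_halfspace_le)

lemma compact_offset_body:
  assumes "bounded K"
  shows "compact (offset_body K t)"
proof -
  obtain R where R: "\<And>y. y \<in> K \<Longrightarrow> norm y \<le> R" using assms by (auto simp: bounded_iff)
  have "norm x \<le> max 0 (R + t)" if x: "x \<in> offset_body K t" for x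
  proof (cases "x = 0")
    case False
    have "(x /\<^sub>R norm x) \<bullet> x \<le> R + t"
    proof (rule offset_bodyD[OF x])
      fix y assume "y \<in> K"
      have "(x /\<^sub>R norm x) \<bullet> y \<le> norm (x /\<^sub>R norm x) * norm y" by (rule norm_cauchy_schwarz)
      also have "\<dots> = norm y" using False by simp
      also have "\<dots> \<le> R" using R[OF \<open>y \<in> K\<close>] .
      finally show "(x /\<^sub>R norm x) \<bullet> y \<le> R" .
    qed (use False in simp)
    moreover have "(x /\<^sub>R norm x) \<bullet> x = norm x"
      using False by (simp add: dot_square_norm power2_eq_square)
    ultimately show ?thesis by simp
  qed simp
  then have "bounded (offset_body K t)" unfolding bounded_iff by blast
  then show ?thesis using closed_offset_body by (simp add: compact_eq_bounded_closed)
qed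

text \<open>The defining inequalities are affine in the point and the parameter jointly.\<close>

lemma offset_body_combine:
  assumes x: "x \<in> offset_body K s" and y: "y \<in> offset_body K t" and p: "0 \<le> p" "0 \<le> q" "p + q = 1"
  shows "p *\<^sub>R x + q *\<^sub>R y \<in> offset_body K (p * s + q * t)"
proof (rule offset_bodyI)
  fix u b assume ub: "norm u = 1" "\<And>y. y \<in> K \<Longrightarrow> u \<bullet> y \<le> b"
  have "p * (u \<bullet> x) + q * (u \<bullet> y) \<le> p * (b + s) + q * (b + t)"
    using offset_bodyD[OF x ub] offset_bodyD[OF y ub] p by (intro add_mono mult_left_mono) auto
  also have "\<dots> = (p + q) * b + (p * s + q * t)" by (simp add: algebra_simps)
  finally show "u \<bullet> (p *\<^sub>R x + q *\<^sub>R y) \<le> b + (p * s + q * t)"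
    using p(3) by (simp add: inner_add_right)
qed

text \<open>This fact and the next one supply the inclusions that \<open>body_outer\<close> and
  \<open>body_inner\<close> demand of \<open>Z\<close>.\<close>

lemma cball_subset_offset_body:
  assumes x: "x \<in> offset_body K t"
  shows "cball x h \<subseteq> offset_body K (t + h)"
proof
  fix y assume y: "y \<in> cball x h"
  show "y \<in> offset_body K (t + h)"
  proof (rule offset_bodyI)
    fix u b assume ub: "norm u = 1" "\<And>y. y \<in> K \<Longrightarrow> u \<bullet> y \<le> b"
    have "u \<bullet> (y - x) \<le> h"
      using norm_cauchy_schwarz[of u "y - x"] ub(1) y by (simp add: dist_norm norm_minus_commute)
    then show "u \<bullet> y \<le> b + (t + h)"
      using offset_bodyD[OF x ub] by (simp add: inner_diff_right)
  qed
qed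

lemma offset_body_if_cball_subset:
  assumes h: "h \<ge> 0" and x: "cball x h \<subseteq> offset_body K t"
  shows "x \<in> offset_body K (t - h)"
proof (rule offset_bodyI)
  fix u b assume ub: "norm u = 1" "\<And>y. y \<in> K \<Longrightarrow> u \<bullet> y \<le> b"
  have "x + h *\<^sub>R u \<in> cball x h" using ub(1) h by (simp add: dist_norm)
  then have "x + h *\<^sub>R u \<in> offset_body K t" using x by blast
  then have "u \<bullet> (x + h *\<^sub>R u) \<le> b + t" by (rule offset_bodyD[OF _ ub])
  then show "u \<bullet> x \<le> b + (t - h)" using ub(1) by (simp add: inner_add_right dot_square_norm)
qed

text \<open>Some radius \<open>r > - t\<close> is attained by a ball in \<open>K\<close>. Its centre
  lies in the body with parameter \<open>- r\<close>, and raising the parameter to \<open>t\<close>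
  leaves room for a ball of radius \<open>t + r\<close>.\<close>

lemma interior_offset_body:
  fixes K :: "'a::euclidean_space set"
  assumes K: "convex_body K" and t: "- inradius K (cball 0 1) < t"
  shows "interior (offset_body K t) \<noteq> {}"
proof -
  let ?R = "{r. r \<ge> 0 \<and> (\<exists>x. (\<lambda>b. x + r *\<^sub>R b) ` cball 0 1 \<subseteq> K)}"
  obtain x where "x \<in> K" using K by (auto simp: convex_body_def)
  then have "0 \<in> ?R" by auto
  then have "?R \<noteq> {}" by blast
  have "- t < Sup ?R" using t by (simp add: inradius_def)
  then obtain r where "r \<in> ?R" "- t < r" using \<open>?R \<noteq> {}\<close> by (rule less_cSupE)
  then obtain x where r: "r \<ge> 0" "(\<lambda>b. x + r *\<^sub>R b) ` cball 0 1 \<subseteq> K" "- t < r" by auto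
  then have "x \<in> parallel_body K (cball 0 1) (- r)" by (simp add: parallel_body_def)
  then have "x \<in> offset_body K (- r)" by (simp add: parallel_body_eq_offset_body[OF K])
  then have "cball x (t + r) \<subseteq> offset_body K t"
    using cball_subset_offset_body[of x K "- r" "t + r"] by simp
  moreover have "t + r > 0" using r(3) by simp
  ultimately have "x \<in> interior (offset_body K t)" by (meson mem_interior_cball)
  then show ?thesis by blast
qed

section \<open>Concavity of the root of the volume\<close>

lemma measure_interior_convex:
  fixes S :: "'a::euclidean_space set"
  assumes "convex S" "bounded S"
  shows "measure lebesgue (interior S) = measure lebesgue S"
proof (rule measure_negligible_symdiff)
  have "S - interior S \<union> (interior S - S) \<subseteq> frontier S"
    using interior_subset closure_subset by (auto simp: frontier_def)
  then show "negligible (S - interior S \<union> (interior S - S))"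
    using negligible_convex_frontier[OF assms(1)] negligible_subset by blast
qed (rule measurable_convex[OF assms])

lemma root_measure_scaleR:
  fixes S :: "'a::euclidean_space set"
  assumes "c \<ge> 0"
  shows "root DIM('a) (measure lebesgue ((*\<^sub>R) c ` S)) = c * root DIM('a) (measure lebesgue S)"
proof -
  have "measure lebesgue ((*\<^sub>R) c ` S) = c ^ DIM('a) * measure lebesgue S"
    using assms emeasure_scaleR_image[of c S] by (simp add: measure_def enn2real_mult)
  then show ?thesis using assms by (simp add: real_root_mult real_root_power_cancel)
qed

text \<open>Brunn-Minkowski is applied to the scaled interiors, which are open and have the volumes
  of the scaled bodies. Their sum lies in the intermediate body by
  \<open>offset_body_combine\<close>.\<close>

lemma root_volume_concave:
  fixes K :: "'a::euclidean_space set"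
  assumes K: "convex_body K"
  defines "f \<equiv> \<lambda>t. root DIM('a) (measure lebesgue (offset_body K t))"
  shows "convex_on {- inradius K (cball 0 1)<..} (\<lambda>t. - f t)"
proof (rule convex_onI)
  fix p s t :: real
  assume p: "0 < p" "p < 1" and s: "s \<in> {- inradius K (cball 0 1)<..}" and t: "t \<in> {- inradius K (cball 0 1)<..}"
  have bK: "bounded K" using K by (auto simp: convex_body_def compact_imp_bounded)
  have f: "f t = root DIM('a) (measure lebesgue (interior (offset_body K t)))" for t
    using measure_interior_convex[OF convex_offset_body compact_imp_bounded[OF compact_offset_body[OF bK]]]
    by (simp only: f_def)
  let ?m = "(1 - p) * s + p * t"
  let ?A = "(*\<^sub>R) (1 - p) ` interior (offset_body K s)" and ?B = "(*\<^sub>R) p ` interior (offset_body K t)"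
  have bd: "bounded (interior (offset_body K r))" for r
    using compact_offset_body[OF bK] by (simp add: compact_imp_bounded bounded_interior)
  have "root DIM('a) (measure lebesgue ?A) + root DIM('a) (measure lebesgue ?B)
      \<le> root DIM('a) (measure lebesgue (offset_body K ?m))"
  proof (rule brunn_minkowski_open)
    show "open ?A" "open ?B" using p by (simp_all add: open_scaling)
    show "bounded ?A" "bounded ?B" using bd by (simp_all add: bounded_scaling)
    show "?A \<noteq> {}" "?B \<noteq> {}" using interior_offset_body[OF K] s t by auto
    show "offset_body K ?m \<in> lmeasurable" by (rule lmeasurable_compact[OF compact_offset_body[OF bK]])
    fix x y assume "x \<in> ?A" "y \<in> ?B"
    then obtain x' y' where "x = (1 - p) *\<^sub>R x'" "y = p *\<^sub>R y'" "x' \<in> offset_body K s" "y' \<in> offset_body K t"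
      using interior_subset by fast
    then show "x + y \<in> offset_body K ?m" using offset_body_combine[of x' K s y' t "1 - p" p] p by simp
  qed
  then have "(1 - p) * f s + p * f t \<le> f ?m"
    using p unfolding f[of s] f[of t] by (simp add: root_measure_scaleR f_def)
  then show "- f ((1 - p) *\<^sub>R s + p *\<^sub>R t) \<le> (1 - p) * - f s + p * - f t" by simp
qed (rule convex_real_interval)

text \<open>Both \<open>s\<close> and \<open>t\<close> are convex combinations of the outer points,
  with weights interchanged, so the two convexity inequalities add up. For \<open>g = - f\<close>
  this compares the increments of \<open>f\<close> after \<open>t\<close> and before
  \<open>s\<close>.\<close>

lemma convex_on_outer_sum:
  fixes g :: "real \<Rightarrow> real"
  assumes g: "convex_on S g" and S: "s - h \<in> S" "t + h \<in> S" and st: "s \<le> t" and h: "h > 0"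
  shows "g s + g t \<le> g (s - h) + g (t + h)"
proof -
  define D where "D = t - s + 2 * h"
  have D: "D > 0" using st h by (simp add: D_def)
  define p where "p = h / D"
  have p: "0 \<le> p" "p \<le> 1" using h D st by (auto simp: p_def D_def)
  have pD: "p * D = h" using D by (simp add: p_def)
  have eq: "(1 - p) * (s - h) + p * (t + h) = s" "p * (s - h) + (1 - p) * (t + h) = t"
    using pD by (simp_all add: D_def algebra_simps)
  have "g ((1 - p) *\<^sub>R (s - h) + p *\<^sub>R (t + h)) \<le> (1 - p) * g (s - h) + p * g (t + h)"
    by (rule convex_onD[OF g]) (use p S in auto)
  moreover have "g ((1 - (1 - p)) *\<^sub>R (s - h) + (1 - p) *\<^sub>R (t + h)) \<le> (1 - (1 - p)) * g (s - h) + (1 - p) * g (t + h)"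
    by (rule convex_onD[OF g]) (use p S in auto)
  ultimately have "g s \<le> (1 - p) * g (s - h) + p * g (t + h)" "g t \<le> p * g (s - h) + (1 - p) * g (t + h)"
    using eq by simp_all
  then show ?thesis by (simp add: algebra_simps)
qed

text \<open>The mean value bounds for the \<open>n\<close>-th power; they stand in for
  differentiating the volume as a power of \<open>f\<close>.\<close>

lemma power_diff_le:
  fixes x y :: real
  assumes "0 \<le> y" "y \<le> x"
  shows "x ^ n - y ^ n \<le> real n * x ^ (n - 1) * (x - y)"
    and "real n * y ^ (n - 1) * (x - y) \<le> x ^ n - y ^ n"
proof -
  have eq: "x ^ n - y ^ n = (x - y) * (\<Sum>i<n. y ^ (n - Suc i) * x ^ i)"
    by (rule power_diff_sumr2)
  have "y ^ (n - Suc i) * x ^ i \<le> x ^ (n - 1)" if "i < n" for i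
  proof -
    have "y ^ (n - Suc i) * x ^ i \<le> x ^ (n - Suc i) * x ^ i"
      using assms by (intro mult_right_mono power_mono) auto
    then show ?thesis using that by (simp flip: power_add)
  qed
  then have "(\<Sum>i<n. y ^ (n - Suc i) * x ^ i) \<le> of_nat (card {..<n}) * x ^ (n - 1)"
    by (intro sum_bounded_above) auto
  then show "x ^ n - y ^ n \<le> real n * x ^ (n - 1) * (x - y)"
    unfolding eq using assms mult_right_mono[of _ _ "x - y"] by (fastforce simp: mult.commute)
  have "y ^ (n - 1) \<le> y ^ (n - Suc i) * x ^ i" if "i < n" for i
  proof -
    have "y ^ (n - Suc i) * y ^ i \<le> y ^ (n - Suc i) * x ^ i"
      using assms by (intro mult_left_mono power_mono) auto
    then show ?thesis using that by (simp flip: power_add)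
  qed
  then have "of_nat (card {..<n}) * y ^ (n - 1) \<le> (\<Sum>i<n. y ^ (n - Suc i) * x ^ i)"
    by (intro sum_bounded_below) auto
  then show "real n * y ^ (n - 1) * (x - y) \<le> x ^ n - y ^ n"
    unfolding eq using assms mult_right_mono[of _ _ "x - y"] by (fastforce simp: mult.commute)
qed

text \<open>\<open>a\<close> and \<open>b\<close> are the surface areas at \<open>t\<close> and
  \<open>s\<close>, and \<open>m\<close> is the cylinder volume for the common height
  \<open>h\<close>.\<close>

lemma surface_quotient_step:
  fixes f :: "real \<Rightarrow> real"
  assumes n: "n > 0" and \<kappa>: "\<kappa> \<ge> 0" and m: "m > 0"
    and f: "0 \<le> f (s - h)" "f (s - h) \<le> f s" "0 \<le> f t" "f t \<le> f (t + h)"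
    and conc: "f (t + h) - f t \<le> f s - f (s - h)"
    and outer: "\<kappa> * f t ^ n + a * m \<le> \<kappa> * f (t + h) ^ n"
    and inner: "\<kappa> * f s ^ n \<le> \<kappa> * f (s - h) ^ n + b * m"
  shows "a * f (s - h) ^ (n - 1) \<le> b * f (t + h) ^ (n - 1)"
proof -
  \<comment> \<open>The increment of \<open>f\<close> before \<open>s\<close> bounds
    \<open>a\<close> from above and \<open>b\<close> from below. Multiplying the two bounds
    crosswise, instead of dividing by \<open>c\<close>, covers the case
    \<open>c = 0\<close>.\<close>
  define c where "c = \<kappa> * n * (f s - f (s - h))"
  have "a * m \<le> \<kappa> * (f (t + h) ^ n - f t ^ n)" using outer by (simp add: algebra_simps)
  also have "\<dots> \<le> \<kappa> * (n * f (t + h) ^ (n - 1) * (f (t + h) - f t))"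
    using f \<kappa> by (intro mult_left_mono power_diff_le) auto
  also have "\<dots> \<le> \<kappa> * (n * f (t + h) ^ (n - 1) * (f s - f (s - h)))"
    using f \<kappa> conc by (intro mult_left_mono mult_nonneg_nonneg) auto
  finally have A: "a * m \<le> c * f (t + h) ^ (n - 1)" by (simp add: c_def ac_simps)
  have "\<kappa> * (n * f (s - h) ^ (n - 1) * (f s - f (s - h))) \<le> \<kappa> * (f s ^ n - f (s - h) ^ n)"
    using f \<kappa> by (intro mult_left_mono power_diff_le) auto
  also have "\<dots> \<le> b * m" using inner by (simp add: algebra_simps)
  finally have B: "c * f (s - h) ^ (n - 1) \<le> b * m" by (simp add: c_def ac_simps)
  have "(a * m) * f (s - h) ^ (n - 1) \<le> (c * f (t + h) ^ (n - 1)) * f (s - h) ^ (n - 1)"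
    using A f by (intro mult_right_mono) auto
  also have "\<dots> = (c * f (s - h) ^ (n - 1)) * f (t + h) ^ (n - 1)" by (simp add: ac_simps)
  also have "\<dots> \<le> (b * m) * f (t + h) ^ (n - 1)"
    using B f by (intro mult_right_mono) auto
  finally have "m * (a * f (s - h) ^ (n - 1)) \<le> m * (b * f (t + h) ^ (n - 1))" by (simp add: ac_simps)
  then show ?thesis using m by simp
qed

theorem theorem1p1:
  fixes K :: "(real ^ 'n) set"
  assumes "convex_body K"
    and "interior K \<noteq> {}"
  shows "antimono_on {- inradius K (cball 0 1)<..}
           (\<lambda>t. isoperimetric_quotient (parallel_body K (cball 0 1) t))"
proof (rule monotone_onI)
  fix s t assume s: "s \<in> {- inradius K (cball 0 1)<..}" and t: "t \<in> {- inradius K (cball 0 1)<..}" and st: "s \<le> t"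
  note K = assms(1)
  have bK: "bounded K" using K by (auto simp: convex_body_def compact_imp_bounded)
  let ?J = "{- inradius K (cball 0 1)<..}"
  define n where "n = CARD('n)"
  have n: "n > 0" by (simp add: n_def)
  let ?L = "offset_body K"
  define V where "V t = measure lebesgue (?L t)" for t
  define f where "f t = root n (V t)" for t
  let ?H = "\<lambda>t. hausdorff_measure (n - 1) (frontier (?L t))"
  have meas: "?L t \<in> lmeasurable" for t by (rule lmeasurable_compact[OF compact_offset_body[OF bK]])
  have eV: "emeasure lebesgue (?L t) = ennreal (V t)" for t
    unfolding V_def using meas by (intro emeasure_eq_measure2)
  have V0: "V t \<ge> 0" for t by (simp add: V_def)
  have fV: "f t ^ n = V t" for t using n V0 by (simp add: f_def)
  have f0: "f t \<ge> 0" for t unfolding f_def by (rule real_root_pos_pos_le[OF V0])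
  have Vpos: "V t > 0" if "t \<in> ?J" for t
  proof -
    have "interior (?L t) \<noteq> {}" using interior_offset_body[OF K] that by simp
    then have "\<not> negligible (?L t)"
      by (meson interior_subset negligible_subset open_interior open_not_negligible)
    then show ?thesis using meas[of t] unfolding V_def
      by (simp add: negligible_iff_measure0 zero_less_measure_iff)
  qed
  have Lmono: "?L s \<subseteq> ?L t" if "s \<le> t" for s t
    using that by (force simp: offset_body_def)
  have fmono: "f s \<le> f t" if "s \<le> t" for s t
    unfolding f_def V_def using n measure_mono_fmeasurable[OF Lmono[OF that] _ meas] meas by auto
  have conv: "convex_on ?J (\<lambda>t. - f t)"
    using root_volume_concave[OF K] by (simp add: f_def V_def n_def)
  have quot: "isoperimetric_quotient (parallel_body K (cball 0 1) t) = ?H t ^ n / ennreal (V t) ^ (n - 1)" for t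
    by (simp add: isoperimetric_quotient_def surface_area_def parallel_body_eq_offset_body[OF K] n_def eV)
  have int: "interior (?L t) \<noteq> {}" if "t \<in> ?J" for t using interior_offset_body[OF K] that by simp
  have cvx: "convex (?L t)" "compact (?L t)" for t by (rule convex_offset_body compact_offset_body[OF bK])+
  have Z: "?L t \<in> sets lebesgue" for t using meas by blast
  have "?H t ^ n / ennreal (V t) ^ (n - 1) \<le> ?H s ^ n / ennreal (V s) ^ (n - 1)"
    \<comment> \<open>If discs had infinite Hausdorff measure, the quotient would be \<open>\<infinity>\<close>; ruling this out would be extra work.\<close>
  proof (cases "disc_area TYPE('n) (n - 1) = \<infinity>")
    case True
    have "?H s = \<infinity>"
      using True cvx(2)[of s] int[OF s] by (intro hausdorff_frontier_infinite) (auto simp: compact_imp_bounded)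
    then have "?H s ^ n / ennreal (V s) ^ (n - 1) = \<infinity>"
      using n by (simp add: ennreal_top_divide ennreal_power V0 top_power_ennreal)
    then show ?thesis by simp
  next
    case False
    then have fin: "disc_area TYPE('n) (n - 1) < \<infinity>" by (simp add: less_top)
    obtain \<kappa> where \<kappa>: "disc_area TYPE('n) (n - 1) = ennreal \<kappa>" "\<kappa> \<ge> 0"
      using fin by (cases "disc_area TYPE('n) (n - 1)") auto
    have outer: "ennreal \<kappa> * V r + ?H r * cylinder_volume TYPE('n) h \<le> ennreal \<kappa> * V (r + h)"
      if "r \<in> ?J" "h > 0" for r h
      using body_outer[OF that(2) fin cvx int[OF that(1)] Z[of "r + h"] cball_subset_offset_body]
      unfolding eV \<kappa>(1) .
    have inner: "ennreal \<kappa> * V r \<le> ennreal \<kappa> * V (r - h) + ?H r * cylinder_volume TYPE('n) h"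
      if "r \<in> ?J" "h > 0" for r h
      using body_inner[OF that(2) fin cvx int[OF that(1)] Z[of "r - h"]
          offset_body_if_cball_subset[OF less_imp_le[OF that(2)]]]
      unfolding eV \<kappa>(1) .
    \<comment> \<open>With \<open>h = 1\<close> the outer estimate bounds the area times a positive
      cylinder volume by a finite number.\<close>
    have Hfin: "?H r < \<infinity>" if "r \<in> ?J" for r
    proof -
      have "?H r * cylinder_volume TYPE('n) 1 \<le> ennreal \<kappa> * V (r + 1)"
        using outer[OF that, of 1] by (auto intro: order_trans[rotated])
      also have "\<dots> < \<infinity>" by (simp add: ennreal_mult_less_top)
      finally show ?thesis
        using cylinder_volume_pos[of 1, where ?'n = 'n] by (auto simp: ennreal_mult_less_top less_top)
    qed
    obtain a where a: "?H t = ennreal a" "a \<ge> 0" using Hfin[OF t] by (cases "?H t") auto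
    obtain b where b: "?H s = ennreal b" "b \<ge> 0" using Hfin[OF s] by (cases "?H s") auto
    \<comment> \<open>\<open>s - h\<close> must stay in the range where \<open>f\<close> is known to
      be concave; for \<open>t + h\<close> this is automatic.\<close>
    have step: "a * f (s - h) ^ (n - 1) \<le> b * f (t + h) ^ (n - 1)" if h: "h > 0" "s - h \<in> ?J" for h
    proof -
      obtain m where m: "cylinder_volume TYPE('n) h = ennreal m" "m > 0"
        using cylinder_volume_pos[OF h(1), where ?'n = 'n] cylinder_volume_finite[OF h(1), where ?'n = 'n]
        by (cases "cylinder_volume TYPE('n) h") auto
      show ?thesis
      proof (rule surface_quotient_step[where h = h and s = s and t = t and f = f, OF n \<kappa>(2) m(2)])
        have "ennreal (\<kappa> * V t + a * m) \<le> ennreal (\<kappa> * V (t + h))"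
          using outer[OF t h(1)] \<kappa> a m V0 by (simp add: ennreal_mult ennreal_plus)
        then have "\<kappa> * V t + a * m \<le> \<kappa> * V (t + h)"
          using \<kappa> V0 by (subst (asm) ennreal_le_iff) auto
        then show "\<kappa> * f t ^ n + a * m \<le> \<kappa> * f (t + h) ^ n" by (simp only: fV)
        have "ennreal (\<kappa> * V s) \<le> ennreal (\<kappa> * V (s - h) + b * m)"
          using inner[OF s h(1)] \<kappa> b m V0 by (simp add: ennreal_mult ennreal_plus)
        then have "\<kappa> * V s \<le> \<kappa> * V (s - h) + b * m"
          using \<kappa> V0 b m by (subst (asm) ennreal_le_iff) auto
        then show "\<kappa> * f s ^ n \<le> \<kappa> * f (s - h) ^ n + b * m" by (simp only: fV)
        show "f (t + h) - f t \<le> f s - f (s - h)"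
          using convex_on_outer_sum[OF conv h(2) _ st h(1)] h t by simp
      qed (use f0 fmono h in auto)
    qed
    have cont: "continuous_on ?J f"
      using continuous_on_minus[OF convex_on_continuous[OF _ conv]] by simp
    \<comment> \<open>Used with \<open>c = 1\<close> at \<open>t\<close> and \<open>c = - 1\<close>
      at \<open>s\<close>: the limits are taken from outside the interval between them.\<close>
    have lim: "((\<lambda>h. f (r + c * h)) \<longlongrightarrow> f r) (at_right 0)" if "r \<in> ?J" for r c
    proof -
      have "isCont f r" using cont that by (simp add: continuous_on_eq_continuous_at)
      moreover have "((\<lambda>h. r + c * h) \<longlongrightarrow> r + c * 0) (at_right 0)" by (intro tendsto_intros)
      ultimately show ?thesis by (intro isCont_tendsto_compose[of r f]) auto
    qed
    have "a * f s ^ (n - 1) \<le> b * f t ^ (n - 1)"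
    proof (rule tendsto_le)
      show "((\<lambda>h. b * f (t + 1 * h) ^ (n - 1)) \<longlongrightarrow> b * f t ^ (n - 1)) (at_right 0)"
        by (intro tendsto_intros lim t)
      show "((\<lambda>h. a * f (s + (- 1) * h) ^ (n - 1)) \<longlongrightarrow> a * f s ^ (n - 1)) (at_right 0)"
        by (intro tendsto_intros lim s)
      have "\<forall>\<^sub>F h in at_right 0. h < s + inradius K (cball 0 1)"
        using s by (intro eventually_at_rightI[of 0 "s + inradius K (cball 0 1)"]) auto
      then show "\<forall>\<^sub>F h in at_right 0. a * f (s + (- 1) * h) ^ (n - 1) \<le> b * f (t + 1 * h) ^ (n - 1)"
        using eventually_at_right_less[of 0] by eventually_elim (use step in auto)
    qed simp
    \<comment> \<open>Taking the \<open>n\<close>-th power turns \<open>f\<close> into the volume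
      and gives the cross-multiplied form of the claim.\<close>
    then have "(a * f s ^ (n - 1)) ^ n \<le> (b * f t ^ (n - 1)) ^ n"
      using a f0 by (intro power_mono) auto
    moreover have "(c * f r ^ (n - 1)) ^ n = c ^ n * V r ^ (n - 1)" for c r
    proof -
      have "(f r ^ (n - 1)) ^ n = (f r ^ n) ^ (n - 1)"
        by (simp add: power_mult[symmetric] mult.commute)
      then show ?thesis by (simp add: power_mult_distrib fV)
    qed
    ultimately have "a ^ n * V s ^ (n - 1) \<le> b ^ n * V t ^ (n - 1)" by simp
    then have "a ^ n / V t ^ (n - 1) \<le> b ^ n / V s ^ (n - 1)"
      using Vpos[OF s] Vpos[OF t] by (simp add: field_simps)
    then have "ennreal (a ^ n / V t ^ (n - 1)) \<le> ennreal (b ^ n / V s ^ (n - 1))"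
      by (rule ennreal_leI)
    then show ?thesis
      using a b Vpos[OF s] Vpos[OF t] by (simp add: divide_ennreal ennreal_power)
  qed
  then show "isoperimetric_quotient (parallel_body K (cball 0 1) s) \<ge> isoperimetric_quotient (parallel_body K (cball 0 1) t)"
    by (simp add: quot)
qed

end
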